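(* Let $n>1$ be an integer. There exists a finitely presented torsion-free group $G(n)$ with classifying space $K(G(n),1)$ a finite CW-complex such that the Sidki double $X(G(n))$ contains an element of order $n$. Moreover, the group $G(n)$ can be chosen so that the complex group ring $\mathbb{C}G(n)$ does not contain any non-trivial idempotent.
   Context: Sidki double: let $G$ be a group, $G^\psi$ a disjoint copy of $G$ and $\psi:G\to G^\psi$ an isomorphism, written $g\mapsto g^\psi$. With $[x,y]=x^{-1}y^{-1}xy$, the Sidki double of $G$ is the group $X(G)=\langle G, G^\psi \mid [g,g^\psi],\ g\in G\rangle$. An idempotent of a unital ring is called trivial if it equals $0$ or $1$. *)

theory Defs
  imports "HOL-Algebra.Multiplicative_Group" "HOL-Algebra.Generated_Groups" "HOL-Analysis.Analysis"
begin

section \<open>Group presentations and the Sidki double\<close>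

text \<open>
  A letter \<open>(x, True)\<close> is the generator \<open>x\<close>, and \<open>(x, False)\<close> is its inverse.
  The free group on \<open>S\<close> consists of the reduced words in such letters.
\<close>

type_synonym 'a word = "('a \<times> bool) list"

definition cancels :: "'a \<times> bool \<Rightarrow> 'a \<times> bool \<Rightarrow> bool" where
  "cancels a b \<longleftrightarrow> fst a = fst b \<and> snd a \<noteq> snd b"

definition reduced :: "'a word \<Rightarrow> bool" where
  "reduced w \<longleftrightarrow> successively (\<lambda>a b. \<not> cancels a b) w"

text \<open>Reduced form of \<open>a # w\<close>, for reduced \<open>w\<close>.\<close>

fun push :: "'a \<times> bool \<Rightarrow> 'a word \<Rightarrow> 'a word" where
  "push a [] = [a]"
| "push a (b # w) = (if cancels a b then w else a # b # w)"

definition free_group :: "'a set \<Rightarrow> 'a word monoid" where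
  "free_group S =
     \<lparr>carrier = {w. fst ` set w \<subseteq> S \<and> reduced w}, monoid.mult = foldr push, one = []\<rparr>"

definition gen :: "'a \<Rightarrow> 'a word" where
  "gen x = [(x, True)]"

definition normal_closure :: "('a, 'b) monoid_scheme \<Rightarrow> 'a set \<Rightarrow> 'a set" where
  "normal_closure G R =
     generate G {g \<otimes>\<^bsub>G\<^esub> r \<otimes>\<^bsub>G\<^esub> inv\<^bsub>G\<^esub> g | g r. g \<in> carrier G \<and> r \<in> R}"

definition presented_group :: "'a set \<Rightarrow> 'a word set \<Rightarrow> 'a word set monoid" where
  "presented_group S R = free_group S Mod normal_closure (free_group S) R"

text \<open>Finite generating sets may be taken inside \<^typ>\<open>nat\<close> without loss of generality.\<close>

definition finitely_presented :: "('a, 'b) monoid_scheme \<Rightarrow> bool" where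
  "finitely_presented G \<longleftrightarrow>
     (\<exists>(S :: nat set) R. finite S \<and> finite R \<and> R \<subseteq> carrier (free_group S) \<and>
        G \<cong> presented_group S R)"

definition torsion_free :: "('a, 'b) monoid_scheme \<Rightarrow> bool" where
  "torsion_free G \<longleftrightarrow>
     (\<forall>x\<in>carrier G. \<forall>n::nat. n > 0 \<and> x [^]\<^bsub>G\<^esub> n = \<one>\<^bsub>G\<^esub> \<longrightarrow> x = \<one>\<^bsub>G\<^esub>)"

definition commutator :: "('a, 'b) monoid_scheme \<Rightarrow> 'a \<Rightarrow> 'a \<Rightarrow> 'a" where
  "commutator G x y = inv\<^bsub>G\<^esub> x \<otimes>\<^bsub>G\<^esub> inv\<^bsub>G\<^esub> y \<otimes>\<^bsub>G\<^esub> x \<otimes>\<^bsub>G\<^esub> y"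

text \<open>
  The disjoint copies \<open>G\<close> and \<open>G\<^sup>\<psi>\<close> are tagged by \<^term>\<open>Inl\<close> and \<^term>\<open>Inr\<close>, so that
  \<open>\<psi>\<close> sends \<^term>\<open>Inl g\<close> to \<^term>\<open>Inr g\<close>. As usual, having groups among the generators of
  a presentation means that all relations of these groups are imposed: these are
  \<open>sidki_table\<close>, the multiplication tables of both copies.
\<close>

abbreviation sidki_free :: "('a, 'b) monoid_scheme \<Rightarrow> ('a + 'a) word monoid" where
  "sidki_free G \<equiv> free_group (Inl ` carrier G \<union> Inr ` carrier G)"

definition sidki_table :: "('a, 'b) monoid_scheme \<Rightarrow> ('a + 'a) word set" where
  "sidki_table G =
     {gen (c g) \<otimes>\<^bsub>sidki_free G\<^esub> gen (c h) \<otimes>\<^bsub>sidki_free G\<^esub> inv\<^bsub>sidki_free G\<^esub> gen (c (g \<otimes>\<^bsub>G\<^esub> h)) |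
        c g h. c \<in> {Inl, Inr} \<and> g \<in> carrier G \<and> h \<in> carrier G}"

definition sidki_double :: "('a, 'b) monoid_scheme \<Rightarrow> ('a + 'a) word set monoid" where
  "sidki_double G =
     presented_group (Inl ` carrier G \<union> Inr ` carrier G)
       (sidki_table G \<union>
        {commutator (sidki_free G) (gen (Inl g)) (gen (Inr g)) | g. g \<in> carrier G})"


subsection \<open>These are groups\<close>

lemma cancels_flip [simp]: "cancels (x, \<not> s) (x, s)" "cancels (x, s) (x, \<not> s)"
  by (auto simp: cancels_def)

lemma reduced_Cons: "reduced (a # w) \<longleftrightarrow> reduced w \<and> (w = [] \<or> \<not> cancels a (hd w))"
  by (cases w) (auto simp: reduced_def)

lemma reduced_push: "reduced w \<Longrightarrow> reduced (push a w)"
  by (cases w) (auto simp: reduced_Cons)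

lemma reduced_foldr_push: "reduced w \<Longrightarrow> reduced (foldr push u w)"
  by (induction u) (auto simp: reduced_push)

lemma push_push: "reduced w \<Longrightarrow> cancels a b \<Longrightarrow> push a (push b w) = w"
  by (cases w; cases "tl w") (auto simp: reduced_Cons cancels_def prod_eq_iff)

lemma set_push: "set (push a w) \<subseteq> insert a (set w)"
  by (cases w) auto

lemma set_foldr_push: "set (foldr push u w) \<subseteq> set u \<union> set w"
  using set_push by (induction u) fastforce+

lemma foldr_push_push: "reduced w \<Longrightarrow> foldr push (push a v) w = push a (foldr push v w)"
  by (cases v) (auto simp: push_push reduced_foldr_push)

lemma foldr_push_assoc:
  "reduced w \<Longrightarrow> foldr push (foldr push u v) w = foldr push u (foldr push v w)"
  by (induction u) (auto simp: foldr_push_push)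

lemma foldr_push_inverse: "foldr push (rev (map (apsnd Not) u)) u = []"
  by (induction u) (auto simp: cancels_def)

lemma group_free_group: "group (free_group S)"
proof (rule groupI)
  fix x assume x: "x \<in> carrier (free_group S)"
  let ?y = "foldr push (rev (map (apsnd Not) x)) []"
  have "reduced ?y"
    by (intro reduced_foldr_push) (simp add: reduced_def)
  moreover have "fst ` set ?y \<subseteq> fst ` set (map (apsnd Not) x)"
    using set_foldr_push[of "rev (map (apsnd Not) x)" "[]"] by (intro image_mono) simp
  ultimately have "?y \<in> carrier (free_group S)"
    using x by (force simp: free_group_def)
  moreover have "foldr push ?y x = []"
    using x foldr_push_assoc[of x "rev (map (apsnd Not) x)" "[]"]
    by (simp add: free_group_def foldr_push_inverse)
  ultimately show "\<exists>y\<in>carrier (free_group S). y \<otimes>\<^bsub>free_group S\<^esub> x = \<one>\<^bsub>free_group S\<^esub>"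
    by (auto simp: free_group_def)
next
  fix x y assume "x \<in> carrier (free_group S)" "y \<in> carrier (free_group S)"
  then show "x \<otimes>\<^bsub>free_group S\<^esub> y \<in> carrier (free_group S)"
    using set_foldr_push[of x y] by (fastforce simp: free_group_def reduced_foldr_push)
qed (auto simp: free_group_def foldr_push_assoc reduced_def)

lemma (in group) normal_normal_closure:
  assumes R: "R \<subseteq> carrier G"
  shows "normal_closure G R \<lhd> G"
  unfolding normal_closure_def
proof (rule normal_generateI)
  show "{g \<otimes> r \<otimes> inv g | g r. g \<in> carrier G \<and> r \<in> R} \<subseteq> carrier G"
    using R by auto
next
  fix h k assume "h \<in> {g \<otimes> r \<otimes> inv g | g r. g \<in> carrier G \<and> r \<in> R}" and k: "k \<in> carrier G"
  then obtain g r where h: "h = g \<otimes> r \<otimes> inv g" "g \<in> carrier G" "r \<in> R" by auto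
  then have "k \<otimes> h \<otimes> inv k = (k \<otimes> g) \<otimes> r \<otimes> inv (k \<otimes> g)"
    using k R by (auto simp: m_assoc inv_mult_group subset_iff)
  then show "k \<otimes> h \<otimes> inv k \<in> {g \<otimes> r \<otimes> inv g | g r. g \<in> carrier G \<and> r \<in> R}"
    using h k by blast
qed

lemma group_presented_group:
  "R \<subseteq> carrier (free_group S) \<Longrightarrow> group (presented_group S R)"
  unfolding presented_group_def
  by (intro normal.factorgroup_is_group group.normal_normal_closure group_free_group)

lemma group_sidki_double:
  assumes "group G"
  shows "group (sidki_double G)"
proof -
  interpret G: group G by fact
  interpret F: group "sidki_free G" by (rule group_free_group)
  have gen: "gen (Inl g) \<in> carrier (sidki_free G)" "gen (Inr g) \<in> carrier (sidki_free G)"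
    if "g \<in> carrier G" for g
    using that by (auto simp: gen_def free_group_def reduced_def)
  show ?thesis
    unfolding sidki_double_def sidki_table_def commutator_def
    by (rule group_presented_group) (auto intro!: F.m_closed F.inv_closed gen)
qed


section \<open>Complex group rings\<close>

definition complex_group_ring :: "('a, 'b) monoid_scheme \<Rightarrow> ('a \<Rightarrow> complex) ring" where
  "complex_group_ring G =
     \<lparr>carrier = {f. finite {x. f x \<noteq> 0} \<and> {x. f x \<noteq> 0} \<subseteq> carrier G},
      monoid.mult = (\<lambda>f g x. \<Sum>(y, z) | f y \<noteq> 0 \<and> g z \<noteq> 0 \<and> y \<otimes>\<^bsub>G\<^esub> z = x. f y * g z),
      monoid.one = (\<lambda>x. if x = \<one>\<^bsub>G\<^esub> then 1 else 0),
      ring.zero = (\<lambda>x. 0),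
      ring.add = (\<lambda>f g x. f x + g x)\<rparr>"

definition only_trivial_idempotents :: "('a, 'b) ring_scheme \<Rightarrow> bool" where
  "only_trivial_idempotents R \<longleftrightarrow>
     (\<forall>e\<in>carrier R. e \<otimes>\<^bsub>R\<^esub> e = e \<longrightarrow> e = \<zero>\<^bsub>R\<^esub> \<or> e = \<one>\<^bsub>R\<^esub>)"


section \<open>CW complexes\<close>

text \<open>For \<open>n = 0\<close> the closed and the open disc are a point and the boundary sphere is empty.\<close>

definition closed_disc :: "nat \<Rightarrow> (nat \<Rightarrow> real) topology" where
  "closed_disc n = subtopology (Euclidean_space n) {x. (\<Sum>i<n. (x i)\<^sup>2) \<le> 1}"

definition open_disc :: "nat \<Rightarrow> (nat \<Rightarrow> real) set" where
  "open_disc n = {x \<in> topspace (Euclidean_space n). (\<Sum>i<n. (x i)\<^sup>2) < 1}"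

definition disc_boundary :: "nat \<Rightarrow> (nat \<Rightarrow> real) set" where
  "disc_boundary n = {x \<in> topspace (Euclidean_space n). (\<Sum>i<n. (x i)\<^sup>2) = 1}"

text \<open>
  A CW structure on \<open>X\<close>: a cell of dimension \<open>d i\<close> with characteristic map \<open>\<Phi> i\<close> for each
  \<open>i \<in> I\<close>. The last two conditions are closure finiteness and the weak topology.
\<close>

definition CW_structure ::
  "'a topology \<Rightarrow> 'i set \<Rightarrow> ('i \<Rightarrow> nat) \<Rightarrow> ('i \<Rightarrow> (nat \<Rightarrow> real) \<Rightarrow> 'a) \<Rightarrow> bool" where
  "CW_structure X I d \<Phi> \<longleftrightarrow>
     Hausdorff_space X \<and>
     (\<forall>i\<in>I. continuous_map (closed_disc (d i)) X (\<Phi> i) \<and>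
            embedding_map (subtopology (closed_disc (d i)) (open_disc (d i))) X (\<Phi> i)) \<and>
     disjoint_family_on (\<lambda>i. \<Phi> i ` open_disc (d i)) I \<and>
     (\<Union>i\<in>I. \<Phi> i ` open_disc (d i)) = topspace X \<and>
     (\<forall>i\<in>I. \<exists>J\<subseteq>I. finite J \<and> (\<forall>j\<in>J. d j < d i) \<and>
            \<Phi> i ` disc_boundary (d i) \<subseteq> (\<Union>j\<in>J. \<Phi> j ` open_disc (d j))) \<and>
     (\<forall>A\<subseteq>topspace X. closedin X A \<longleftrightarrow>
        (\<forall>i\<in>I. closedin (closed_disc (d i)) {x \<in> topspace (closed_disc (d i)). \<Phi> i x \<in> A}))"

definition finite_CW_complex :: "'a topology \<Rightarrow> bool" where
  "finite_CW_complex X \<longleftrightarrow> (\<exists>(I :: nat set) d \<Phi>. finite I \<and> CW_structure X I d \<Phi>)"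


section \<open>Homotopy groups and classifying spaces\<close>

definition loop_at :: "'a topology \<Rightarrow> 'a \<Rightarrow> (real \<Rightarrow> 'a) \<Rightarrow> bool" where
  "loop_at X x0 p \<longleftrightarrow> pathin X p \<and> p 0 = x0 \<and> p 1 = x0"

definition loop_homotopic :: "'a topology \<Rightarrow> 'a \<Rightarrow> (real \<Rightarrow> 'a) \<Rightarrow> (real \<Rightarrow> 'a) \<Rightarrow> bool" where
  "loop_homotopic X x0 = homotopic_with (\<lambda>p. p 0 = x0 \<and> p 1 = x0) (top_of_set {0..1}) X"

definition loop_class :: "'a topology \<Rightarrow> 'a \<Rightarrow> (real \<Rightarrow> 'a) \<Rightarrow> (real \<Rightarrow> 'a) set" where
  "loop_class X x0 p = {q. loop_homotopic X x0 p q}"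

definition loop_concat :: "(real \<Rightarrow> 'a) \<Rightarrow> (real \<Rightarrow> 'a) \<Rightarrow> real \<Rightarrow> 'a" where
  "loop_concat p q = (\<lambda>t. if t \<le> 1/2 then p (2 * t) else q (2 * t - 1))"

definition fundamental_group :: "'a topology \<Rightarrow> 'a \<Rightarrow> (real \<Rightarrow> 'a) set monoid" where
  "fundamental_group X x0 =
     \<lparr>carrier = {loop_class X x0 p | p. loop_at X x0 p},
      monoid.mult = (\<lambda>A B. \<Union>p\<in>A. \<Union>q\<in>B. loop_class X x0 (loop_concat p q)),
      one = loop_class X x0 (\<lambda>_. x0)\<rparr>"

text \<open>
  Triviality of \<open>\<pi>\<^sub>k(X, x0)\<close>, whose elements are the classes of based maps from the
  \<open>k\<close>-sphere to \<open>X\<close> under based homotopy.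
\<close>

definition sphere_basepoint :: "nat \<Rightarrow> real" where
  "sphere_basepoint = (\<lambda>i. if i = 0 then 1 else 0)"

definition trivial_homotopy_group :: "nat \<Rightarrow> 'a topology \<Rightarrow> 'a \<Rightarrow> bool" where
  "trivial_homotopy_group k X x0 \<longleftrightarrow>
     (\<forall>f. continuous_map (nsphere k) X f \<and> f sphere_basepoint = x0 \<longrightarrow>
        homotopic_with (\<lambda>h. h sphere_basepoint = x0) (nsphere k) X f (\<lambda>_. x0))"

definition Eilenberg_MacLane_1 :: "('g, 'b) monoid_scheme \<Rightarrow> 'a topology \<Rightarrow> bool" where
  "Eilenberg_MacLane_1 G X \<longleftrightarrow>
     path_connected_space X \<and>
     (\<exists>x0\<in>topspace X. fundamental_group X x0 \<cong> G \<and>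
        (\<forall>k\<ge>2. trivial_homotopy_group k X x0))"

text \<open>
  Every finite CW complex embeds in some Euclidean space, so it loses no generality to ask for
  one whose points lie in \<^typ>\<open>nat \<Rightarrow> real\<close>; its topology is arbitrary.
\<close>

definition has_finite_classifying_space :: "('g, 'b) monoid_scheme \<Rightarrow> bool" where
  "has_finite_classifying_space G \<longleftrightarrow>
     (\<exists>X :: (nat \<Rightarrow> real) topology. finite_CW_complex X \<and> Eilenberg_MacLane_1 G X)"

end

theory Submission
  imports Defs
begin

text \<open>
  Put \<open>m = n + 1\<close> and \<open>G = BS(1, m) \<times> \<int> = \<langle>a, t, c | a t = t a\<^sup>m, c central\<rangle>\<close>, which embeds
  as \<open>(\<int>[1/m] \<rtimes> \<langle>t\<rangle>) \<times> \<langle>c\<rangle>\<close>. The lexicographic order is a bi-order on \<open>G\<close>, so \<open>G\<close> is torsion-free, and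
  the largest and the smallest element of the support of an idempotent of the group ring can only
  be \<open>1\<close>.

  The space \<open>K(G, 1)\<close> is the mapping torus of the map \<open>(x, y) \<mapsto> (m x, y)\<close> of the torus, with one cell
  for each subset of \<open>{0, 1, 2}\<close>. Flowing forwards far enough pushes a map of a simply connected
  compact space into a single torus fibre, where it lifts to the plane and is null-homotopic. The
  fundamental group is read off from the end points of lifts of the developing map, which are unique
  because the values of that map over a point form a countable set.

  In the Sidki double consider \<open>w = [a, c\<^sup>\<psi>]\<close> and \<open>k = c\<^sup>-\<^sup>1 c\<^sup>\<psi>\<close>. The conjugates \<open>k\<^sup>g\<close>, \<open>g \<in> G\<close>, commute with
  each other and satisfy Jensen's equation in \<open>g\<close>. As \<open>a\<^sup>n\<close> is a commutator, this forces \<open>w\<close> to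
  have finite order. Conversely, let \<open>v\<close> be the image of \<open>g\<close> in \<open>(\<int>/n)\<^sup>2\<close> given by the exponents of \<open>a\<close> and
  \<open>c\<close>; then \<open>g \<mapsto> (v, 0)\<close>, \<open>g\<^sup>\<psi> \<mapsto> (0, v)\<close> is a homomorphism to a central extension of
  \<open>(\<int>/n)\<^sup>4\<close> by \<open>\<int>/n\<close> whose cocycle is the determinant. It maps \<open>w\<close> to an element of order \<open>n\<close>, so
  some power of \<open>w\<close> has order \<open>n\<close>.
\<close>

section \<open>Homomorphisms out of presented groups\<close>

text \<open>The choice \<open>m = n + 1\<close> serves both bounds. In the abelianization of BS(1,
  m) the image of \<open>a\<close> has order exactly \<open>m - 1 = n\<close>, which feeds the lower
  bound. For the upper bound, write Jensen's equation additively with solution \<open>f\<close>: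
  along \<open>t\<close> and along \<open>t t\<close> it gives two linear relations between
  \<open>f a\<close> and the slope of \<open>f\<close> at \<open>t\<close>, and eliminating the
  slope leaves n^3 f(a) = 0. The order of \<open>w\<close> itself is not determined; it is a divisor
  of n^3 and a multiple of n.

  The topological obstacle is that the gluing map x -> m x is not injective, so the unrolling map
  from R^3 to the mapping torus is not a covering. The coordinates s and y lift as real logarithms
  of circle-valued functions, but x is determined only modulo m^(-floor s) Z, a group that grows
  with the level s. On a compact domain s stays below some N, and there m^N x is a well-defined
  circle coordinate. Lifting it and dividing by m^N gives x up to m^(-N) Z, an error that disappears
  once everything has flowed up to level N.\<close>

definition letter :: "('b, 'c) monoid_scheme \<Rightarrow> ('a \<Rightarrow> 'b) \<Rightarrow> 'a \<times> bool \<Rightarrow> 'b" where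
  "letter H \<phi> x = (if snd x then \<phi> (fst x) else inv\<^bsub>H\<^esub> \<phi> (fst x))"

definition eval_word :: "('b, 'c) monoid_scheme \<Rightarrow> ('a \<Rightarrow> 'b) \<Rightarrow> 'a word \<Rightarrow> 'b" where
  "eval_word H \<phi> w = foldr (\<lambda>x y. letter H \<phi> x \<otimes>\<^bsub>H\<^esub> y) w \<one>\<^bsub>H\<^esub>"

lemma eval_word_simps [simp]:
  "eval_word H \<phi> [] = \<one>\<^bsub>H\<^esub>"
  "eval_word H \<phi> (x # w) = letter H \<phi> x \<otimes>\<^bsub>H\<^esub> eval_word H \<phi> w"
  by (auto simp: eval_word_def)

lemma carrier_free_group: "w \<in> carrier (free_group S) \<longleftrightarrow> fst ` set w \<subseteq> S \<and> reduced w"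
  by (simp add: free_group_def)

lemma gen_in_free_group [simp]: "gen x \<in> carrier (free_group S) \<longleftrightarrow> x \<in> S"
  by (simp add: carrier_free_group gen_def reduced_def)

lemma inv_gen: "x \<in> S \<Longrightarrow> inv\<^bsub>free_group S\<^esub> gen x = [(x, False)]"
  by (rule group.inv_equality[OF group_free_group])
     (auto simp: gen_def free_group_def reduced_def cancels_def)

text \<open>The first letter of a reduced word does not cancel against the rest, so
  \<open>push\<close> is plain consing; this is what permits induction over reduced words.\<close>

lemma free_group_Cons:
  assumes "x # w \<in> carrier (free_group S)"
  shows "x # w = letter (free_group S) gen x \<otimes>\<^bsub>free_group S\<^esub> w"
    and "fst x \<in> S" and "w \<in> carrier (free_group S)"
proof -
  show 1: "fst x \<in> S" and "w \<in> carrier (free_group S)"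
    using assms by (auto simp: carrier_free_group reduced_Cons)
  have "push x w = x # w"
    using assms by (cases w) (auto simp: carrier_free_group reduced_Cons)
  then show "x # w = letter (free_group S) gen x \<otimes>\<^bsub>free_group S\<^esub> w"
    using 1 by (cases x) (auto simp: letter_def inv_gen, auto simp: free_group_def gen_def)
qed

context group
begin

lemma letter_closed [simp]: "\<phi> (fst x) \<in> carrier G \<Longrightarrow> letter G \<phi> x \<in> carrier G"
  by (simp add: letter_def)

lemma eval_word_closed:
  assumes "\<And>x. x \<in> S \<Longrightarrow> \<phi> x \<in> carrier G" "fst ` set w \<subseteq> S"
  shows "eval_word G \<phi> w \<in> carrier G"
  using assms(2) by (induction w) (auto simp: assms(1))

lemma letter_cancels:
  "cancels x y \<Longrightarrow> \<phi> (fst x) \<in> carrier G \<Longrightarrow> letter G \<phi> x \<otimes> letter G \<phi> y = \<one>"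
  by (auto simp: letter_def cancels_def)

lemma eval_word_push:
  assumes "\<And>x. x \<in> S \<Longrightarrow> \<phi> x \<in> carrier G" "fst x \<in> S" "fst ` set w \<subseteq> S"
  shows "eval_word G \<phi> (push x w) = letter G \<phi> x \<otimes> eval_word G \<phi> w"
proof (cases "\<exists>y v. w = y # v \<and> cancels x y")
  case True
  then obtain y v where w: "w = y # v" "cancels x y" by blast
  have "eval_word G \<phi> v \<in> carrier G"
    using eval_word_closed[of S \<phi> v] assms w by auto
  then show ?thesis
    using w letter_cancels[of x y \<phi>] assms by (auto simp flip: m_assoc)
next
  case False
  then have "push x w = x # w"
    by (cases w) auto
  then show ?thesis by simp
qed

text \<open>Universal property of the free group. As the product is \<open>foldr push\<close>,
  induction on the left factor leaves the case of one letter, where \<open>push\<close> either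
  conses or deletes a pair of letters with inverse values.\<close>

lemma eval_word_hom:
  assumes "\<And>x. x \<in> S \<Longrightarrow> \<phi> x \<in> carrier G"
  shows "eval_word G \<phi> \<in> hom (free_group S) G"
proof (rule homI)
  show "eval_word G \<phi> w \<in> carrier G" if "w \<in> carrier (free_group S)" for w
    using that eval_word_closed[of S \<phi>] assms by (simp add: carrier_free_group)
next
  fix u v assume "u \<in> carrier (free_group S)" and v: "v \<in> carrier (free_group S)"
  then have "fst ` set u \<subseteq> S" "fst ` set v \<subseteq> S" by (auto simp: carrier_free_group)
  then show "eval_word G \<phi> (u \<otimes>\<^bsub>free_group S\<^esub> v) = eval_word G \<phi> u \<otimes> eval_word G \<phi> v"
  proof (induction u)
    case (Cons x u)
    have "fst ` set (foldr push u v) \<subseteq> S"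
      using set_foldr_push[of u v] Cons.prems by fastforce
    then show ?case
      using Cons eval_word_push[of S \<phi> x "foldr push u v"] assms eval_word_closed[of S \<phi>]
      by (simp add: free_group_def m_assoc)
  qed (use assms eval_word_closed[of S \<phi>] in \<open>simp add: free_group_def\<close>)
qed

end

lemma eval_word_gen [simp]: "group H \<Longrightarrow> \<phi> x \<in> carrier H \<Longrightarrow> eval_word H \<phi> (gen x) = \<phi> x"
  by (simp add: gen_def letter_def group.is_monoid)

text \<open>Von Dyck: conjugates of killed relators are killed, and the kernel is a
  subgroup.\<close>

lemma (in group_hom) normal_closure_subset_kernel:
  assumes "R \<subseteq> carrier G" "\<And>r. r \<in> R \<Longrightarrow> h r = \<one>\<^bsub>H\<^esub>"
  shows "normal_closure G R \<subseteq> kernel G H h"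
  unfolding normal_closure_def
  by (rule G.generate_subgroup_incl[OF _ subgroup_kernel]) (use assms in \<open>auto simp: kernel_def\<close>)

locale presentation =
  fixes S :: "'a set" and R :: "'a word set"
  assumes R: "R \<subseteq> carrier (free_group S)"
begin

abbreviation "F \<equiv> free_group S"
abbreviation "N \<equiv> normal_closure F R"
abbreviation "P \<equiv> presented_group S R"

sublocale F: group F by (rule group_free_group)
sublocale N: normal N F by (rule F.normal_normal_closure[OF R])
sublocale P: group P by (rule group_presented_group[OF R])

definition pr :: "'a word \<Rightarrow> 'a word set" where "pr w = N #>\<^bsub>F\<^esub> w"

lemma pr_hom: "group_hom F P pr"
  unfolding group_hom_def group_hom_axioms_def pr_def presented_group_def
  by (simp add: F.group_axioms N.factorgroup_is_group N.r_coset_hom_Mod)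

sublocale pr: group_hom F P pr by (rule pr_hom)

lemma pr_eq_one_iff: "w \<in> carrier F \<Longrightarrow> pr w = \<one>\<^bsub>P\<^esub> \<longleftrightarrow> w \<in> N"
  using F.coset_join1[OF _ _ N.subgroup_axioms, of w] F.coset_join2[OF _ N.subgroup_axioms, of w]
  by (auto simp: presented_group_def FactGroup_def pr_def)

lemma pr_relator: "r \<in> R \<Longrightarrow> pr r = \<one>\<^bsub>P\<^esub>"
proof -
  assume r: "r \<in> R"
  have "\<one>\<^bsub>F\<^esub> \<otimes>\<^bsub>F\<^esub> r \<otimes>\<^bsub>F\<^esub> inv\<^bsub>F\<^esub> \<one>\<^bsub>F\<^esub> = r"
    using r R by (auto simp: subset_iff)
  with r have "r \<in> N"
    unfolding normal_closure_def by (intro generate.incl) (metis (mono_tags, lifting) CollectI F.one_closed)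
  then show ?thesis
    using r R pr_eq_one_iff by blast
qed

end

section \<open>Ordered groups\<close>

locale ordered_group = group G for G (structure) +
  fixes less :: "'a \<Rightarrow> 'a \<Rightarrow> bool" (infix \<open>\<sqsubset>\<close> 50)
  assumes irrefl: "x \<in> carrier G \<Longrightarrow> \<not> x \<sqsubset> x"
    and less_trans: "x \<in> carrier G \<Longrightarrow> y \<in> carrier G \<Longrightarrow> z \<in> carrier G \<Longrightarrow>
      x \<sqsubset> y \<Longrightarrow> y \<sqsubset> z \<Longrightarrow> x \<sqsubset> z"
    and total: "x \<in> carrier G \<Longrightarrow> y \<in> carrier G \<Longrightarrow> x \<noteq> y \<Longrightarrow> x \<sqsubset> y \<or> y \<sqsubset> x"
    and left_mono: "x \<in> carrier G \<Longrightarrow> y \<in> carrier G \<Longrightarrow> z \<in> carrier G \<Longrightarrow>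
      x \<sqsubset> y \<Longrightarrow> z \<otimes> x \<sqsubset> z \<otimes> y"
    and right_mono: "x \<in> carrier G \<Longrightarrow> y \<in> carrier G \<Longrightarrow> z \<in> carrier G \<Longrightarrow>
      x \<sqsubset> y \<Longrightarrow> x \<otimes> z \<sqsubset> y \<otimes> z"
begin

text \<open>Lets each statement about greatest elements be reused for least elements.\<close>

lemma ordered_group_converse: "ordered_group G (\<lambda>x y. y \<sqsubset> x)"
proof unfold_locales
  show "z \<sqsubset> x" if "x \<in> carrier G" "y \<in> carrier G" "z \<in> carrier G" "y \<sqsubset> x" "z \<sqsubset> y" for x y z
    using that less_trans[of z y x] by blast
qed (use irrefl total left_mono right_mono in auto)

lemma pow_greater_one:
  fixes n :: nat
  assumes "x \<in> carrier G" "\<one> \<sqsubset> x" "n > 0"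
  shows "\<one> \<sqsubset> x [^] n"
  using assms(3)
proof (induction n rule: nat_induct_non_zero)
  case (Suc n)
  then have "x [^] n \<otimes> \<one> \<sqsubset> x [^] n \<otimes> x"
    using assms by (intro left_mono) auto
  then show ?case
    using Suc assms less_trans[of \<one> "x [^] n" "x [^] Suc n"] by simp
qed (use assms in simp)

lemma torsion_free: "torsion_free G"
  unfolding torsion_free_def
proof (intro ballI allI impI, rule ccontr)
  fix x n assume x: "x \<in> carrier G" and n: "n > 0 \<and> x [^] (n::nat) = \<one>" and "x \<noteq> \<one>"
  interpret op: ordered_group G "\<lambda>x y. y \<sqsubset> x" by (rule ordered_group_converse)
  have "\<one> \<sqsubset> x \<or> x \<sqsubset> \<one>"
    using total[OF one_closed x] \<open>x \<noteq> \<one>\<close> by auto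
  then show False
    using pow_greater_one[of x n] op.pow_greater_one[of x n] x n irrefl by auto
qed

section \<open>Idempotents in the group ring of a bi-ordered group\<close>

lemma greatest_exists:
  assumes "finite A" "A \<noteq> {}" "A \<subseteq> carrier G"
  shows "\<exists>m\<in>A. \<forall>x\<in>A. x = m \<or> x \<sqsubset> m"
  using assms
proof (induction A rule: finite_ne_induct)
  case (insert x A)
  then obtain m where m: "m \<in> A" "\<forall>y\<in>A. y = m \<or> y \<sqsubset> m" by auto
  show ?case
  proof (cases "x = m \<or> x \<sqsubset> m")
    case False
    then have "m \<sqsubset> x" using total[of x m] insert m by auto
    then have "\<forall>y\<in>insert x A. y = x \<or> y \<sqsubset> x"
      using m less_trans insert.prems by (metis insert_iff subset_iff)
    then show ?thesis by blast
  qed (use m in auto)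
qed auto

text \<open>Consequently the top product of two support elements is attained by one pair only, and
  nothing can cancel its coefficient.\<close>

lemma mult_less:
  assumes "x \<in> carrier G" "y \<in> carrier G" "m \<in> carrier G"
    "x = m \<or> x \<sqsubset> m" "y = m \<or> y \<sqsubset> m" "x \<noteq> m \<or> y \<noteq> m"
  shows "x \<otimes> y \<sqsubset> m \<otimes> m"
proof (cases "y = m")
  case True
  then show ?thesis using assms right_mono[of x m m] by auto
next
  case False
  then have *: "x \<otimes> y \<sqsubset> x \<otimes> m" using assms left_mono[of y m x] by auto
  show ?thesis
  proof (cases "x = m")
    case False
    then have "x \<otimes> m \<sqsubset> m \<otimes> m" using assms right_mono[of x m m] by auto
    then show ?thesis using * assms less_trans[of "x \<otimes> y" "x \<otimes> m" "m \<otimes> m"] by simp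
  qed (use * in auto)
qed

text \<open>The coefficient of \<open>e e = e\<close> at \<open>m m\<close> is
  \<open>(e m)\<^sup>2\<close>, so \<open>m m\<close> lies in the support and is at most
  \<open>m\<close>. If it were smaller, then \<open>m\<close> would be below \<open>\<one>\<close>,
  every product of support elements would be at most \<open>m m\<close> and hence below
  \<open>m\<close>, and the coefficient at \<open>m\<close> would vanish. So
  \<open>m m = m\<close>.\<close>

lemma idempotent_greatest:
  assumes e: "e \<in> carrier (complex_group_ring G)"
    and idem: "e \<otimes>\<^bsub>complex_group_ring G\<^esub> e = e"
    and m: "e m \<noteq> 0" "\<And>x. e x \<noteq> 0 \<Longrightarrow> x = m \<or> x \<sqsubset> m"
  shows "m = \<one> \<and> e m = 1"
proof -
  have fin: "finite {x. e x \<noteq> 0}" and sub: "\<And>x. e x \<noteq> 0 \<Longrightarrow> x \<in> carrier G"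
    using e by (auto simp: complex_group_ring_def)
  have ee: "e x = (\<Sum>(y, z) | e y \<noteq> 0 \<and> e z \<noteq> 0 \<and> y \<otimes> z = x. e y * e z)" for x
    using fun_cong[OF idem, of x] by (simp add: complex_group_ring_def)
  have mc: "m \<in> carrier G" using m sub by auto
  have "{(y, z). e y \<noteq> 0 \<and> e z \<noteq> 0 \<and> y \<otimes> z = m \<otimes> m} = {(m, m)}"
  proof (intro equalityI subrelI)
    fix y z assume "(y, z) \<in> {(y, z). e y \<noteq> 0 \<and> e z \<noteq> 0 \<and> y \<otimes> z = m \<otimes> m}"
    then have yz: "e y \<noteq> 0" "e z \<noteq> 0" "y \<otimes> z = m \<otimes> m" by auto
    then have "\<not> y \<otimes> z \<sqsubset> m \<otimes> m" using irrefl[of "m \<otimes> m"] mc by simp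
    then show "(y, z) \<in> {(m, m)}"
      using mult_less[OF sub sub mc, OF yz(1,2) m(2)[OF yz(1)] m(2)[OF yz(2)]] by auto
  qed (use m in auto)
  then have 1: "e (m \<otimes> m) = e m * e m"
    using ee[of "m \<otimes> m"] by simp
  then have "e (m \<otimes> m) \<noteq> 0" using m by simp
  then have "m \<otimes> m = m \<or> m \<otimes> m \<sqsubset> m" using m by blast
  moreover have False if "m \<sqsubset> \<one>"
  proof -
    have "{(y, z). e y \<noteq> 0 \<and> e z \<noteq> 0 \<and> y \<otimes> z = m} = {}"
    proof (rule equals0I, clarify)
      fix y z assume yz: "e y \<noteq> 0" "e z \<noteq> 0" "m = y \<otimes> z"
      have "y \<otimes> z \<sqsubset> m \<otimes> m \<or> y \<otimes> z = m \<otimes> m"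
      proof (cases "y = m \<and> z = m")
        case False
        then show ?thesis
          using mult_less[OF sub sub mc, OF yz(1,2) m(2)[OF yz(1)] m(2)[OF yz(2)]] by simp
      qed simp
      moreover have "m \<otimes> m \<sqsubset> m" using left_mono[of m \<one> m] that mc by simp
      moreover have "\<not> (m \<sqsubset> m \<otimes> m \<and> m \<otimes> m \<sqsubset> m)"
        using mc irrefl[of m] less_trans[of m "m \<otimes> m" m] by blast
      ultimately show False
        using irrefl[OF mc] yz(3) by metis
    qed
    then have "e m = 0" unfolding ee[of m] by (simp only: sum.empty)
    then show False using m by simp
  qed
  moreover have "m \<sqsubset> \<one>" if "m \<otimes> m \<sqsubset> m"
  proof -
    have "inv m \<otimes> (m \<otimes> m) \<sqsubset> inv m \<otimes> m"
      using left_mono[of "m \<otimes> m" m "inv m"] mc that by simp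
    moreover have "inv m \<otimes> (m \<otimes> m) = m" using mc by (simp add: inv_solve_left')
    ultimately show ?thesis using mc by simp
  qed
  ultimately have "m \<otimes> m = m" by blast
  then have "m = \<one>" using mc by simp
  then show ?thesis using 1 m by simp
qed

lemma only_trivial_idempotents: "only_trivial_idempotents (complex_group_ring G)"
  unfolding only_trivial_idempotents_def
proof (intro ballI impI)
  fix e assume e: "e \<in> carrier (complex_group_ring G)"
    and idem: "e \<otimes>\<^bsub>complex_group_ring G\<^esub> e = e"
  interpret op: ordered_group G "\<lambda>x y. y \<sqsubset> x" by (rule ordered_group_converse)
  let ?A = "{x. e x \<noteq> 0}"
  have A: "finite ?A" "?A \<subseteq> carrier G" using e by (auto simp: complex_group_ring_def)
  show "e = \<zero>\<^bsub>complex_group_ring G\<^esub> \<or> e = \<one>\<^bsub>complex_group_ring G\<^esub>"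
  proof (cases "?A = {}")
    case False
    obtain m where m: "e m \<noteq> 0" "\<And>x. e x \<noteq> 0 \<Longrightarrow> x = m \<or> x \<sqsubset> m"
      using greatest_exists[OF A(1) False A(2)] by auto
    obtain l where l: "e l \<noteq> 0" "\<And>x. e x \<noteq> 0 \<Longrightarrow> x = l \<or> l \<sqsubset> x"
      using op.greatest_exists[OF A(1) False A(2)] by auto
    have ml: "m = \<one> \<and> e m = 1" "l = \<one> \<and> e l = 1"
      using idempotent_greatest[OF e idem m] op.idempotent_greatest[OF e idem l] by auto
    have "x = \<one>" if "e x \<noteq> 0" for x
    proof (rule ccontr)
      assume "x \<noteq> \<one>"
      then have "x \<sqsubset> \<one>" "\<one> \<sqsubset> x" "x \<in> carrier G"
        using m(2)[OF that] l(2)[OF that] ml A(2) that by auto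
      then show False using irrefl[of x] less_trans[of x \<one> x] by simp
    qed
    then have "e = (\<lambda>x. if x = \<one> then 1 else 0)"
      using ml by fastforce
    then show ?thesis by (auto simp: complex_group_ring_def)
  qed (auto simp: complex_group_ring_def)
qed

end

section \<open>Torsion in the Sidki double\<close>

lemma (in group) inv_mult_cancel [simp]:
  assumes "x \<in> carrier G" "y \<in> carrier G"
  shows "inv x \<otimes> (x \<otimes> y) = y" "x \<otimes> (inv x \<otimes> y) = y"
  using assms by (simp_all flip: m_assoc)

text \<open>
  In additive notation the hypotheses say that \<open>f (g x) + f (g\<^sup>-\<^sup>1 x) = 2 f x = f (x g) + f (x g\<^sup>-\<^sup>1)\<close>,
  which is Jensen's functional equation: \<open>f\<close> is affine along \<open>x, x g, x g\<^sup>2, \<dots>\<close>.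
\<close>

locale jensen = G: group G + K: comm_group K for G (structure) and K :: "('c, 'd) monoid_scheme" +
  fixes f :: "'a \<Rightarrow> 'c"
  assumes closed [simp]: "x \<in> carrier G \<Longrightarrow> f x \<in> carrier K"
    and f_one [simp]: "f \<one> = \<one>\<^bsub>K\<^esub>"
    and left: "x \<in> carrier G \<Longrightarrow> g \<in> carrier G \<Longrightarrow> f (g \<otimes> x) \<otimes>\<^bsub>K\<^esub> f (inv g \<otimes> x) = f x \<otimes>\<^bsub>K\<^esub> f x"
    and right: "x \<in> carrier G \<Longrightarrow> g \<in> carrier G \<Longrightarrow> f (x \<otimes> g) \<otimes>\<^bsub>K\<^esub> f (x \<otimes> inv g) = f x \<otimes>\<^bsub>K\<^esub> f x"
begin

lemma f_inv: "x \<in> carrier G \<Longrightarrow> f (inv x) = inv\<^bsub>K\<^esub> f x"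
  using left[of \<one> x] K.inv_equality[of "f (inv x)" "f x"] by (simp add: K.m_comm)

text \<open>The equation \<open>right\<close> at \<open>x a^(i+1)\<close> says that the second
  differences along \<open>x, x a, x a^2, ...\<close> vanish.\<close>

lemma progression:
  fixes j :: nat
  assumes "x \<in> carrier G" "a \<in> carrier G"
  shows "f (x \<otimes> a [^] j) = f x \<otimes>\<^bsub>K\<^esub> (inv\<^bsub>K\<^esub> f x \<otimes>\<^bsub>K\<^esub> f (x \<otimes> a)) [^]\<^bsub>K\<^esub> j"
proof (induction j rule: nat_less_induct)
  case (1 j)
  let ?d = "inv\<^bsub>K\<^esub> f x \<otimes>\<^bsub>K\<^esub> f (x \<otimes> a)"
  have d: "?d \<in> carrier K" using assms by simp
  show ?case
  proof (cases "j < 2")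
    case True
    then consider "j = 0" | "j = 1" by linarith
    then show ?thesis using assms by cases (auto simp flip: K.m_assoc)
  next
    case False
    define i where "i = j - 2"
    have j: "j = Suc (Suc i)" using False by (simp add: i_def)
    define r where "r = f x"
    have r: "r \<in> carrier K" using assms by (simp add: r_def)
    have IH: "f (x \<otimes> a [^] i) = r \<otimes>\<^bsub>K\<^esub> ?d [^]\<^bsub>K\<^esub> i"
      "f (x \<otimes> a [^] Suc i) = r \<otimes>\<^bsub>K\<^esub> ?d [^]\<^bsub>K\<^esub> Suc i"
      using 1 j by (auto simp: r_def simp del: nat_pow_Suc)
    have "f (x \<otimes> a [^] Suc i \<otimes> a) \<otimes>\<^bsub>K\<^esub> f (x \<otimes> a [^] Suc i \<otimes> inv a) =
        f (x \<otimes> a [^] Suc i) \<otimes>\<^bsub>K\<^esub> f (x \<otimes> a [^] Suc i)"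
      using assms by (intro right) auto
    moreover have "x \<otimes> a [^] Suc i \<otimes> inv a = x \<otimes> a [^] i"
      using assms by (simp add: G.m_assoc)
    moreover have "x \<otimes> a [^] Suc i \<otimes> a = x \<otimes> a [^] j"
      using assms j by (simp add: G.m_assoc)
    ultimately have "f (x \<otimes> a [^] j) \<otimes>\<^bsub>K\<^esub> (r \<otimes>\<^bsub>K\<^esub> ?d [^]\<^bsub>K\<^esub> i) =
        (r \<otimes>\<^bsub>K\<^esub> ?d [^]\<^bsub>K\<^esub> Suc i) \<otimes>\<^bsub>K\<^esub> (r \<otimes>\<^bsub>K\<^esub> ?d [^]\<^bsub>K\<^esub> Suc i)"
      using IH by simp
    also have "\<dots> = (r \<otimes>\<^bsub>K\<^esub> ?d [^]\<^bsub>K\<^esub> j) \<otimes>\<^bsub>K\<^esub> (r \<otimes>\<^bsub>K\<^esub> ?d [^]\<^bsub>K\<^esub> i)"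
      unfolding j using r K.nat_pow_closed[OF d, of i] d by (simp only: nat_pow_Suc K.m_ac K.m_closed)
    finally show ?thesis
      using r K.nat_pow_closed[OF d] assms unfolding r_def[symmetric] by simp
  qed
qed

text \<open>Additively, with d the slope at \<open>s\<close>: the progression gives f(a s) = f(s) +
  M d. The equation \<open>right\<close> at \<open>s\<close> gives d = f(s) + f(a s^-1), and
  \<open>right\<close> at \<open>a\<close> gives f(a s) + f(a s^-1) = 2 f(a). The sum is (M + 1) d =
  2 f(a).\<close>

lemma slope:
  fixes M :: nat
  assumes s: "s \<in> carrier G" and a: "a \<in> carrier G" and as: "a \<otimes> s = s \<otimes> a [^] M"
  shows "(inv\<^bsub>K\<^esub> f s \<otimes>\<^bsub>K\<^esub> f (s \<otimes> a)) [^]\<^bsub>K\<^esub> Suc M = f a \<otimes>\<^bsub>K\<^esub> f a"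
proof -
  define d where "d = inv\<^bsub>K\<^esub> f s \<otimes>\<^bsub>K\<^esub> f (s \<otimes> a)"
  have d: "d \<in> carrier K" using s a by (simp add: d_def)
  have 1: "f (a \<otimes> s) = f s \<otimes>\<^bsub>K\<^esub> d [^]\<^bsub>K\<^esub> M"
    using progression[OF s a, of M] as by (simp add: d_def)
  have "inv (a \<otimes> inv s) = s \<otimes> inv a" using s a by (simp add: G.inv_mult_group)
  then have 2: "f (s \<otimes> inv a) = inv\<^bsub>K\<^esub> f (a \<otimes> inv s)"
    using f_inv[of "a \<otimes> inv s"] s a by simp
  have 3: "f (s \<otimes> a) = f s \<otimes>\<^bsub>K\<^esub> d" using s a by (simp add: d_def flip: K.m_assoc)
  have "f (s \<otimes> a) \<otimes>\<^bsub>K\<^esub> f (s \<otimes> inv a) = f s \<otimes>\<^bsub>K\<^esub> f s" using right s a by simp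
  then have "f s \<otimes>\<^bsub>K\<^esub> d = f s \<otimes>\<^bsub>K\<^esub> f s \<otimes>\<^bsub>K\<^esub> f (a \<otimes> inv s)"
    unfolding 3 2 using K.inv_solve_right'[of "f s \<otimes>\<^bsub>K\<^esub> f s" "f s \<otimes>\<^bsub>K\<^esub> d" "f (a \<otimes> inv s)"] s a d by simp
  then have 4: "d = f s \<otimes>\<^bsub>K\<^esub> f (a \<otimes> inv s)"
    using s a d by (simp add: K.m_assoc)
  have "f (a \<otimes> s) \<otimes>\<^bsub>K\<^esub> f (a \<otimes> inv s) = f a \<otimes>\<^bsub>K\<^esub> f a" using right s a by simp
  then have "f s \<otimes>\<^bsub>K\<^esub> d [^]\<^bsub>K\<^esub> M \<otimes>\<^bsub>K\<^esub> f (a \<otimes> inv s) = f a \<otimes>\<^bsub>K\<^esub> f a" unfolding 1 .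
  moreover have "f s \<otimes>\<^bsub>K\<^esub> d [^]\<^bsub>K\<^esub> M \<otimes>\<^bsub>K\<^esub> f (a \<otimes> inv s) = d [^]\<^bsub>K\<^esub> M \<otimes>\<^bsub>K\<^esub> (f s \<otimes>\<^bsub>K\<^esub> f (a \<otimes> inv s))"
    using s a d by (simp add: K.m_ac)
  ultimately show ?thesis using 4 unfolding d_def[symmetric] by simp
qed

text \<open>Additively, with \<open>c = f a\<close>: \<open>slope\<close> at \<open>t\<close> gives
  (m + 1) d = 2c, and \<open>slope\<close> at \<open>t t\<close>, where the exponent is
  \<open>m * m\<close>, gives (m^2 + 1)(2d - c) = 2c. Eliminating d leaves a multiple of c
  alone.\<close>

lemma torsion:
  fixes n :: nat
  assumes t: "t \<in> carrier G" and a: "a \<in> carrier G" and at: "a \<otimes> t = t \<otimes> a [^] Suc n"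
  shows "f a [^]\<^bsub>K\<^esub> (n ^ 3) = \<one>\<^bsub>K\<^esub>"
proof -
  define m where "m = Suc n"
  have at': "a [^] j \<otimes> t = t \<otimes> a [^] (m * j)" for j :: nat
  proof (induction j)
    case (Suc j)
    have "a [^] Suc j \<otimes> t = a [^] j \<otimes> (a \<otimes> t)" using a t by (simp add: G.m_assoc)
    also have "\<dots> = a [^] j \<otimes> t \<otimes> a [^] m" using a t at by (simp add: G.m_assoc m_def)
    also have "\<dots> = t \<otimes> (a [^] (m * j) \<otimes> a [^] m)" using a t Suc by (simp add: G.m_assoc)
    also have "\<dots> = t \<otimes> a [^] (m * Suc j)" using a by (simp add: G.nat_pow_mult add.commute)
    finally show ?case .
  qed (use t in simp)
  have "a \<otimes> (t \<otimes> t) = t \<otimes> (a [^] m \<otimes> t)" using a t at by (simp add: m_def flip: G.m_assoc)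
  also have "\<dots> = (t \<otimes> t) \<otimes> a [^] (m * m)" using a t at'[of m] by (simp add: G.m_assoc)
  finally have att: "a \<otimes> (t \<otimes> t) = (t \<otimes> t) \<otimes> a [^] (m * m)" .
  define c where "c = f a"
  define d where "d = inv\<^bsub>K\<^esub> f t \<otimes>\<^bsub>K\<^esub> f (t \<otimes> a)"
  have [simp]: "c \<in> carrier K" "d \<in> carrier K" using a t by (auto simp: c_def d_def)
  have sq: "x [^]\<^bsub>K\<^esub> (2::nat) = x \<otimes>\<^bsub>K\<^esub> x" if "x \<in> carrier K" for x
    using that by (simp add: numeral_2_eq_2)
  have d: "d [^]\<^bsub>K\<^esub> Suc m = c [^]\<^bsub>K\<^esub> (2::nat)"
    using slope[OF t a at] sq[of c] a unfolding c_def d_def m_def by (simp del: nat_pow_Suc)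
  \<comment> \<open>The slope at \<open>t t\<close> is 2d - c; this is the point where the left-hand
    Jensen equation enters.\<close>
  have "f (t \<otimes> t \<otimes> a) \<otimes>\<^bsub>K\<^esub> f a = f (t \<otimes> a) \<otimes>\<^bsub>K\<^esub> f (t \<otimes> a)"
    using left[of "t \<otimes> a" t] a t by (simp add: G.m_assoc)
  then have "f (t \<otimes> t \<otimes> a) = f (t \<otimes> a) \<otimes>\<^bsub>K\<^esub> f (t \<otimes> a) \<otimes>\<^bsub>K\<^esub> inv\<^bsub>K\<^esub> c"
    using K.inv_solve_right[of "f (t \<otimes> t \<otimes> a)" "f (t \<otimes> a) \<otimes>\<^bsub>K\<^esub> f (t \<otimes> a)" c] a t unfolding c_def by simp
  moreover have "f (t \<otimes> t) = f t \<otimes>\<^bsub>K\<^esub> f t"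
    using right[of t t] t by simp
  ultimately have "inv\<^bsub>K\<^esub> f (t \<otimes> t) \<otimes>\<^bsub>K\<^esub> f (t \<otimes> t \<otimes> a) = d \<otimes>\<^bsub>K\<^esub> d \<otimes>\<^bsub>K\<^esub> inv\<^bsub>K\<^esub> c"
    using a t by (simp add: d_def K.inv_mult K.m_ac)
  then have dd: "(d \<otimes>\<^bsub>K\<^esub> d \<otimes>\<^bsub>K\<^esub> inv\<^bsub>K\<^esub> c) [^]\<^bsub>K\<^esub> Suc (m * m) = c [^]\<^bsub>K\<^esub> (2::nat)"
    using slope[OF _ a att] t a sq[of c] by (simp add: c_def del: nat_pow_Suc)
  have c4: "c [^]\<^bsub>K\<^esub> (2::nat) \<otimes>\<^bsub>K\<^esub> c [^]\<^bsub>K\<^esub> (2::nat) = c [^]\<^bsub>K\<^esub> (4::int)"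
    using int_pow_int[of K c 4] by (simp add: K.nat_pow_mult)
  have cm: "inv\<^bsub>K\<^esub> c [^]\<^bsub>K\<^esub> Suc m = c [^]\<^bsub>K\<^esub> (- int (Suc m))"
    by (simp only: K.nat_pow_inv K.int_pow_neg_int \<open>c \<in> carrier K\<close>)
  \<comment> \<open>Raising the relation \<open>dd\<close> to the power \<open>m + 1\<close> allows
    \<open>d\<close> to be replaced by \<open>c\<close> through the first relation.\<close>
  have "((d \<otimes>\<^bsub>K\<^esub> d \<otimes>\<^bsub>K\<^esub> inv\<^bsub>K\<^esub> c) [^]\<^bsub>K\<^esub> Suc (m * m)) [^]\<^bsub>K\<^esub> Suc m = (c [^]\<^bsub>K\<^esub> (2::nat)) [^]\<^bsub>K\<^esub> Suc m"
    unfolding dd ..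
  moreover have "((d \<otimes>\<^bsub>K\<^esub> d \<otimes>\<^bsub>K\<^esub> inv\<^bsub>K\<^esub> c) [^]\<^bsub>K\<^esub> Suc (m * m)) [^]\<^bsub>K\<^esub> Suc m
      = ((d [^]\<^bsub>K\<^esub> Suc m \<otimes>\<^bsub>K\<^esub> d [^]\<^bsub>K\<^esub> Suc m) \<otimes>\<^bsub>K\<^esub> inv\<^bsub>K\<^esub> c [^]\<^bsub>K\<^esub> Suc m) [^]\<^bsub>K\<^esub> Suc (m * m)"
    by (simp only: K.nat_pow_pow K.nat_pow_distrib[symmetric] K.m_closed K.inv_closed
        \<open>c \<in> carrier K\<close> \<open>d \<in> carrier K\<close> mult.commute)
  moreover have "\<dots> = (c [^]\<^bsub>K\<^esub> (4::int) \<otimes>\<^bsub>K\<^esub> c [^]\<^bsub>K\<^esub> (- int (Suc m))) [^]\<^bsub>K\<^esub> int (Suc (m * m))"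
    unfolding d c4 cm int_pow_int ..
  moreover have "\<dots> = c [^]\<^bsub>K\<^esub> ((4 - int (Suc m)) * int (Suc (m * m)))"
    by (simp only: K.int_pow_mult[symmetric] K.int_pow_pow \<open>c \<in> carrier K\<close>) simp
  moreover have "(c [^]\<^bsub>K\<^esub> (2::nat)) [^]\<^bsub>K\<^esub> Suc m = c [^]\<^bsub>K\<^esub> (2 * int (Suc m))"
    by (metis K.nat_pow_pow \<open>c \<in> carrier K\<close> int_pow_int of_nat_mult of_nat_numeral)
  ultimately have "c [^]\<^bsub>K\<^esub> ((4 - int (Suc m)) * int (Suc (m * m))) = c [^]\<^bsub>K\<^esub> (2 * int (Suc m))"
    by (simp only:)
  then have "c [^]\<^bsub>K\<^esub> (2 * int (Suc m) - (4 - int (Suc m)) * int (Suc (m * m))) = \<one>\<^bsub>K\<^esub>"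
    by (simp add: K.int_pow_diff)
  \<comment> \<open>With m = n + 1 all lower terms cancel: 2(n + 2) - (2 - n)(n^2 + 2n + 2) =
    n^3.\<close>
  moreover have "2 * int (Suc m) - (4 - int (Suc m)) * int (Suc (m * m)) = int (n ^ 3)"
    by (simp add: m_def algebra_simps power3_eq_cube)
  ultimately show ?thesis
    unfolding c_def by (metis int_pow_int)
qed

end

section \<open>Double centralizers and conjugation\<close>

definition centralizer :: "('a, 'b) monoid_scheme \<Rightarrow> 'a set \<Rightarrow> 'a set" where
  "centralizer G A = {x \<in> carrier G. \<forall>a\<in>A. x \<otimes>\<^bsub>G\<^esub> a = a \<otimes>\<^bsub>G\<^esub> x}"

context group
begin

lemma commutes_inv:
  assumes "x \<in> carrier G" "y \<in> carrier G" "x \<otimes> y = y \<otimes> x"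
  shows "inv x \<otimes> y = y \<otimes> inv x"
  using assms by (metis inv_closed inv_solve_left inv_solve_right' m_assoc m_closed)

lemma subgroup_centralizer:
  assumes "A \<subseteq> carrier G"
  shows "subgroup (centralizer G A) G"
proof
  show "inv x \<in> centralizer G A" if "x \<in> centralizer G A" for x
    using that assms commutes_inv by (auto simp: centralizer_def)
  show "x \<otimes> y \<in> centralizer G A" if "x \<in> centralizer G A" "y \<in> centralizer G A" for x y
  proof -
    have "x \<otimes> y \<otimes> a = a \<otimes> (x \<otimes> y)" if "a \<in> A" for a
      using that \<open>x \<in> _\<close> \<open>y \<in> _\<close> assms unfolding centralizer_def
      by (smt (verit) m_assoc mem_Collect_eq subset_iff)
    then show ?thesis using that by (simp add: centralizer_def)
  qed
qed (use assms in \<open>auto simp: centralizer_def\<close>)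

text \<open>Supplies an abelian group around a commuting set without describing the subgroup it
  generates: \<open>A\<close> lies in its centralizer, and taking centralizers reverses this
  inclusion.\<close>

lemma comm_group_double_centralizer:
  assumes "A \<subseteq> carrier G" "\<And>x y. x \<in> A \<Longrightarrow> y \<in> A \<Longrightarrow> x \<otimes> y = y \<otimes> x"
  shows "comm_group (G\<lparr>carrier := centralizer G (centralizer G A)\<rparr>)"
    and "A \<subseteq> centralizer G (centralizer G A)"
    and "subgroup (centralizer G (centralizer G A)) G"
proof -
  show 1: "subgroup (centralizer G (centralizer G A)) G"
    by (rule subgroup_centralizer) (auto simp: centralizer_def)
  show 2: "A \<subseteq> centralizer G (centralizer G A)"
    using assms(1) by (auto simp: centralizer_def)
  have "A \<subseteq> centralizer G A"
    using assms by (auto simp: centralizer_def)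
  then have "centralizer G (centralizer G A) \<subseteq> centralizer G A"
    by (auto simp: centralizer_def)
  then show "comm_group (G\<lparr>carrier := centralizer G (centralizer G A)\<rparr>)"
    by (intro group.group_comm_groupI[OF subgroup_imp_group[OF 1]]) (auto simp: centralizer_def)
qed

text \<open>Conjugation as a right action, so that iterated conjugation multiplies the conjugating
  elements in reading order.\<close>

definition cj :: "'a \<Rightarrow> 'a \<Rightarrow> 'a" where
  "cj x y = inv x \<otimes> y \<otimes> x"

lemma cj_closed [simp]: "x \<in> carrier G \<Longrightarrow> y \<in> carrier G \<Longrightarrow> cj x y \<in> carrier G"
  by (simp add: cj_def)

lemma cj_mult:
  "x \<in> carrier G \<Longrightarrow> y \<in> carrier G \<Longrightarrow> z \<in> carrier G \<Longrightarrow> cj x (y \<otimes> z) = cj x y \<otimes> cj x z"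
  unfolding cj_def by (simp add: m_assoc)

lemma cj_inv: "x \<in> carrier G \<Longrightarrow> y \<in> carrier G \<Longrightarrow> cj x (inv y) = inv (cj x y)"
  by (simp add: cj_def inv_mult_group m_assoc)

lemma cj_cj:
  "x \<in> carrier G \<Longrightarrow> y \<in> carrier G \<Longrightarrow> z \<in> carrier G \<Longrightarrow> cj y (cj x z) = cj (x \<otimes> y) z"
  by (simp add: cj_def inv_mult_group m_assoc)

lemma cj_eq_iff:
  "x \<in> carrier G \<Longrightarrow> y \<in> carrier G \<Longrightarrow> cj x y = y \<longleftrightarrow> x \<otimes> y = y \<otimes> x"
  by (metis cj_def inv_solve_left m_assoc m_closed inv_closed)

lemma cj_commutes:
  assumes "x \<in> carrier G" "y \<in> carrier G" "z \<in> carrier G" "y \<otimes> z = z \<otimes> y"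
  shows "cj x y \<otimes> cj x z = cj x z \<otimes> cj x y"
  using assms by (metis cj_mult)

end

text \<open>Such a pair amounts to a homomorphism from the Sidki double of \<open>G\<close> to
  \<open>X\<close>; the torsion argument is carried out for any such pair.\<close>

locale weak_commutativity = G: group G + X: group X for G (structure) and X :: "('c, 'd) monoid_scheme" +
  fixes \<alpha> \<beta> :: "'a \<Rightarrow> 'c"
  assumes \<alpha>: "\<alpha> \<in> hom G X" and \<beta>: "\<beta> \<in> hom G X"
    and weak: "g \<in> carrier G \<Longrightarrow> \<alpha> g \<otimes>\<^bsub>X\<^esub> \<beta> g = \<beta> g \<otimes>\<^bsub>X\<^esub> \<alpha> g"
begin

sublocale A: group_hom G X \<alpha> by unfold_locales (rule \<alpha>)
sublocale B: group_hom G X \<beta> by unfold_locales (rule \<beta>)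

context
  fixes c assumes c [simp]: "c \<in> carrier G" and central: "\<And>g. g \<in> carrier G \<Longrightarrow> g \<otimes> c = c \<otimes> g"
begin

abbreviation "k \<equiv> inv\<^bsub>X\<^esub> \<alpha> c \<otimes>\<^bsub>X\<^esub> \<beta> c"
abbreviation "\<kappa> g \<equiv> X.cj (\<alpha> g) k"

lemma central_image:
  assumes "g \<in> carrier G"
  shows "X.cj (\<alpha> g) (\<alpha> c) = \<alpha> c" "X.cj (\<beta> g) (\<beta> c) = \<beta> c"
  using assms central[of g] by (auto simp: X.cj_eq_iff simp flip: A.hom_mult B.hom_mult)

text \<open>Expand the weak commutativity relation of \<open>g c\<close>.\<close>

lemma k_commutes:
  assumes g: "g \<in> carrier G"
  shows "(\<alpha> g \<otimes>\<^bsub>X\<^esub> \<beta> g) \<otimes>\<^bsub>X\<^esub> k = k \<otimes>\<^bsub>X\<^esub> (\<alpha> g \<otimes>\<^bsub>X\<^esub> \<beta> g)"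
proof -
  define s where "s = \<alpha> g \<otimes>\<^bsub>X\<^esub> \<beta> g"
  have s: "s \<in> carrier X" "s = \<beta> g \<otimes>\<^bsub>X\<^esub> \<alpha> g" using g weak by (auto simp: s_def)
  have ac: "\<alpha> (g \<otimes> c) = \<alpha> c \<otimes>\<^bsub>X\<^esub> \<alpha> g" "\<beta> (g \<otimes> c) = \<beta> g \<otimes>\<^bsub>X\<^esub> \<beta> c"
    "\<alpha> (g \<otimes> c) = \<alpha> g \<otimes>\<^bsub>X\<^esub> \<alpha> c" "\<beta> (g \<otimes> c) = \<beta> c \<otimes>\<^bsub>X\<^esub> \<beta> g"
    using g central[of g] by (metis A.hom_mult B.hom_mult c)+
  have "\<alpha> c \<otimes>\<^bsub>X\<^esub> s \<otimes>\<^bsub>X\<^esub> \<beta> c = \<alpha> (g \<otimes> c) \<otimes>\<^bsub>X\<^esub> \<beta> (g \<otimes> c)"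
    unfolding ac(1,2) s_def using g by (simp add: X.m_assoc)
  also have "\<dots> = \<beta> (g \<otimes> c) \<otimes>\<^bsub>X\<^esub> \<alpha> (g \<otimes> c)" using weak[of "g \<otimes> c"] g by simp
  also have "\<dots> = \<beta> c \<otimes>\<^bsub>X\<^esub> s \<otimes>\<^bsub>X\<^esub> \<alpha> c"
    unfolding ac(3,4) s(2) using g by (simp add: X.m_assoc)
  finally have "inv\<^bsub>X\<^esub> \<alpha> c \<otimes>\<^bsub>X\<^esub> (\<alpha> c \<otimes>\<^bsub>X\<^esub> s \<otimes>\<^bsub>X\<^esub> \<beta> c) \<otimes>\<^bsub>X\<^esub> inv\<^bsub>X\<^esub> \<alpha> c =
      inv\<^bsub>X\<^esub> \<alpha> c \<otimes>\<^bsub>X\<^esub> (\<beta> c \<otimes>\<^bsub>X\<^esub> s \<otimes>\<^bsub>X\<^esub> \<alpha> c) \<otimes>\<^bsub>X\<^esub> inv\<^bsub>X\<^esub> \<alpha> c" by simp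
  then have "s \<otimes>\<^bsub>X\<^esub> (\<beta> c \<otimes>\<^bsub>X\<^esub> inv\<^bsub>X\<^esub> \<alpha> c) = k \<otimes>\<^bsub>X\<^esub> s"
    using s(1) by (simp add: X.m_assoc del: X.Units_r_inv)
  moreover have "\<beta> c \<otimes>\<^bsub>X\<^esub> inv\<^bsub>X\<^esub> \<alpha> c = k"
    using weak[of c] X.commutes_inv[of "\<alpha> c" "\<beta> c"] by simp
  ultimately show ?thesis by (simp add: s_def)
qed

lemma \<kappa>_closed [simp]: "g \<in> carrier G \<Longrightarrow> \<kappa> g \<in> carrier X"
  by simp

lemma \<kappa>_\<alpha>: "g \<in> carrier G \<Longrightarrow> h \<in> carrier G \<Longrightarrow> X.cj (\<alpha> h) (\<kappa> g) = \<kappa> (g \<otimes> h)"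
  by (simp add: X.cj_cj)

text \<open>Since \<open>\<alpha> g \<beta> g\<close> centralizes \<open>k\<close>, conjugating
  \<open>k\<close> by \<open>\<alpha> g\<close> is the same as conjugating it by the inverse of
  \<open>\<beta> g\<close>.\<close>

lemma \<kappa>_eq_\<beta>: "g \<in> carrier G \<Longrightarrow> \<kappa> g = X.cj (\<beta> (inv g)) k"
proof -
  assume g: "g \<in> carrier G"
  have "X.cj (\<beta> (inv g)) k = X.cj (\<beta> (inv g)) (X.cj (\<alpha> g \<otimes>\<^bsub>X\<^esub> \<beta> g) k)"
    using k_commutes[OF g] g X.cj_eq_iff[of "\<alpha> g \<otimes>\<^bsub>X\<^esub> \<beta> g" k] by simp
  also have "\<dots> = X.cj (\<alpha> g \<otimes>\<^bsub>X\<^esub> \<beta> g \<otimes>\<^bsub>X\<^esub> \<beta> (inv g)) k"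
    using g by (subst X.cj_cj) auto
  also have "\<alpha> g \<otimes>\<^bsub>X\<^esub> \<beta> g \<otimes>\<^bsub>X\<^esub> \<beta> (inv g) = \<alpha> g" using g by (simp add: X.m_assoc)
  finally show ?thesis by simp
qed

text \<open>Thus \<open>\<alpha>\<close> moves the index of \<open>\<kappa>\<close> on the right and
  \<open>\<beta>\<close> on the left. Having both actions is the source of the two Jensen
  equations.\<close>

lemma \<kappa>_\<beta>: "g \<in> carrier G \<Longrightarrow> h \<in> carrier G \<Longrightarrow> X.cj (\<beta> h) (\<kappa> g) = \<kappa> (inv h \<otimes> g)"
  using \<kappa>_eq_\<beta>[of "inv h \<otimes> g"] by (simp add: \<kappa>_eq_\<beta> X.cj_cj G.inv_mult_group del: B.hom_inv)

lemma \<kappa>_eq: "g \<in> carrier G \<Longrightarrow> \<kappa> g = inv\<^bsub>X\<^esub> \<alpha> c \<otimes>\<^bsub>X\<^esub> X.cj (\<alpha> g) (\<beta> c)"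
  by (simp add: X.cj_mult X.cj_inv central_image)

text \<open>Both \<open>\<alpha> c\<close> and \<open>\<beta> c\<close> commute with
  \<open>k\<close>. Conjugation by \<open>\<alpha> g\<close> fixes \<open>\<alpha> c\<close>, so
  \<open>\<alpha> c\<close> commutes with \<open>\<kappa> g\<close>; in the description by
  \<open>\<beta>\<close> the same holds for \<open>\<beta> c\<close>. Hence so does their quotient
  \<open>k\<close>.\<close>

lemma \<kappa>_commutes_k:
  assumes g: "g \<in> carrier G"
  shows "\<kappa> g \<otimes>\<^bsub>X\<^esub> k = k \<otimes>\<^bsub>X\<^esub> \<kappa> g"
proof -
  have k: "k = \<beta> c \<otimes>\<^bsub>X\<^esub> inv\<^bsub>X\<^esub> \<alpha> c"
    using weak[of c] X.commutes_inv[of "\<alpha> c" "\<beta> c"] by simp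
  have "\<alpha> c \<otimes>\<^bsub>X\<^esub> k = \<beta> c" "\<beta> c \<otimes>\<^bsub>X\<^esub> inv\<^bsub>X\<^esub> \<alpha> c \<otimes>\<^bsub>X\<^esub> \<alpha> c = \<beta> c"
    by (simp_all add: X.m_assoc)
  then have cc1: "\<alpha> c \<otimes>\<^bsub>X\<^esub> k = k \<otimes>\<^bsub>X\<^esub> \<alpha> c" using k by metis
  have "\<beta> c \<otimes>\<^bsub>X\<^esub> k = (\<beta> c \<otimes>\<^bsub>X\<^esub> inv\<^bsub>X\<^esub> \<alpha> c) \<otimes>\<^bsub>X\<^esub> \<beta> c" by (simp add: X.m_assoc)
  then have cc2: "\<beta> c \<otimes>\<^bsub>X\<^esub> k = k \<otimes>\<^bsub>X\<^esub> \<beta> c" using k by metis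
  have 1: "\<alpha> c \<otimes>\<^bsub>X\<^esub> \<kappa> g = \<kappa> g \<otimes>\<^bsub>X\<^esub> \<alpha> c"
    using X.cj_commutes[OF _ _ _ cc1, of "\<alpha> g"] g by (simp add: central_image)
  have 2: "\<beta> c \<otimes>\<^bsub>X\<^esub> \<kappa> g = \<kappa> g \<otimes>\<^bsub>X\<^esub> \<beta> c"
    unfolding \<kappa>_eq_\<beta>[OF g]
    using X.cj_commutes[OF _ _ _ cc2, of "\<beta> (inv g)"] g central_image(2)[of "inv g"] by simp
  have "\<kappa> g \<otimes>\<^bsub>X\<^esub> k = inv\<^bsub>X\<^esub> \<alpha> c \<otimes>\<^bsub>X\<^esub> \<kappa> g \<otimes>\<^bsub>X\<^esub> \<beta> c"
    using X.commutes_inv[OF _ _ 1] g by (simp add: X.m_assoc[symmetric])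
  also have "\<dots> = k \<otimes>\<^bsub>X\<^esub> \<kappa> g"
    using 2 g by (simp add: X.m_assoc)
  finally show ?thesis .
qed

lemma \<kappa>_commutes:
  assumes "g \<in> carrier G" "h \<in> carrier G"
  shows "\<kappa> g \<otimes>\<^bsub>X\<^esub> \<kappa> h = \<kappa> h \<otimes>\<^bsub>X\<^esub> \<kappa> g"
  using X.cj_commutes[OF _ _ _ \<kappa>_commutes_k[of "g \<otimes> inv h"], of "\<alpha> h"] assms
  by (simp add: X.cj_cj X.m_assoc)

text \<open>Conjugate \<open>\<beta> c\<close> by the commuting elements \<open>\<alpha> g\<close>
  and \<open>\<beta> g\<close> in both orders, using that \<open>\<beta> g\<close> fixes
  \<open>\<beta> c\<close>, and rewrite everything through \<open>\<alpha> c\<close>,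
  \<open>k\<close> and \<open>\<kappa>\<close>.\<close>

lemma \<kappa>_inv:
  assumes g: "g \<in> carrier G"
  shows "\<kappa> g \<otimes>\<^bsub>X\<^esub> \<kappa> (inv g) = k \<otimes>\<^bsub>X\<^esub> k"
proof -
  let ?C = "\<alpha> c"
  have k: "\<beta> c = ?C \<otimes>\<^bsub>X\<^esub> k" by (simp flip: X.m_assoc)
  have Cg: "X.cj (\<alpha> g) (\<beta> c) = ?C \<otimes>\<^bsub>X\<^esub> \<kappa> g"
    using g by (simp add: \<kappa>_eq flip: X.m_assoc)
  have "X.cj (\<beta> g) (?C \<otimes>\<^bsub>X\<^esub> \<kappa> g) = X.cj (\<alpha> g \<otimes>\<^bsub>X\<^esub> \<beta> g) (\<beta> c)"
    using g by (simp add: X.cj_cj flip: Cg)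
  also have "\<dots> = X.cj (\<alpha> g) (X.cj (\<beta> g) (\<beta> c))"
    using g weak[OF g] by (simp add: X.cj_cj)
  finally have "X.cj (\<beta> g) (?C \<otimes>\<^bsub>X\<^esub> \<kappa> g) = X.cj (\<alpha> g) (X.cj (\<beta> g) (\<beta> c))" .
  moreover have "X.cj (\<beta> g) (?C \<otimes>\<^bsub>X\<^esub> \<kappa> g) = X.cj (\<beta> g) ?C \<otimes>\<^bsub>X\<^esub> X.cj (\<beta> g) (\<kappa> g)"
    using g by (intro X.cj_mult) simp_all
  ultimately have 1: "X.cj (\<beta> g) ?C \<otimes>\<^bsub>X\<^esub> X.cj (\<beta> g) (\<kappa> g) = ?C \<otimes>\<^bsub>X\<^esub> \<kappa> g"
    unfolding central_image(2)[OF g] Cg by simp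
  have 2: "X.cj (\<beta> g) (\<kappa> g) = k" using \<kappa>_\<beta>[OF g g] g by (simp add: X.cj_def)
  have "?C = \<beta> c \<otimes>\<^bsub>X\<^esub> inv\<^bsub>X\<^esub> k"
    using k X.inv_solve_right[of ?C "\<beta> c" k] by simp
  then have "X.cj (\<beta> g) ?C = X.cj (\<beta> g) (\<beta> c) \<otimes>\<^bsub>X\<^esub> inv\<^bsub>X\<^esub> X.cj (\<beta> g) k"
    using g X.cj_mult[of "\<beta> g" "\<beta> c" "inv\<^bsub>X\<^esub> k"] X.cj_inv[of "\<beta> g" k] by simp
  also have "X.cj (\<beta> g) k = \<kappa> (inv g)"
    using g \<kappa>_eq_\<beta>[of "inv g"] by simp
  also have "X.cj (\<beta> g) (\<beta> c) = ?C \<otimes>\<^bsub>X\<^esub> k" using k central_image(2)[OF g] by simp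
  finally have "X.cj (\<beta> g) ?C = ?C \<otimes>\<^bsub>X\<^esub> k \<otimes>\<^bsub>X\<^esub> inv\<^bsub>X\<^esub> \<kappa> (inv g)" .
  then have "?C \<otimes>\<^bsub>X\<^esub> k \<otimes>\<^bsub>X\<^esub> inv\<^bsub>X\<^esub> \<kappa> (inv g) \<otimes>\<^bsub>X\<^esub> k = ?C \<otimes>\<^bsub>X\<^esub> \<kappa> g"
    using 1 2 by simp
  then have "k \<otimes>\<^bsub>X\<^esub> (inv\<^bsub>X\<^esub> \<kappa> (inv g) \<otimes>\<^bsub>X\<^esub> k) = \<kappa> g"
    using g by (simp add: X.m_assoc del: A.hom_inv)
  moreover have "inv\<^bsub>X\<^esub> \<kappa> (inv g) \<otimes>\<^bsub>X\<^esub> k = k \<otimes>\<^bsub>X\<^esub> inv\<^bsub>X\<^esub> \<kappa> (inv g)"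
    using X.commutes_inv[OF _ _ \<kappa>_commutes_k[of "inv g"]] g by simp
  ultimately have "k \<otimes>\<^bsub>X\<^esub> k \<otimes>\<^bsub>X\<^esub> inv\<^bsub>X\<^esub> \<kappa> (inv g) = \<kappa> g"
    using g by (simp add: X.m_assoc del: A.hom_inv)
  then show ?thesis
    using X.inv_solve_right'[of "\<kappa> g" "k \<otimes>\<^bsub>X\<^esub> k" "\<kappa> (inv g)"] g by simp
qed

text \<open>Conjugate \<open>\<kappa>_inv\<close> by \<open>\<alpha> x\<close>.\<close>

lemma \<kappa>_left:
  assumes "g \<in> carrier G" "x \<in> carrier G"
  shows "\<kappa> (g \<otimes> x) \<otimes>\<^bsub>X\<^esub> \<kappa> (inv g \<otimes> x) = \<kappa> x \<otimes>\<^bsub>X\<^esub> \<kappa> x"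
proof -
  have "X.cj (\<alpha> x) (\<kappa> g \<otimes>\<^bsub>X\<^esub> \<kappa> (inv g)) = X.cj (\<alpha> x) (k \<otimes>\<^bsub>X\<^esub> k)"
    using \<kappa>_inv assms by simp
  then show ?thesis using assms \<kappa>_\<alpha>[of g x] \<kappa>_\<alpha>[of "inv g" x] by (subst (asm) (1 2) X.cj_mult) auto
qed

text \<open>Conjugate \<open>\<kappa>_inv\<close> by \<open>\<beta> (inv x)\<close>, which
  multiplies the indices by \<open>x\<close> on the left.\<close>

lemma \<kappa>_right:
  assumes "g \<in> carrier G" "x \<in> carrier G"
  shows "\<kappa> (x \<otimes> g) \<otimes>\<^bsub>X\<^esub> \<kappa> (x \<otimes> inv g) = \<kappa> x \<otimes>\<^bsub>X\<^esub> \<kappa> x"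
proof -
  define b where "b = \<beta> (inv x)"
  have b: "b \<in> carrier X" using assms by (simp add: b_def)
  have "X.cj b (\<kappa> g) \<otimes>\<^bsub>X\<^esub> X.cj b (\<kappa> (inv g)) = X.cj b (\<kappa> g \<otimes>\<^bsub>X\<^esub> \<kappa> (inv g))"
    using assms b by (intro X.cj_mult[symmetric]) simp_all
  also have "\<dots> = X.cj b k \<otimes>\<^bsub>X\<^esub> X.cj b k"
    unfolding \<kappa>_inv[OF assms(1)] using b by (intro X.cj_mult) simp_all
  finally show ?thesis
    unfolding b_def \<kappa>_\<beta>[OF assms(1) G.inv_closed[OF assms(2)]]
      \<kappa>_\<beta>[OF G.inv_closed[OF assms(1)] G.inv_closed[OF assms(2)]]
      \<kappa>_eq_\<beta>[OF assms(2), symmetric] G.inv_inv[OF assms(2)] .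
qed

lemma torsion:
  fixes n :: nat
  assumes t: "t \<in> carrier G" and a: "a \<in> carrier G" and at: "a \<otimes> t = t \<otimes> a [^] Suc n"
  shows "commutator X (\<alpha> a) (\<beta> c) [^]\<^bsub>X\<^esub> (n ^ 3) = \<one>\<^bsub>X\<^esub>"
proof -
  define Z where "Z = centralizer X (centralizer X (\<kappa> ` carrier G))"
  have *: "\<kappa> ` carrier G \<subseteq> carrier X" using \<kappa>_closed by blast
  have **: "x \<otimes>\<^bsub>X\<^esub> y = y \<otimes>\<^bsub>X\<^esub> x" if x: "x \<in> \<kappa> ` carrier G" and y: "y \<in> \<kappa> ` carrier G" for x y
  proof -
    obtain g h where "x = \<kappa> g" "g \<in> carrier G" "y = \<kappa> h" "h \<in> carrier G" using x y by (elim imageE)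
    then show ?thesis using \<kappa>_commutes[of g h] by blast
  qed
  have comm: "comm_group (X\<lparr>carrier := Z\<rparr>)" and sub: "\<kappa> ` carrier G \<subseteq> Z" and Z: "subgroup Z X"
    unfolding Z_def by (rule X.comm_group_double_centralizer[OF * **]; assumption)+
  have kZ: "k \<in> Z"
  proof -
    have "\<kappa> \<one> = k" by (simp add: X.cj_def)
    then show ?thesis using sub G.one_closed by (metis imageI subsetD)
  qed
  interpret K: comm_group "X\<lparr>carrier := Z\<rparr>" by (rule comm)
  have [simp]: "inv\<^bsub>X\<lparr>carrier := Z\<rparr>\<^esub> x = inv\<^bsub>X\<^esub> x" if "x \<in> Z" for x
    using that Z X.m_inv_consistent by blast
  \<comment> \<open>Dividing by \<open>k\<close> gives the normalization
    \<open>f \<one> = \<one>\<close> and preserves the Jensen equations inside the abelian group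
    \<open>Z\<close>.\<close>
  define f where "f g = \<kappa> g \<otimes>\<^bsub>X\<^esub> inv\<^bsub>X\<^esub> k" for g
  have ZX: "x \<in> carrier X" if "x \<in> Z" for x using that Z subgroup.mem_carrier by metis
  have inv_k: "inv\<^bsub>X\<^esub> k \<in> Z" using Z kZ by (rule subgroup.m_inv_closed)
  have sq: "(u \<otimes>\<^bsub>X\<^esub> inv\<^bsub>X\<^esub> k) \<otimes>\<^bsub>X\<^esub> (v \<otimes>\<^bsub>X\<^esub> inv\<^bsub>X\<^esub> k) = (u \<otimes>\<^bsub>X\<^esub> v) \<otimes>\<^bsub>X\<^esub> (inv\<^bsub>X\<^esub> k \<otimes>\<^bsub>X\<^esub> inv\<^bsub>X\<^esub> k)"
    if "u \<in> Z" "v \<in> Z" for u v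
    using that inv_k K.m_lcomm ZX by (simp add: X.m_assoc del: A.hom_inv)
  interpret jensen G "X\<lparr>carrier := Z\<rparr>" f
  proof unfold_locales
    show "f x \<in> carrier (X\<lparr>carrier := Z\<rparr>)" if "x \<in> carrier G" for x
      using that sub inv_k Z by (auto simp: f_def intro: subgroup.m_closed)
    show "f \<one> = \<one>\<^bsub>X\<lparr>carrier := Z\<rparr>\<^esub>"
      by (simp add: f_def X.cj_def)
  next
    fix x g assume xg: "x \<in> carrier G" "g \<in> carrier G"
    then have Zs: "\<kappa> (g \<otimes> x) \<in> Z" "\<kappa> (inv g \<otimes> x) \<in> Z" "\<kappa> (x \<otimes> g) \<in> Z" "\<kappa> (x \<otimes> inv g) \<in> Z" "\<kappa> x \<in> Z"
      by (auto intro!: subsetD[OF sub] imageI simp del: A.hom_mult A.hom_inv)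
    show "f (g \<otimes> x) \<otimes>\<^bsub>X\<lparr>carrier := Z\<rparr>\<^esub> f (inv g \<otimes> x) = f x \<otimes>\<^bsub>X\<lparr>carrier := Z\<rparr>\<^esub> f x"
      using sq[OF Zs(1,2)] sq[OF Zs(5,5)] \<kappa>_left[OF xg(2,1)] by (simp add: f_def del: A.hom_mult A.hom_inv)
    show "f (x \<otimes> g) \<otimes>\<^bsub>X\<lparr>carrier := Z\<rparr>\<^esub> f (x \<otimes> inv g) = f x \<otimes>\<^bsub>X\<lparr>carrier := Z\<rparr>\<^esub> f x"
      using sq[OF Zs(3,4)] sq[OF Zs(5,5)] \<kappa>_right[OF xg(2,1)] by (simp add: f_def del: A.hom_mult A.hom_inv)
  qed
  have fa: "f a \<in> carrier X" using closed[OF a] ZX by simp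
  have "f a [^]\<^bsub>X\<^esub> (n ^ 3) = \<one>\<^bsub>X\<^esub>"
    using torsion[OF t a at] by (simp flip: X.nat_pow_consistent)
  \<comment> \<open>Here \<open>\<alpha> c\<close> cancels: \<open>f a\<close> is the inverse of
    \<open>\<beta> c\<close> times its conjugate by \<open>\<alpha> a\<close>.\<close>
  moreover have "commutator X (\<alpha> a) (\<beta> c) = inv\<^bsub>X\<^esub> f a"
  proof -
    have "f a = (inv\<^bsub>X\<^esub> \<alpha> c \<otimes>\<^bsub>X\<^esub> X.cj (\<alpha> a) (\<beta> c)) \<otimes>\<^bsub>X\<^esub> inv\<^bsub>X\<^esub> k"
      using a by (simp add: f_def \<kappa>_eq)
    also have "\<dots> = inv\<^bsub>X\<^esub> k \<otimes>\<^bsub>X\<^esub> (inv\<^bsub>X\<^esub> \<alpha> c \<otimes>\<^bsub>X\<^esub> X.cj (\<alpha> a) (\<beta> c))"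
      using a \<kappa>_commutes_k[OF a] X.commutes_inv[of k "\<kappa> a"] by (simp add: \<kappa>_eq)
    also have "inv\<^bsub>X\<^esub> k = inv\<^bsub>X\<^esub> \<beta> c \<otimes>\<^bsub>X\<^esub> \<alpha> c" by (simp add: X.inv_mult_group)
    finally have "f a = inv\<^bsub>X\<^esub> \<beta> c \<otimes>\<^bsub>X\<^esub> X.cj (\<alpha> a) (\<beta> c)"
      using a by (simp add: X.m_assoc)
    then show ?thesis
      using a by (simp add: commutator_def X.cj_def X.inv_mult_group X.m_assoc)
  qed
  ultimately show ?thesis using fa by (simp add: X.nat_pow_inv)
qed

end

end

section \<open>The group \<open>BS(1, m) \<times> \<int>\<close>\<close>

text \<open>
  \<open>(q, e, l)\<close> stands for the element \<open>q t\<^sup>e c\<^sup>l\<close> of \<open>\<int>[1/m] \<rtimes> \<langle>t\<rangle> \<times> \<langle>c\<rangle>\<close>, where \<open>t\<close> acts on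
  \<open>\<int>[1/m]\<close> as division by \<open>m\<close>.
\<close>

definition localized_ints :: "nat \<Rightarrow> real set" where
  "localized_ints m = {q. \<exists>i::nat. q * real m ^ i \<in> \<int>}"

definition bsz :: "nat \<Rightarrow> (real \<times> int \<times> int) monoid" where
  "bsz m =
     \<lparr>carrier = {(q, e, l). q \<in> localized_ints m},
      monoid.mult = (\<lambda>(q, e, l) (q', e', l'). (q + q' * real m powi (- e), e + e', l + l')),
      one = (0, 0, 0)\<rparr>"

lemma mult_bsz [simp]:
  "(q, e, l) \<otimes>\<^bsub>bsz m\<^esub> (q', e', l') = (q + q' * real m powi (- e), e + e', l + l')"
  by (simp add: bsz_def)

lemma one_bsz [simp]: "\<one>\<^bsub>bsz m\<^esub> = (0, 0, 0)"
  by (simp add: bsz_def)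

lemma carrier_bsz [simp]: "(q, e, l) \<in> carrier (bsz m) \<longleftrightarrow> q \<in> localized_ints m"
  by (simp add: bsz_def)

lemma Ints_mult_power: "q * real m ^ i \<in> \<int> \<Longrightarrow> i \<le> j \<Longrightarrow> q * real m ^ j \<in> \<int>"
proof -
  assume q: "q * real m ^ i \<in> \<int>" and "i \<le> j"
  then have "q * real m ^ j = (q * real m ^ i) * real m ^ (j - i)"
    by (simp flip: power_add)
  moreover have "(q * real m ^ i) * real m ^ (j - i) \<in> \<int>"
    by (rule Ints_mult[OF q Ints_power]) simp
  ultimately show ?thesis by metis
qed

lemma localized_ints_add: "p \<in> localized_ints m \<Longrightarrow> q \<in> localized_ints m \<Longrightarrow> p + q \<in> localized_ints m"
proof -
  assume "p \<in> localized_ints m" "q \<in> localized_ints m"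
  then obtain i j where "p * real m ^ i \<in> \<int>" "q * real m ^ j \<in> \<int>"
    by (auto simp: localized_ints_def)
  then have "(p + q) * real m ^ max i j \<in> \<int>"
    using Ints_mult_power[of p m i "max i j"] Ints_mult_power[of q m j "max i j"]
    by (simp add: distrib_right)
  then show ?thesis by (auto simp: localized_ints_def)
qed

lemma Ints_localized_ints: "q \<in> \<int> \<Longrightarrow> q \<in> localized_ints m"
  unfolding localized_ints_def by (intro CollectI exI[of _ 0]) simp

lemma localized_ints_minus [simp]: "- q \<in> localized_ints m \<longleftrightarrow> q \<in> localized_ints m"
  by (simp add: localized_ints_def)

lemma localized_ints_diff: "p \<in> localized_ints m \<Longrightarrow> q \<in> localized_ints m \<Longrightarrow> p - q \<in> localized_ints m"
  using localized_ints_add[of p m "- q"] by simp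

lemma localized_ints_powi:
  assumes "m > 0" "q \<in> localized_ints m"
  shows "q * real m powi e \<in> localized_ints m"
proof -
  obtain i where i: "q * real m ^ i \<in> \<int>" using assms by (auto simp: localized_ints_def)
  show ?thesis
  proof (cases "e \<ge> 0")
    case True
    then have "q * real m powi e * real m ^ i = (q * real m ^ i) * real m ^ nat e"
      by (simp add: power_int_def)
    moreover have "(q * real m ^ i) * real m ^ nat e \<in> \<int>"
      by (rule Ints_mult[OF i Ints_power]) simp
    ultimately have "q * real m powi e * real m ^ i \<in> \<int>" by (simp only:)
    then show ?thesis unfolding localized_ints_def by blast
  next
    case False
    then have "q * real m powi e * real m ^ (i + nat (- e)) = q * real m ^ i"
      using assms by (simp add: power_int_def power_add field_simps)
    then have "q * real m powi e * real m ^ (i + nat (- e)) \<in> \<int>" using i by (simp only:)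
    then show ?thesis unfolding localized_ints_def by blast
  qed
qed

lemma countable_localized_ints: "m > 0 \<Longrightarrow> countable (localized_ints m)"
proof -
  assume m: "m > 0"
  have "localized_ints m \<subseteq> (\<lambda>(j::int, i::nat). of_int j / real m ^ i) ` UNIV"
  proof
    fix q assume "q \<in> localized_ints m"
    then obtain i j where "q * real m ^ i = of_int j" by (auto simp: localized_ints_def Ints_def)
    then have "q = of_int j / real m ^ i" using m by (simp add: field_simps)
    then show "q \<in> (\<lambda>(j::int, i::nat). of_int j / real m ^ i) ` UNIV" by force
  qed
  then show ?thesis by (rule countable_subset) simp
qed

lemma countable_carrier_bsz: "m > 0 \<Longrightarrow> countable (carrier (bsz m))"
proof -
  assume "m > 0"
  then have "countable (localized_ints m \<times> (UNIV :: (int \<times> int) set))"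
    by (intro countable_SIGMA countable_localized_ints) auto
  then show ?thesis
    by (rule countable_subset[rotated]) (auto simp: bsz_def)
qed

lemma group_bsz:
  assumes m: "m > 0"
  shows "group (bsz m)"
proof (rule groupI)
  fix x y z assume "x \<in> carrier (bsz m)" "y \<in> carrier (bsz m)" "z \<in> carrier (bsz m)"
  then show "x \<otimes>\<^bsub>bsz m\<^esub> y \<otimes>\<^bsub>bsz m\<^esub> z = x \<otimes>\<^bsub>bsz m\<^esub> (y \<otimes>\<^bsub>bsz m\<^esub> z)"
    using m by (cases x; cases y; cases z) (simp add: power_int_diff power_int_minus field_simps)
next
  fix x assume "x \<in> carrier (bsz m)"
  moreover obtain q e l where "x = (q, e, l)" by (cases x)
  ultimately show "\<exists>y\<in>carrier (bsz m). y \<otimes>\<^bsub>bsz m\<^esub> x = \<one>\<^bsub>bsz m\<^esub>"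
    using m by (intro bexI[of _ "(- (q * real m powi e), - e, - l)"]) (auto simp: localized_ints_powi)
qed (auto simp: localized_ints_add localized_ints_powi m Ints_localized_ints split: prod.splits)

text \<open>The exponent of \<open>t\<close> is compared first. Multiplication is monotone on both
  sides because \<open>t\<close> acts on the first coordinate by a positive factor.\<close>

lemma ordered_group_bsz:
  assumes m: "m > 0"
  shows "ordered_group (bsz m)
    (\<lambda>(q, e, l) (q', e', l'). e < e' \<or> e = e' \<and> (q < q' \<or> q = q' \<and> l < l'))"
proof -
  interpret group "bsz m" by (rule group_bsz[OF m])
  show ?thesis
    using m by unfold_locales (auto split: prod.splits)
qed

lemma (in group) commutator_eqI:
  assumes "x \<in> carrier G" "y \<in> carrier G" "z \<in> carrier G" "x \<otimes> y = y \<otimes> x \<otimes> z"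
  shows "commutator G x y = z"
  using assms by (simp add: commutator_def m_assoc)

lemma (in group) commutator_eq_one_iff:
  assumes "x \<in> carrier G" "y \<in> carrier G"
  shows "commutator G x y = \<one> \<longleftrightarrow> x \<otimes> y = y \<otimes> x"
proof -
  have "commutator G x y = inv (y \<otimes> x) \<otimes> (x \<otimes> y)"
    using assms by (simp add: commutator_def m_assoc inv_mult_group)
  then show ?thesis
    using assms by (metis inv_closed inv_solve_left' m_closed r_one one_closed)
qed

lemma (in group_hom) hom_commutator:
  "x \<in> carrier G \<Longrightarrow> y \<in> carrier G \<Longrightarrow> h (commutator G x y) = commutator H (h x) (h y)"
  by (simp add: commutator_def)

lemma (in group) commutator_closed:
  "x \<in> carrier G \<Longrightarrow> y \<in> carrier G \<Longrightarrow> commutator G x y \<in> carrier G"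
  by (simp add: commutator_def)

section \<open>The presentation by normal forms\<close>

locale baumslag_solitar =
  fixes m :: nat
  assumes m: "m > 0"
begin

sublocale bsz: group "bsz m" by (rule group_bsz[OF m])

lemma pow_a: "(1, 0, 0) [^]\<^bsub>bsz m\<^esub> (j::nat) = (real j, 0, 0)"
  by (induction j) auto

lemma pow_t: "(0, 1, 0) [^]\<^bsub>bsz m\<^esub> (j::nat) = (0, int j, 0)"
  by (induction j) auto

lemma inv_bsz: "q \<in> localized_ints m \<Longrightarrow> inv\<^bsub>bsz m\<^esub> (q, e, l) = (- (q * real m powi e), - e, - l)"
  using m by (intro bsz.inv_equality) (auto simp: localized_ints_powi)

lemma int_pow_a: "(1, 0, 0) [^]\<^bsub>bsz m\<^esub> (j::int) = (real_of_int j, 0, 0)"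
  by (cases j) (auto simp: int_pow_int bsz.int_pow_neg_int Ints_localized_ints pow_a inv_bsz simp del: of_nat_Suc)

lemma int_pow_c: "(0, 0, 1) [^]\<^bsub>bsz m\<^esub> (j::int) = (0, 0, j)"
proof -
  have "(0, 0, 1) [^]\<^bsub>bsz m\<^esub> (j::nat) = (0, 0, int j)" for j
    by (induction j) auto
  then show ?thesis
    by (cases j) (auto simp: int_pow_int bsz.int_pow_neg_int Ints_localized_ints inv_bsz simp del: of_nat_Suc)
qed

lemma relation_bsz: "(1, 0, 0) \<otimes>\<^bsub>bsz m\<^esub> (0, 1, 0) = (0, 1, 0) \<otimes>\<^bsub>bsz m\<^esub> (1, 0, 0) [^]\<^bsub>bsz m\<^esub> m"
  using m by (simp add: pow_a power_int_minus)

lemma normal_form_bsz: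
  "(0, 1, 0) [^]\<^bsub>bsz m\<^esub> i \<otimes>\<^bsub>bsz m\<^esub> (1, 0, 0) [^]\<^bsub>bsz m\<^esub> (j::int) \<otimes>\<^bsub>bsz m\<^esub>
     inv\<^bsub>bsz m\<^esub> ((0, 1, 0) [^]\<^bsub>bsz m\<^esub> k) \<otimes>\<^bsub>bsz m\<^esub> (0, 0, 1) [^]\<^bsub>bsz m\<^esub> (l::int) =
   (of_int j / real m ^ i, int i - int k, l)"
  by (simp add: pow_t int_pow_a int_pow_c inv_bsz Ints_localized_ints power_int_minus divide_inverse)

lemma normal_form_exists:
  assumes "x \<in> carrier (bsz m)"
  obtains i k :: nat and j l :: int where "x = (of_int j / real m ^ i, int i - int k, l)"
proof -
  obtain q e l where x: "x = (q, e, l)" by (cases x)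
  then obtain i0 where "q * real m ^ i0 \<in> \<int>" using assms by (auto simp: localized_ints_def)
  \<comment> \<open>The denominator is enlarged by \<open>nat e\<close> so that
    \<open>k = i - e\<close> is a natural number.\<close>
  then have "q * real m ^ (i0 + nat e) \<in> \<int>" by (rule Ints_mult_power) simp
  then obtain j where j: "q * real m ^ (i0 + nat e) = of_int j" by (auto simp: Ints_def)
  have "x = (of_int j / real m ^ (i0 + nat e), int (i0 + nat e) - int (nat (int i0 + nat e - e)), l)"
    using j m x by (simp add: field_simps)
  then show ?thesis by (rule that)
qed

end

text \<open>Normal form of words: \<open>T\<^sup>i A\<^sup>j T\<^sup>-\<^sup>k C\<^sup>l\<close>.\<close>

locale bs_relations = group G for G (structure) +
  fixes A T C :: 'a and m :: nat
  assumes A [simp]: "A \<in> carrier G" and T [simp]: "T \<in> carrier G" and C [simp]: "C \<in> carrier G"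
    and AT: "A \<otimes> T = T \<otimes> A [^] m"
    and AC: "A \<otimes> C = C \<otimes> A" and TC: "T \<otimes> C = C \<otimes> T"
begin

definition nf :: "nat \<Rightarrow> int \<Rightarrow> nat \<Rightarrow> int \<Rightarrow> 'a" where
  "nf i j k l = T [^] i \<otimes> A [^] j \<otimes> inv (T [^] k) \<otimes> C [^] l"

text \<open>Conjugation by \<open>T\<close> is an endomorphism that sends \<open>A\<close> to its
  \<open>m\<close>-th power.\<close>

lemma AT_pow: "A [^] (j::int) \<otimes> T = T \<otimes> A [^] (int m * j)"
proof -
  have "cj T A = A [^] int m"
    by (simp add: cj_def m_assoc AT int_pow_int)
  moreover have "cj T \<in> hom G G"
    by (rule homI) (auto simp: cj_mult)
  ultimately have "cj T (A [^] j) = A [^] (int m * j)"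
    using hom_int_pow[OF _ _ is_group is_group, of "cj T" A j] by (simp add: int_pow_pow)
  then have "T \<otimes> cj T (A [^] j) = T \<otimes> A [^] (int m * j)" by simp
  then show ?thesis by (simp add: cj_def m_assoc)
qed

lemma AT_pow_pow: "A [^] (j::int) \<otimes> T [^] i = T [^] (i::nat) \<otimes> A [^] (int m ^ i * j)"
proof (induction i)
  case (Suc i)
  have "A [^] j \<otimes> T [^] Suc i = T [^] i \<otimes> (A [^] (int m ^ i * j) \<otimes> T)"
    by (simp add: Suc flip: m_assoc)
  also have "\<dots> = T [^] Suc i \<otimes> A [^] (int m ^ Suc i * j)"
    by (simp add: AT_pow m_assoc mult.assoc)
  finally show ?case .
qed simp

lemma commutes_int_pow:
  assumes "x \<in> carrier G" "y \<in> carrier G" "x \<otimes> y = y \<otimes> x"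
  shows "x \<otimes> y [^] (l::int) = y [^] l \<otimes> x"
proof -
  have "cj x \<in> hom G G"
    using assms by (intro homI) (auto simp: cj_mult)
  then have "cj x (y [^] l) = cj x y [^] l"
    using hom_int_pow[OF _ _ is_group is_group, of "cj x" y l] assms by simp
  then show ?thesis using assms by (simp add: cj_eq_iff[THEN iffD2] flip: cj_eq_iff)
qed

lemma C_pow_commutes:
  "C [^] (l::int) \<otimes> (T [^] (i::nat) \<otimes> A [^] (j::int) \<otimes> inv (T [^] (k::nat))) =
   T [^] i \<otimes> A [^] j \<otimes> inv (T [^] k) \<otimes> C [^] l"
proof -
  interpret Z: subgroup "centralizer G {C [^] l}" G
    by (rule subgroup_centralizer) auto
  have A: "A \<in> centralizer G {C [^] l}" and T: "T \<in> centralizer G {C [^] l}"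
    unfolding centralizer_def using commutes_int_pow[OF A C AC, of l] commutes_int_pow[OF T C TC, of l] by auto
  have Ti: "T [^] (i::nat) \<in> centralizer G {C [^] l}" for i
    using subgroup_int_pow_closed[OF Z.subgroup_axioms T, of "int i"] by (simp add: int_pow_int)
  have "T [^] i \<otimes> A [^] j \<otimes> inv (T [^] k) \<in> centralizer G {C [^] l}"
    by (intro Z.m_closed Z.m_inv_closed Ti subgroup_int_pow_closed[OF Z.subgroup_axioms A])
  then show ?thesis unfolding centralizer_def by simp
qed

lemma A_nf: "A [^] (z::int) \<otimes> nf i j k l = nf i (int m ^ i * z + j) k l"
proof -
  have "A [^] z \<otimes> nf i j k l = (A [^] z \<otimes> T [^] i) \<otimes> (A [^] j \<otimes> inv (T [^] k) \<otimes> C [^] l)"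
    by (simp add: nf_def m_assoc)
  also have "\<dots> = T [^] i \<otimes> (A [^] (int m ^ i * z) \<otimes> A [^] j) \<otimes> inv (T [^] k) \<otimes> C [^] l"
    unfolding AT_pow_pow by (simp add: m_assoc)
  finally show ?thesis by (simp add: nf_def int_pow_mult)
qed

lemma T_nf: "T \<otimes> nf i j k l = nf (Suc i) j k l"
  unfolding nf_def nat_pow_Suc2[OF T] by (simp add: m_assoc)

lemma inv_T_nf_Suc: "inv T \<otimes> nf (Suc i) j k l = nf i j k l"
  by (simp add: m_assoc flip: T_nf) (simp add: nf_def)

text \<open>Without a \<open>T\<close> on the left to cancel, the inverse of \<open>T\<close> must
  travel to the right through the power of \<open>A\<close>. This is the direction in which the
  exponent is multiplied, not divided, by \<open>m\<close>.\<close>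

lemma inv_T_nf_0: "inv T \<otimes> nf 0 j k l = nf 0 (int m * j) (Suc k) l"
proof -
  have "inv T \<otimes> A [^] j = A [^] (int m * j) \<otimes> inv T"
  proof -
    have "inv T \<otimes> (A [^] j \<otimes> T) \<otimes> inv T = inv T \<otimes> (T \<otimes> A [^] (int m * j)) \<otimes> inv T"
      by (simp only: AT_pow)
    then show ?thesis by (simp add: m_assoc)
  qed
  then have "inv T \<otimes> nf 0 j k l = A [^] (int m * j) \<otimes> (inv T \<otimes> inv (T [^] k)) \<otimes> C [^] l"
    by (simp add: nf_def flip: m_assoc)
  also have "inv T \<otimes> inv (T [^] k) = inv (T [^] Suc k)"
    by (simp add: inv_mult_group)
  finally show ?thesis by (simp add: nf_def)
qed

lemma C_nf: "C [^] (z::int) \<otimes> nf i j k l = nf i j k (z + l)"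
proof -
  have "C [^] z \<otimes> nf i j k l = (C [^] z \<otimes> (T [^] i \<otimes> A [^] j \<otimes> inv (T [^] k))) \<otimes> C [^] l"
    by (simp add: nf_def m_assoc)
  also have "\<dots> = nf i j k (z + l)"
    unfolding C_pow_commutes by (simp add: nf_def m_assoc int_pow_mult)
  finally show ?thesis .
qed

text \<open>Left multiplication by any letter keeps the shape \<open>nf\<close>, so induction over
  the word suffices.\<close>

lemma eval_word_eq_nf:
  assumes \<phi>: "\<phi> 0 = A" "\<phi> 2 = T" "\<phi> 3 = C" and w: "fst ` set w \<subseteq> {0, 2, 3::nat}"
  shows "\<exists>i j k l. eval_word G \<phi> w = nf i j k l"
  using w
proof (induction w)
  case Nil
  have "eval_word G \<phi> [] = nf 0 0 0 0" by (simp add: nf_def)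
  then show ?case by blast
next
  case (Cons x w)
  then obtain i j k l where IH: "eval_word G \<phi> w = nf i j k l" by auto
  obtain y s where x: "x = (y, s)" by (cases x)
  have pm: "letter G \<phi> x = \<phi> y [^] (if s then 1 else - 1 :: int)" if "\<phi> y \<in> carrier G"
    using that by (simp add: letter_def x int_pow_neg)
  from Cons.prems x consider "y = 0" | "y = 2" | "y = 3" by auto
  then have "\<exists>i' j' k' l'. letter G \<phi> x \<otimes> nf i j k l = nf i' j' k' l'"
  proof cases
    case 1
    then show ?thesis using pm \<phi>(1) A_nf by simp blast
  next
    case 2
    then show ?thesis
      using x T_nf[of i j k l] inv_T_nf_Suc[of "i - 1" j k l] inv_T_nf_0[of j k l] \<phi>(2)
      by (cases s; cases i) (simp_all add: letter_def, blast+)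
  next
    case 3
    then show ?thesis using pm \<phi>(3) C_nf by simp blast
  qed
  then show ?case using IH by simp
qed

end

context baumslag_solitar
begin

text \<open>The generators \<open>0\<close>, \<open>2\<close>, \<open>3\<close> stand for
  \<open>a\<close>, \<open>t\<close>, \<open>c\<close>.\<close>

definition relators :: "nat word set" where
  "relators = (let F = free_group {0, 2, 3} in
     {gen 0 \<otimes>\<^bsub>F\<^esub> gen 2 \<otimes>\<^bsub>F\<^esub> inv\<^bsub>F\<^esub> (gen 2 \<otimes>\<^bsub>F\<^esub> gen 0 [^]\<^bsub>F\<^esub> m),
      commutator F (gen 0) (gen 3), commutator F (gen 2) (gen 3)})"

lemma relators_closed: "relators \<subseteq> carrier (free_group {0, 2, 3})"
proof -
  interpret F: group "free_group {0, 2, 3 :: nat}" by (rule group_free_group)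
  show ?thesis by (auto simp: relators_def Let_def commutator_def)
qed

sublocale presentation "{0, 2, 3 :: nat}" relators
  by unfold_locales (rule relators_closed)

sublocale P: bs_relations P "pr (gen 0)" "pr (gen 2)" "pr (gen 3)" m
proof unfold_locales
  have g: "gen 0 \<in> carrier F" "gen 2 \<in> carrier F" "gen 3 \<in> carrier F" by auto
  then show "pr (gen 0) \<in> carrier P" "pr (gen 2) \<in> carrier P" "pr (gen 3) \<in> carrier P"
    by (simp_all only: pr.hom_closed)
  have "pr (gen 0 \<otimes>\<^bsub>F\<^esub> gen 2 \<otimes>\<^bsub>F\<^esub> inv\<^bsub>F\<^esub> (gen 2 \<otimes>\<^bsub>F\<^esub> gen 0 [^]\<^bsub>F\<^esub> m)) = \<one>\<^bsub>P\<^esub>"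
    by (rule pr_relator) (simp add: relators_def Let_def)
  then have "pr (gen 0 \<otimes>\<^bsub>F\<^esub> gen 2) \<otimes>\<^bsub>P\<^esub> inv\<^bsub>P\<^esub> pr (gen 2 \<otimes>\<^bsub>F\<^esub> gen 0 [^]\<^bsub>F\<^esub> m) = \<one>\<^bsub>P\<^esub>"
    using g by (simp del: pr.hom_mult add: pr.hom_mult[of "gen 0 \<otimes>\<^bsub>F\<^esub> gen 2"])
  then have "pr (gen 0 \<otimes>\<^bsub>F\<^esub> gen 2) = pr (gen 2 \<otimes>\<^bsub>F\<^esub> gen 0 [^]\<^bsub>F\<^esub> m)"
    using g P.inv_solve_right'[of "\<one>\<^bsub>P\<^esub>" "pr (gen 0 \<otimes>\<^bsub>F\<^esub> gen 2)" "pr (gen 2 \<otimes>\<^bsub>F\<^esub> gen 0 [^]\<^bsub>F\<^esub> m)"]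
    by (simp del: pr.hom_mult)
  then show "pr (gen 0) \<otimes>\<^bsub>P\<^esub> pr (gen 2) = pr (gen 2) \<otimes>\<^bsub>P\<^esub> pr (gen 0) [^]\<^bsub>P\<^esub> m"
    using g by (simp add: pr.hom_nat_pow)
  have "pr (commutator F (gen 0) (gen 3)) = \<one>\<^bsub>P\<^esub>" "pr (commutator F (gen 2) (gen 3)) = \<one>\<^bsub>P\<^esub>"
    by (rule pr_relator, simp add: relators_def Let_def)+
  then show "pr (gen 0) \<otimes>\<^bsub>P\<^esub> pr (gen 3) = pr (gen 3) \<otimes>\<^bsub>P\<^esub> pr (gen 0)"
    "pr (gen 2) \<otimes>\<^bsub>P\<^esub> pr (gen 3) = pr (gen 3) \<otimes>\<^bsub>P\<^esub> pr (gen 2)"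
    using g by (simp_all add: pr.hom_commutator P.commutator_eq_one_iff)
qed

definition nf_word :: "nat \<Rightarrow> int \<Rightarrow> nat \<Rightarrow> int \<Rightarrow> nat word" where
  "nf_word i j k l =
     gen 2 [^]\<^bsub>F\<^esub> i \<otimes>\<^bsub>F\<^esub> gen 0 [^]\<^bsub>F\<^esub> j \<otimes>\<^bsub>F\<^esub> inv\<^bsub>F\<^esub> (gen 2 [^]\<^bsub>F\<^esub> k) \<otimes>\<^bsub>F\<^esub> gen 3 [^]\<^bsub>F\<^esub> l"

lemma nf_word_closed: "nf_word i j k l \<in> carrier F"
  by (simp add: nf_word_def)

lemma pr_nf_word: "pr (nf_word i j k l) = P.nf i j k l"
  by (simp add: nf_word_def P.nf_def pr.hom_nat_pow pr.hom_int_pow)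

lemma pr_eq_eval_word:
  "w \<in> carrier F \<Longrightarrow> pr w = eval_word P (\<lambda>x. pr (gen x)) w"
proof (induction w)
  case Nil
  then show ?case using pr.hom_one by (simp add: free_group_def)
next
  case (Cons x w)
  have "pr (letter F gen x) = letter P (\<lambda>x. pr (gen x)) x"
    using free_group_Cons(2)[OF Cons.prems] by (auto simp: letter_def)
  moreover have "pr (letter F gen x \<otimes>\<^bsub>F\<^esub> w) = pr (letter F gen x) \<otimes>\<^bsub>P\<^esub> pr w"
    using free_group_Cons[OF Cons.prems] by (intro pr.hom_mult F.letter_closed) auto
  ultimately have "pr (letter F gen x \<otimes>\<^bsub>F\<^esub> w) = eval_word P (\<lambda>x. pr (gen x)) (x # w)"
    using Cons.IH free_group_Cons(3)[OF Cons.prems] by simp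
  then show ?case by (simp only: free_group_Cons(1)[OF Cons.prems, symmetric])
qed

definition \<phi> :: "nat \<Rightarrow> real \<times> int \<times> int" where
  "\<phi> x = (if x = 0 then (1, 0, 0) else if x = 2 then (0, 1, 0) else (0, 0, 1))"

lemma \<phi>_closed: "\<phi> x \<in> carrier (bsz m)"
  by (simp add: \<phi>_def Ints_localized_ints)

sublocale ev: group_hom F "bsz m" "eval_word (bsz m) \<phi>"
  by unfold_locales (rule bsz.eval_word_hom, rule \<phi>_closed)

lemma eval_gen: "eval_word (bsz m) \<phi> (gen x) = \<phi> x"
  by (simp add: bsz.group_axioms \<phi>_closed)

lemma eval_nf_word: "eval_word (bsz m) \<phi> (nf_word i j k l) = (of_int j / real m ^ i, int i - int k, l)"
  unfolding nf_word_def normal_form_bsz[symmetric]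
  by (simp add: ev.hom_nat_pow ev.hom_int_pow eval_gen) (simp add: \<phi>_def)

text \<open>Modulo \<open>N\<close> a word of the kernel equals a normal form word, which then also
  lies in the kernel. The concrete triple it evaluates to forces \<open>i = k\<close>,
  \<open>j = 0\<close>, \<open>l = 0\<close>, and such a normal form is trivial in
  \<open>P\<close>.\<close>

lemma kernel_eq: "kernel F (bsz m) (eval_word (bsz m) \<phi>) = N"
proof
  show NK: "N \<subseteq> kernel F (bsz m) (eval_word (bsz m) \<phi>)"
  proof (rule ev.normal_closure_subset_kernel[OF relators_closed])
    fix r assume "r \<in> relators"
    then consider "r = gen 0 \<otimes>\<^bsub>F\<^esub> gen 2 \<otimes>\<^bsub>F\<^esub> inv\<^bsub>F\<^esub> (gen 2 \<otimes>\<^bsub>F\<^esub> gen 0 [^]\<^bsub>F\<^esub> m)"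
      | x where "r = commutator F (gen x) (gen 3)" "x \<in> {0, 2}"
      by (auto simp: relators_def Let_def)
    then show "eval_word (bsz m) \<phi> r = \<one>\<^bsub>bsz m\<^esub>"
    proof cases
      case 1
      have "eval_word (bsz m) \<phi> (gen 0 \<otimes>\<^bsub>F\<^esub> gen 2) = eval_word (bsz m) \<phi> (gen 2 \<otimes>\<^bsub>F\<^esub> gen 0 [^]\<^bsub>F\<^esub> m)"
        using relation_bsz by (simp add: ev.hom_nat_pow eval_gen) (simp add: \<phi>_def)
      then show ?thesis using 1
        by (simp del: ev.hom_mult one_bsz add: ev.hom_mult[of "gen 0 \<otimes>\<^bsub>F\<^esub> gen 2"])
    next
      case 2
      then have "gen x \<in> carrier F" by auto
      moreover have "\<phi> x \<otimes>\<^bsub>bsz m\<^esub> \<phi> 3 = \<phi> 3 \<otimes>\<^bsub>bsz m\<^esub> \<phi> x" using 2 by (auto simp: \<phi>_def)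
      ultimately show ?thesis
        using 2 \<phi>_closed by (simp add: commutator_def eval_gen bsz.m_assoc del: one_bsz mult_bsz)
    qed
  qed
  show "kernel F (bsz m) (eval_word (bsz m) \<phi>) \<subseteq> N"
  proof
    fix w assume w: "w \<in> kernel F (bsz m) (eval_word (bsz m) \<phi>)"
    then have wF: "w \<in> carrier F" and ew: "eval_word (bsz m) \<phi> w = (0, 0, 0)" by (auto simp: kernel_def)
    obtain i j k l where "pr w = P.nf i j k l"
      using pr_eq_eval_word[OF wF] P.eval_word_eq_nf[of "\<lambda>x. pr (gen x)" w] wF
      by (auto simp: carrier_free_group)
    then have "pr w = pr (nf_word i j k l)" by (simp add: pr_nf_word)
    then have "pr (w \<otimes>\<^bsub>F\<^esub> inv\<^bsub>F\<^esub> nf_word i j k l) = \<one>\<^bsub>P\<^esub>"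
      using wF nf_word_closed by (simp del: pr.hom_mult add: pr.hom_mult[of w])
    then have "w \<otimes>\<^bsub>F\<^esub> inv\<^bsub>F\<^esub> nf_word i j k l \<in> kernel F (bsz m) (eval_word (bsz m) \<phi>)"
      using pr_eq_one_iff[of "w \<otimes>\<^bsub>F\<^esub> inv\<^bsub>F\<^esub> nf_word i j k l"] wF nf_word_closed[of i j k l] NK
      by (auto simp del: pr.hom_mult)
    then have "eval_word (bsz m) \<phi> w = eval_word (bsz m) \<phi> (nf_word i j k l)"
      using wF nf_word_closed[of i j k l]
        bsz.inv_solve_right'[of "\<one>\<^bsub>bsz m\<^esub>" "eval_word (bsz m) \<phi> w" "eval_word (bsz m) \<phi> (nf_word i j k l)"]
      by (simp add: kernel_def del: one_bsz)
    then have "i = k" "j = 0" "l = 0" using ew m by (auto simp: eval_nf_word)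
    then have "pr w = \<one>\<^bsub>P\<^esub>"
      using \<open>pr w = P.nf i j k l\<close> by (simp add: P.nf_def)
    then show "w \<in> N" using wF pr_eq_one_iff by blast
  qed
qed

lemma finitely_presented_bsz: "finitely_presented (bsz m)"
proof -
  have "carrier (bsz m) \<subseteq> eval_word (bsz m) \<phi> ` carrier F"
  proof
    fix x assume "x \<in> carrier (bsz m)"
    then obtain i j k l where "x = (of_int j / real m ^ i, int i - int k, l)"
      by (rule normal_form_exists)
    then have "x = eval_word (bsz m) \<phi> (nf_word i j k l)" by (simp only: eval_nf_word)
    then show "x \<in> eval_word (bsz m) \<phi> ` carrier F" using nf_word_closed by blast
  qed
  then have "eval_word (bsz m) \<phi> ` carrier F = carrier (bsz m)" by auto
  then have "F Mod kernel F (bsz m) (eval_word (bsz m) \<phi>) \<cong> bsz m" by (rule ev.FactGroup_iso)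
  then have "P \<cong> bsz m" by (simp add: presented_group_def kernel_eq)
  then have "bsz m \<cong> P" by (rule P.iso_sym)
  moreover have "finite relators" by (simp add: relators_def Let_def)
  ultimately show ?thesis unfolding finitely_presented_def
    by (intro exI[of _ "{0, 2, 3}"] exI[of _ relators] conjI relators_closed) simp_all
qed

end

section \<open>The Sidki double\<close>

text \<open>The cocycle pairs \<open>(u, v)\<close> of the left factor with \<open>(x, y)\<close> of
  the right one. As the determinant of a vector with itself is 0, equal vectors placed in the two
  copies of \<open>(\<int>/n)\<^sup>2\<close> commute; the two standard basis vectors placed in
  different copies have a generator of the centre \<open>\<int>/n\<close> as commutator.\<close>

definition heisenberg :: "nat \<Rightarrow> (int \<times> int \<times> int \<times> int \<times> int) monoid" where
  "heisenberg n =
     \<lparr>carrier = {0..<int n} \<times> {0..<int n} \<times> {0..<int n} \<times> {0..<int n} \<times> {0..<int n},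
      monoid.mult = (\<lambda>(x, y, u, v, z) (x', y', u', v', z').
        ((x + x') mod n, (y + y') mod n, (u + u') mod n, (v + v') mod n,
         (z + z' + u * y' - v * x') mod n)),
      one = (0, 0, 0, 0, 0)\<rparr>"

lemma group_heisenberg:
  assumes "n > 0"
  shows "group (heisenberg n)"
proof (rule groupI)
  fix g h k assume "g \<in> carrier (heisenberg n)" "h \<in> carrier (heisenberg n)" "k \<in> carrier (heisenberg n)"
  show "g \<otimes>\<^bsub>heisenberg n\<^esub> h \<otimes>\<^bsub>heisenberg n\<^esub> k = g \<otimes>\<^bsub>heisenberg n\<^esub> (h \<otimes>\<^bsub>heisenberg n\<^esub> k)"
  proof -
    obtain x y u v z x' y' u' v' z' x'' y'' u'' v'' z'' where
      ghk: "g = (x, y, u, v, z)" "h = (x', y', u', v', z')" "k = (x'', y'', u'', v'', z'')"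
      by (cases g; cases h; cases k)
    \<comment> \<open>Associativity in the last coordinate is bilinearity of the cocycle; the
      remaining work is to move \<open>mod n\<close> outwards and back in.\<close>
    have "((z + z' + u * y' - v * x') mod n + z'' + ((u + u') mod n) * y'' - ((v + v') mod n) * x'') mod n =
        (z + z' + u * y' - v * x' + z'' + (u + u') * y'' - (v + v') * x'') mod n"
      by (intro mod_diff_cong mod_add_cong mod_mult_cong refl mod_mod_trivial)
    also have "\<dots> = (z + (z' + z'' + u' * y'' - v' * x'') + u * (y' + y'') - v * (x' + x'')) mod n"
      by (simp add: algebra_simps)
    also have "\<dots> = (z + (z' + z'' + u' * y'' - v' * x'') mod n + u * ((y' + y'') mod n) - v * ((x' + x'') mod n)) mod n"
      by (intro mod_diff_cong mod_add_cong mod_mult_cong refl mod_mod_trivial[symmetric])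
    finally show ?thesis
      by (simp add: heisenberg_def ghk mod_simps ac_simps)
  qed
next
  fix g assume "g \<in> carrier (heisenberg n)"
  moreover obtain x y u v z where g: "g = (x, y, u, v, z)" by (cases g)
  ultimately show "\<exists>h\<in>carrier (heisenberg n). h \<otimes>\<^bsub>heisenberg n\<^esub> g = \<one>\<^bsub>heisenberg n\<^esub>"
  \<comment> \<open>The last entry w solves w + z - u y + v x = 0.\<close>
  proof (intro bexI[of _ "((- x) mod n, (- y) mod n, (- u) mod n, (- v) mod n, (u * y - v * x - z) mod n)"])
    have "((u * y - v * x - z) mod n + z + ((- u) mod n) * y - ((- v) mod n) * x) mod n =
        (u * y - v * x - z + z + (- u) * y - (- v) * x) mod n"
      by (intro mod_diff_cong mod_add_cong mod_mult_cong refl mod_mod_trivial)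
    then show "((- x) mod n, (- y) mod n, (- u) mod n, (- v) mod n, (u * y - v * x - z) mod n)
        \<otimes>\<^bsub>heisenberg n\<^esub> g = \<one>\<^bsub>heisenberg n\<^esub>"
      by (simp add: heisenberg_def g mod_simps)
  qed (use assms in \<open>auto simp: heisenberg_def\<close>)
qed (use assms in \<open>auto simp: heisenberg_def\<close>)

locale sidki = G: group G for G (structure)
begin

abbreviation "relators \<equiv> sidki_table G \<union>
  {commutator (sidki_free G) (gen (Inl g)) (gen (Inr g)) | g. g \<in> carrier G}"

sublocale presentation "Inl ` carrier G \<union> Inr ` carrier G" relators
proof
  interpret F: group "sidki_free G" by (rule group_free_group)
  show "relators \<subseteq> carrier (sidki_free G)"
    by (auto simp: sidki_table_def commutator_def)
qed

lemma P_eq: "P = sidki_double G"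
  by (simp add: sidki_double_def)

lemma pr_gen_mult:
  assumes "c \<in> {Inl, Inr}" "g \<in> carrier G" "h \<in> carrier G"
  shows "pr (gen (c (g \<otimes> h))) = pr (gen (c g)) \<otimes>\<^bsub>P\<^esub> pr (gen (c h))"
proof -
  define x y z where "x = gen (c g)" and "y = gen (c h)" and "z = gen (c (g \<otimes> h))"
  have 1: "x \<otimes>\<^bsub>F\<^esub> y \<otimes>\<^bsub>F\<^esub> inv\<^bsub>F\<^esub> z \<in> relators"
    using assms unfolding x_def y_def z_def sidki_table_def by blast
  have 2: "x \<in> carrier F" "y \<in> carrier F" "z \<in> carrier F"
    using assms by (auto simp: x_def y_def z_def)
  have "pr x \<otimes>\<^bsub>P\<^esub> pr y \<otimes>\<^bsub>P\<^esub> inv\<^bsub>P\<^esub> pr z = \<one>\<^bsub>P\<^esub>"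
    using pr_relator[OF 1] 2 by simp
  then have "pr x \<otimes>\<^bsub>P\<^esub> pr y = pr z"
    using P.inv_solve_right'[of "\<one>\<^bsub>P\<^esub>" "pr x \<otimes>\<^bsub>P\<^esub> pr y" "pr z"] 2 by simp
  then show ?thesis by (simp add: x_def y_def z_def)
qed

lemma weak_commutativity: "weak_commutativity G P (\<lambda>g. pr (gen (Inl g))) (\<lambda>g. pr (gen (Inr g)))"
proof unfold_locales
  show "(\<lambda>g. pr (gen (Inl g))) \<in> hom G P" "(\<lambda>g. pr (gen (Inr g))) \<in> hom G P"
    by (rule homI; simp add: pr_gen_mult)+
  fix g assume g: "g \<in> carrier G"
  then have "pr (commutator F (gen (Inl g)) (gen (Inr g))) = \<one>\<^bsub>P\<^esub>"
    by (intro pr_relator) auto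
  then show "pr (gen (Inl g)) \<otimes>\<^bsub>P\<^esub> pr (gen (Inr g)) = pr (gen (Inr g)) \<otimes>\<^bsub>P\<^esub> pr (gen (Inl g))"
    using g by (simp add: pr.hom_commutator P.commutator_eq_one_iff)
qed

text \<open>\<open>\<mu>\<close> and \<open>\<nu>\<close> are homomorphisms to
  \<open>\<int>/n\<close> in terms of least residues. They define a homomorphism from the double to
  \<open>heisenberg n\<close> that sends the commutator to a central element of order
  \<open>n\<close>.\<close>

lemma dvd_ord_commutator:
  fixes n :: nat and \<mu> \<nu> :: "'a \<Rightarrow> int"
  assumes n: "n > 1"
    and \<mu>: "\<And>g. g \<in> carrier G \<Longrightarrow> 0 \<le> \<mu> g \<and> \<mu> g < n"
      "\<And>g h. g \<in> carrier G \<Longrightarrow> h \<in> carrier G \<Longrightarrow> \<mu> (g \<otimes> h) = (\<mu> g + \<mu> h) mod n"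
    and \<nu>: "\<And>g. g \<in> carrier G \<Longrightarrow> 0 \<le> \<nu> g \<and> \<nu> g < n"
      "\<And>g h. g \<in> carrier G \<Longrightarrow> h \<in> carrier G \<Longrightarrow> \<nu> (g \<otimes> h) = (\<nu> g + \<nu> h) mod n"
    and a: "a \<in> carrier G" "\<mu> a = 1" "\<nu> a = 0" and c: "c \<in> carrier G" "\<mu> c = 0" "\<nu> c = 1"
  shows "n dvd P.ord (commutator P (pr (gen (Inl a))) (pr (gen (Inr c))))"
proof -
  let ?H = "heisenberg n"
  interpret H: group ?H using n by (intro group_heisenberg) simp
  define \<alpha> where "\<alpha> g = (\<mu> g, \<nu> g, 0::int, 0::int, 0::int)" for g
  define \<beta> where "\<beta> g = (0::int, 0::int, \<mu> g, \<nu> g, 0::int)" for g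
  define \<phi> where "\<phi> = case_sum \<alpha> \<beta>"
  have \<alpha>: "\<alpha> g \<in> carrier ?H" "g \<in> carrier G \<Longrightarrow> h \<in> carrier G \<Longrightarrow> \<alpha> (g \<otimes> h) = \<alpha> g \<otimes>\<^bsub>?H\<^esub> \<alpha> h" 
    and \<beta>: "\<beta> g \<in> carrier ?H" "g \<in> carrier G \<Longrightarrow> h \<in> carrier G \<Longrightarrow> \<beta> (g \<otimes> h) = \<beta> g \<otimes>\<^bsub>?H\<^esub> \<beta> h"
    if "g \<in> carrier G" for g h
    using that \<mu> \<nu> n by (auto simp: \<alpha>_def \<beta>_def heisenberg_def)
  have \<alpha>\<beta>: "\<alpha> g \<otimes>\<^bsub>?H\<^esub> \<beta> g = \<beta> g \<otimes>\<^bsub>?H\<^esub> \<alpha> g" for g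
    by (simp add: \<alpha>_def \<beta>_def heisenberg_def)
  interpret ev: group_hom F ?H "eval_word ?H \<phi>"
    by unfold_locales (rule H.eval_word_hom, auto simp: \<phi>_def \<alpha> \<beta>)
  have gen [simp]: "eval_word ?H \<phi> (gen (Inl g)) = \<alpha> g" "eval_word ?H \<phi> (gen (Inr g)) = \<beta> g"
    if "g \<in> carrier G" for g
    using that by (simp_all add: H.group_axioms \<phi>_def \<alpha> \<beta>)
  have "eval_word ?H \<phi> r = \<one>\<^bsub>?H\<^esub>" if "r \<in> relators" for r
  proof -
    from that consider
        (table) c g h where "c \<in> {Inl, Inr}" "g \<in> carrier G" "h \<in> carrier G"
          "r = gen (c g) \<otimes>\<^bsub>F\<^esub> gen (c h) \<otimes>\<^bsub>F\<^esub> inv\<^bsub>F\<^esub> gen (c (g \<otimes> h))"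
      | (comm) g where "g \<in> carrier G" "r = commutator F (gen (Inl g)) (gen (Inr g))"
      unfolding sidki_table_def by blast
    then show ?thesis
    proof cases
      case table
      then show ?thesis by (auto simp: \<alpha> \<beta>)
    next
      case comm
      then show ?thesis by (simp add: ev.hom_commutator H.commutator_eq_one_iff \<alpha> \<beta> \<alpha>\<beta>)
    qed
  qed
  then have kernel: "N \<subseteq> kernel F ?H (eval_word ?H \<phi>)"
    by (intro ev.normal_closure_subset_kernel R)
  let ?w = "commutator F (gen (Inl a)) (gen (Inr c))"
  let ?k = "P.ord (pr ?w)"
  have w: "?w \<in> carrier F" using a c by (intro F.commutator_closed) auto
  \<comment> \<open>This also holds for infinite order, which \<open>P.ord\<close> records as 0;
    finiteness is established separately.\<close>
  have "pr (?w [^]\<^bsub>F\<^esub> ?k) = \<one>\<^bsub>P\<^esub>" using w by (simp add: pr.hom_nat_pow)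
  then have "?w [^]\<^bsub>F\<^esub> ?k \<in> N" using w pr_eq_one_iff by simp
  then have 1: "eval_word ?H \<phi> ?w [^]\<^bsub>?H\<^esub> ?k = \<one>\<^bsub>?H\<^esub>"
    using kernel w by (auto simp: kernel_def ev.hom_nat_pow)
  have "eval_word ?H \<phi> ?w = (0, 0, 0, 0, 1)"
    using a c n
    by (simp add: ev.hom_commutator, intro H.commutator_eqI \<alpha> \<beta>)
      (auto simp: \<alpha>_def \<beta>_def heisenberg_def mod_simps)
  moreover have "(0, 0, 0, 0, 1) [^]\<^bsub>?H\<^esub> k = (0, 0, 0, 0, int k mod n)" for k :: nat
    using n by (induction k) (auto simp: heisenberg_def mod_simps add.commute)
  ultimately have "int ?k mod int n = 0"
    using 1 by (simp add: heisenberg_def)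
  then have "n dvd ?k" by (simp flip: of_nat_mod of_nat_dvd_iff add: mod_eq_0_iff_dvd)
  then show ?thesis using a c by (simp add: pr.hom_commutator)
qed

text \<open>The order of \<open>?w\<close> is positive, as it divides \<open>n ^ 3\<close>, and has
  the form \<open>n * q\<close>; so the power of \<open>?w\<close> with exponent \<open>q\<close>
  has order \<open>n\<close>.\<close>

lemma exists_element_of_order:
  fixes n :: nat and \<mu> \<nu> :: "'a \<Rightarrow> int"
  assumes n: "n > 1"
    and \<mu>: "\<And>g. g \<in> carrier G \<Longrightarrow> 0 \<le> \<mu> g \<and> \<mu> g < n"
      "\<And>g h. g \<in> carrier G \<Longrightarrow> h \<in> carrier G \<Longrightarrow> \<mu> (g \<otimes> h) = (\<mu> g + \<mu> h) mod n"
    and \<nu>: "\<And>g. g \<in> carrier G \<Longrightarrow> 0 \<le> \<nu> g \<and> \<nu> g < n"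
      "\<And>g h. g \<in> carrier G \<Longrightarrow> h \<in> carrier G \<Longrightarrow> \<nu> (g \<otimes> h) = (\<nu> g + \<nu> h) mod n"
    and a: "a \<in> carrier G" "\<mu> a = 1" "\<nu> a = 0" and c: "c \<in> carrier G" "\<mu> c = 0" "\<nu> c = 1"
    and t: "t \<in> carrier G" "a \<otimes> t = t \<otimes> a [^] Suc n"
    and central: "\<And>g. g \<in> carrier G \<Longrightarrow> g \<otimes> c = c \<otimes> g"
  shows "\<exists>x\<in>carrier (sidki_double G). group.ord (sidki_double G) x = n"
proof -
  interpret weak_commutativity G P "\<lambda>g. pr (gen (Inl g))" "\<lambda>g. pr (gen (Inr g))"
    by (rule weak_commutativity)
  let ?w = "commutator P (pr (gen (Inl a))) (pr (gen (Inr c)))"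
  have w: "?w \<in> carrier P" using a c by (intro P.commutator_closed) auto
  have "?w [^]\<^bsub>P\<^esub> (n ^ 3) = \<one>\<^bsub>P\<^esub>"
    using torsion[OF c(1) central t(1) a(1) t(2)] by simp
  then have ord: "P.ord ?w > 0"
    using w n P.pow_eq_id[of ?w "n ^ 3"] by (cases "P.ord ?w = 0") auto
  have dvd: "n dvd P.ord ?w"
    by (rule dvd_ord_commutator[of n \<mu> \<nu>]) (use assms in auto)
  then obtain q where q: "P.ord ?w = n * q" by (elim dvdE)
  then have "P.ord (?w [^]\<^bsub>P\<^esub> q) = n"
    using P.ord_pow[OF w, of q] ord by simp
  moreover have "?w [^]\<^bsub>P\<^esub> q \<in> carrier P" using w by (rule P.nat_pow_closed)
  ultimately show ?thesis unfolding P_eq by blast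
qed

end

section \<open>Lifting maps to the circle\<close>

text \<open>A continuous map from a compact space onto a Hausdorff space is a quotient map.
  Functions on the mapping torus, on spheres and on discs are built in this way from functions on
  cylinders and boxes.\<close>

lemma continuous_factor:
  fixes p :: "'a::topological_space \<Rightarrow> 'b::metric_space" and f :: "'a \<Rightarrow> 'c::topological_space"
  assumes "compact S" "continuous_on S p" "continuous_on S f"
    and fibres: "\<And>x y. x \<in> S \<Longrightarrow> y \<in> S \<Longrightarrow> p x = p y \<Longrightarrow> f x = f y"
  shows "\<exists>h. continuous_on (p ` S) h \<and> (\<forall>x\<in>S. h (p x) = f x)"
proof -
  have q: "quotient_map (top_of_set S) (top_of_set (p ` S)) p"
  proof (intro continuous_imp_quotient_map)
    show "continuous_map (top_of_set S) (top_of_set (p ` S)) p"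
      using assms(2) by simp
    show "compact_space (top_of_set S)"
      using assms(1) by (simp add: compact_space_subtopology)
    show "Hausdorff_space (top_of_set (p ` S))"
      by (intro Hausdorff_space_subtopology) simp
  qed simp
  have c: "continuous_map (top_of_set S) euclidean f" using assms(3) by simp
  have fib: "f x = f y" if "x \<in> topspace (top_of_set S)" "y \<in> topspace (top_of_set S)" "p x = p y" for x y
    by (rule fibres) (use that in auto)
  show ?thesis
  proof (rule quotient_map_lift_exists[OF q c fib])
    fix h assume "continuous_map (top_of_set (p ` S)) euclidean h"
      "\<And>x. x \<in> topspace (top_of_set S) \<Longrightarrow> h (p x) = f x"
    then show ?thesis by (intro exI[of _ h]) auto
  qed
qed

lemma cis_eq_cis_iff: "cis (2 * pi * x) = cis (2 * pi * y) \<longleftrightarrow> x - y \<in> \<int>"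
proof -
  have "cis (2 * pi * x) = cis (2 * pi * y) \<longleftrightarrow> (\<exists>n::int. 2 * pi * x = 2 * pi * y + 2 * pi * n)"
    using sin_cos_eq_iff[of "2 * pi * x" "2 * pi * y"] by (auto simp: complex_eq_iff)
  also have "\<dots> \<longleftrightarrow> (\<exists>n::int. x = y + n)"
    by (simp flip: distrib_left)
  also have "\<dots> \<longleftrightarrow> x - y \<in> \<int>"
    by (auto simp: Ints_def algebra_simps)
  finally show ?thesis .
qed

lemma cis_eq_1_iff': "cis x = 1 \<longleftrightarrow> x / (2 * pi) \<in> \<int>"
  using cis_eq_cis_iff[of "x / (2 * pi)" 0] by simp

text \<open>Takes the place of discreteness of fibres: a connected subset of the line with two
  points contains an interval and is uncountable.\<close>

lemma continuous_countable_constant: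
  fixes f :: "'a::topological_space \<Rightarrow> real"
  assumes "connected S" "continuous_on S f" "countable (f ` S)" "x \<in> S" "y \<in> S"
  shows "f x = f y"
proof (rule ccontr)
  assume "f x \<noteq> f y"
  then have "uncountable {min (f x) (f y)..max (f x) (f y)}"
    by (simp add: uncountable_closed_interval)
  moreover have "{min (f x) (f y)..max (f x) (f y)} \<subseteq> f ` S"
    using connected_continuous_image[OF assms(2,1)] assms(4,5)
    by (intro connected_contains_Icc) (auto simp: min_def max_def)
  ultimately show False using assms(3) countable_subset by blast
qed

text \<open>The quotient \<open>H (t, k) / H (0, k)\<close> is lifted rather than \<open>H\<close>,
  because \<open>H (0, _)\<close> by itself need not have a logarithm on \<open>K\<close>.\<close>

lemma lift_homotopy_circle:
  fixes H :: "real \<times> 'a::metric_space \<Rightarrow> complex"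
  assumes K: "compact K" and H: "continuous_on ({0..1} \<times> K) H"
    and unit: "\<And>z. z \<in> {0..1} \<times> K \<Longrightarrow> norm (H z) = 1"
  shows "\<exists>L :: real \<times> 'a \<Rightarrow> real. continuous_on ({0..1} \<times> K) L \<and>
    (\<forall>k\<in>K. L (0, k) = 0) \<and> (\<forall>t\<in>{0..1}. \<forall>k\<in>K. H (t, k) = H (0, k) * cis (L (t, k)))"
proof -
  have "uniformly_continuous_on ({0..1} \<times> K) H"
    using K H by (intro compact_uniformly_continuous compact_Times) auto
  then obtain d where d: "d > 0" "\<And>z w. z \<in> {0..1} \<times> K \<Longrightarrow> w \<in> {0..1} \<times> K \<Longrightarrow> dist z w < d \<Longrightarrow> dist (H z) (H w) < 1"
    unfolding uniformly_continuous_on_def by (metis zero_less_one)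
  obtain n where n: "1 / real (Suc n) < d" using d(1) nat_approx_posE by blast
  \<comment> \<open>Time stopped at \<open>i / Suc n\<close>. Successive stops are less than
    \<open>d\<close> apart, so the quotients \<open>Q i\<close> have positive real part, where
    \<open>Arg\<close> is continuous; their product telescopes to
    \<open>H (t, k) / H (0, k)\<close>.\<close>
  define c where "c i t = min t (real i / real (Suc n))" for i t
  have c01: "c i t \<in> {0..1}" if "t \<in> {0..1}" for i t using that by (auto simp: c_def min_le_iff_disj)
  have cd: "\<bar>c (Suc i) t - c i t\<bar> < d" for i t
  proof -
    have "\<bar>c (Suc i) t - c i t\<bar> \<le> real (Suc i) / real (Suc n) - real i / real (Suc n)"
      using divide_right_mono[of "real i" "real (Suc i)" "real (Suc n)"]
      by (simp add: c_def min_def del: of_nat_Suc)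
    also have "\<dots> = 1 / real (Suc n)" by (simp add: field_simps)
    finally show ?thesis using n by simp
  qed
  define Q where "Q i z = H (c (Suc i) (fst z), snd z) / H (c i (fst z), snd z)" for i z
  have Hn0: "H z \<noteq> 0" if "z \<in> {0..1} \<times> K" for z using unit[OF that] by auto
  have norm_Q: "norm (Q i z) = 1" and Re_Q: "Re (Q i z) > 0" if z: "z \<in> {0..1} \<times> K" for i z
  proof -
    let ?a = "H (c (Suc i) (fst z), snd z)" and ?b = "H (c i (fst z), snd z)"
    have in_dom: "(c j (fst z), snd z) \<in> {0..1} \<times> K" for j using z c01[of "fst z" j] by auto
    show "norm (Q i z) = 1" using unit[OF in_dom] by (simp add: Q_def norm_divide)
    have "dist ?a ?b < 1"
      using d(2)[OF in_dom[of "Suc i"] in_dom[of i]] cd[of i "fst z"] by (simp add: dist_Pair_Pair dist_real_def)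
    moreover have "Q i z - 1 = (?a - ?b) / ?b" using Hn0[OF in_dom[of i]] by (simp add: Q_def field_simps)
    ultimately have "norm (Q i z - 1) < 1" using unit[OF in_dom[of i]] by (simp add: norm_divide dist_norm)
    then have "\<bar>Re (Q i z - 1)\<bar> < 1" using abs_Re_le_cmod[of "Q i z - 1"] by linarith
    then show "Re (Q i z) > 0" by simp
  qed
  define L where "L z = (\<Sum>i<Suc n. Arg (Q i z))" for z
  have cont_c: "continuous_on ({0..1} \<times> K) (\<lambda>z. H (c i (fst z), snd z))" for i
    by (rule continuous_on_compose2[OF H])
      (use c01 in \<open>auto simp: c_def intro!: continuous_intros\<close>)
  have "continuous_on ({0..1} \<times> K) (\<lambda>z. Arg (Q i z))" for i
  proof (rule continuous_on_compose2[where g = Arg and t = "{z. Re z > 0}"])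
    show "continuous_on {z. 0 < Re z} Arg"
      by (auto intro!: continuous_at_imp_continuous_on continuous_at_Arg simp: complex_nonpos_Reals_iff)
    have "H (c i (fst z), snd z) \<noteq> 0" if "z \<in> {0..1} \<times> K" for z
      using that c01[of "fst z" i] by (intro Hn0) auto
    then show "continuous_on ({0..1} \<times> K) (Q i)"
      unfolding Q_def[abs_def] by (intro continuous_on_divide cont_c) auto
  qed (use Re_Q in auto)
  then have "continuous_on ({0..1} \<times> K) L"
    unfolding L_def[abs_def] by (intro continuous_on_sum) auto
  moreover have "L (0, k) = 0" if "k \<in> K" for k
    using that Hn0[of "(0, k)"] by (simp add: L_def Q_def c_def)
  moreover have "H (t, k) = H (0, k) * cis (L (t, k))" if tk: "t \<in> {0..1}" "k \<in> K" for t k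
  proof -
    have "H (c j t, k) = H (0, k) * cis (\<Sum>i<j. Arg (Q i (t, k)))" for j
    proof (induction j)
      case 0
      then show ?case using tk by (simp add: c_def)
    next
      case (Suc j)
      have z: "(t, k) \<in> {0..1} \<times> K" using tk by simp
      have "cis (Arg (Q j (t, k))) = Q j (t, k)"
        using norm_Q[OF z, of j] rcis_cmod_Arg[of "Q j (t, k)"] by (simp add: rcis_def)
      moreover have "H (c j t, k) \<noteq> 0" using Hn0[of "(c j t, k)"] c01[OF tk(1), of j] tk by auto
      ultimately show ?case
        using Suc by (simp add: Q_def field_simps flip: cis_mult)
    qed
    from this[of "Suc n"] show ?thesis using tk by (simp add: L_def c_def)
  qed
  ultimately show ?thesis by blast
qed

text \<open>The form in which simple connectivity is used. It is established for the interval, the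
  square and the spheres of dimension at least 2.\<close>

definition circle_lifting :: "'a::topological_space set \<Rightarrow> bool" where
  "circle_lifting K \<longleftrightarrow> (\<forall>g :: 'a \<Rightarrow> complex. continuous_on K g \<and> (\<forall>k\<in>K. norm (g k) = 1) \<longrightarrow>
     (\<exists>\<phi>. continuous_on K \<phi> \<and> (\<forall>k\<in>K. g k = cis (\<phi> k))))"

text \<open>The contraction to 0 is a homotopy from a constant map to \<open>g\<close>, along which
  the argument is continued.\<close>

lemma circle_lifting_starlike:
  fixes K :: "'a::real_normed_vector set"
  assumes K: "compact K" and star: "\<And>t k. t \<in> {0..1} \<Longrightarrow> k \<in> K \<Longrightarrow> t *\<^sub>R k \<in> K"
  shows "circle_lifting K"
  unfolding circle_lifting_def
proof (intro allI impI)
  fix g :: "'a \<Rightarrow> complex" assume g: "continuous_on K g \<and> (\<forall>k\<in>K. norm (g k) = 1)"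
  define H where "H z = g (fst z *\<^sub>R snd z)" for z
  have H: "continuous_on ({0..1} \<times> K) H"
    unfolding H_def[abs_def] by (rule continuous_on_compose2[of K g]) (use g star in \<open>auto intro!: continuous_intros\<close>)
  have unit: "norm (H z) = 1" if "z \<in> {0..1} \<times> K" for z
    using g star that by (auto simp: H_def)
  obtain L where L1: "continuous_on ({0..1} \<times> K) L" and "\<And>k. k \<in> K \<Longrightarrow> L (0, k) = 0"
    and L2: "\<And>t k. t \<in> {0..1} \<Longrightarrow> k \<in> K \<Longrightarrow> H (t, k) = H (0, k) * cis (L (t, k))"
    using lift_homotopy_circle[OF K H unit] by blast
  show "\<exists>\<phi>. continuous_on K \<phi> \<and> (\<forall>k\<in>K. g k = cis (\<phi> k))"
  proof (intro exI conjI ballI)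
    show "continuous_on K (\<lambda>k. Arg (g 0) + L (1, k))"
      by (intro continuous_intros continuous_on_compose2[OF L1]) auto
    fix k assume "k \<in> K"
    then have "norm (g 0) = 1" using star[of 0 k] g by auto
    then have "cis (Arg (g 0)) = g 0" using rcis_cmod_Arg[of "g 0"] by (simp add: rcis_def)
    then show "g k = cis (Arg (g 0) + L (1, k))"
      using L2[of 1 k] \<open>k \<in> K\<close> by (simp add: H_def flip: cis_mult)
  qed
qed

section \<open>Spheres\<close>

definition sph :: "nat \<Rightarrow> (nat \<Rightarrow> real) set" where
  "sph k = {x. (\<Sum>i\<le>k. (x i)\<^sup>2) = 1 \<and> (\<forall>i>k. x i = 0)}"

lemma nsphere_eq: "nsphere k = top_of_set (sph k)"
  by (simp add: nsphere sph_def euclidean_product_topology)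

text \<open>The point at height \<open>cos (\<pi> t)\<close> on the meridian of \<open>sph (Suc k)\<close> through \<open>u\<close>.\<close>

definition meridian :: "nat \<Rightarrow> real \<times> (nat \<Rightarrow> real) \<Rightarrow> nat \<Rightarrow> real" where
  "meridian k z i = (if i = Suc k then cos (pi * fst z) else sin (pi * fst z) * snd z i)"

lemma continuous_on_coordinate: "continuous_on S (\<lambda>x. (x::'a \<Rightarrow> 'b::topological_space) i)"
  by (rule continuous_on_subset[OF continuous_on_product_coordinates subset_UNIV])

lemma continuous_meridian: "continuous_on S (meridian k)"
proof (rule continuous_on_coordinatewise_then_product)
  fix i
  have "continuous_on S (\<lambda>z::real \<times> (nat \<Rightarrow> real). snd z i)"
    by (rule continuous_on_compose2[OF continuous_on_coordinate[of UNIV i], of S snd]) (auto intro!: continuous_on_snd continuous_on_id)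
  then show "continuous_on S (\<lambda>z. meridian k z i)"
    by (cases "i = Suc k") (auto simp: meridian_def intro!: continuous_intros)
qed

lemma meridian_in_sph:
  assumes "u \<in> sph k"
  shows "meridian k (t, u) \<in> sph (Suc k)"
proof -
  have "(\<Sum>i\<le>Suc k. (meridian k (t, u) i)\<^sup>2) = (\<Sum>i\<le>k. (sin (pi * t))\<^sup>2 * (u i)\<^sup>2) + (cos (pi * t))\<^sup>2"
    by (simp add: meridian_def power_mult_distrib)
  also have "\<dots> = 1"
    using assms by (simp add: sph_def flip: sum_distrib_left)
  finally show ?thesis using assms by (auto simp: sph_def meridian_def)
qed

lemma basepoint_in_sph [simp]: "sphere_basepoint \<in> sph k"
  by (simp add: sph_def sphere_basepoint_def if_distrib[of "\<lambda>x. x\<^sup>2"] cong: if_cong)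

lemma meridian_surj: "meridian k ` ({0..1} \<times> sph k) = sph (Suc k)"
proof
  show "meridian k ` ({0..1} \<times> sph k) \<subseteq> sph (Suc k)" using meridian_in_sph by auto
  show "sph (Suc k) \<subseteq> meridian k ` ({0..1} \<times> sph k)"
  proof
    fix x assume x: "x \<in> sph (Suc k)"
    define r where "r = x (Suc k)"
    define q where "q = (\<Sum>i\<le>k. (x i)\<^sup>2)"
    have q: "q + r\<^sup>2 = 1" "q \<ge> 0" using x by (auto simp: sph_def q_def r_def sum_nonneg)
    then have "r\<^sup>2 \<le> 1" by linarith
    then have r: "-1 \<le> r" "r \<le> 1" by (auto simp: abs_square_le_1 abs_le_iff)
    define t where "t = arccos r / pi"
    have t: "t \<in> {0..1}" "cos (pi * t) = r" using r arccos_bounded[of r] by (auto simp: t_def)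
    have s: "sin (pi * t) = sqrt q" using r q by (simp add: t_def sin_arccos algebra_simps)
    show "x \<in> meridian k ` ({0..1} \<times> sph k)"
    proof (cases "q = 0")
      case True
      then have "x i = 0" if "i \<le> k" for i
        using that sum_nonneg_eq_0_iff[of "{..k}" "\<lambda>i. (x i)\<^sup>2"] by (simp add: q_def)
      moreover have "x i = 0" if "i > Suc k" for i using x that by (simp add: sph_def)
      ultimately have "x = meridian k (t, sphere_basepoint)"
        using t s True unfolding meridian_def by (auto simp: fun_eq_iff r_def) (metis Suc_lessI not_le)
      then show ?thesis using t basepoint_in_sph by blast
    next
      case False
      define u where "u i = (if i \<le> k then x i / sqrt q else 0)" for i
      have "(\<Sum>i\<le>k. (u i)\<^sup>2) = q / q"
        using q by (simp add: u_def power_divide q_def flip: sum_divide_distrib)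
      then have "u \<in> sph k" using False by (simp add: sph_def u_def)
      moreover have "x i = 0" if "i > Suc k" for i using x that by (simp add: sph_def)
      then have "x = meridian k (t, u)"
        using t s False q unfolding meridian_def u_def by (auto simp: fun_eq_iff r_def)
      ultimately show ?thesis using t by blast
    qed
  qed
qed

lemma meridian_inj:
  assumes "t \<in> {0..1}" "t' \<in> {0..1}" "u \<in> sph k" "u' \<in> sph k" "meridian k (t, u) = meridian k (t', u')"
  shows "t = t' \<and> (t = 0 \<or> t = 1 \<or> u = u')"
proof -
  have "cos (pi * t) = cos (pi * t')" using fun_cong[OF assms(5), of "Suc k"] by (simp add: meridian_def)
  then have t: "t = t'" using cos_inj_pi[of "pi * t" "pi * t'"] assms by simp
  moreover have "u = u'" if "t \<noteq> 0" "t \<noteq> 1"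
  proof
    fix i
    have "sin (pi * t) > 0" using that assms by (intro sin_gt_zero) auto
    then show "u i = u' i"
      using fun_cong[OF assms(5), of i] assms t by (cases "i = Suc k") (auto simp: meridian_def sph_def)
  qed
  ultimately show ?thesis by blast
qed

text \<open>Each sphere is the image under \<open>meridian\<close> of a cylinder over the preceding
  one.\<close>

lemma compact_sph: "compact (sph k)"
proof (induction k)
  case 0
  have "sph 0 \<subseteq> {\<lambda>i. if i = 0 then 1 else 0, \<lambda>i. if i = 0 then -1 else 0}"
    by (auto simp: sph_def fun_eq_iff power2_eq_1_iff)
  then show ?case using finite_subset finite_imp_compact by blast
next
  case (Suc k)
  then have "compact (meridian k ` ({0..1} \<times> sph k))"
    by (intro compact_continuous_image continuous_meridian compact_Times) auto
  then show ?case by (simp only: meridian_surj)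
qed

lemma connected_sph: "connected (sph (Suc k))"
proof -
  have "sph (Suc k) = (\<Union>u\<in>sph k. meridian k ` ({0..1} \<times> {u}))"
    unfolding meridian_surj[symmetric] by blast
  moreover have "connected (\<Union>u\<in>sph k. meridian k ` ({0..1} \<times> {u}))"
  proof (rule connected_Union)
    show "connected s" if "s \<in> (\<lambda>u. meridian k ` ({0..1} \<times> {u})) ` sph k" for s
      using that by (auto intro!: connected_continuous_image continuous_meridian connected_Times)
    have "meridian k (0, u) = meridian k (0, u')" for u u' by (auto simp: meridian_def fun_eq_iff)
    then have "meridian k (0, sphere_basepoint) \<in> \<Inter> ((\<lambda>u. meridian k ` ({0..1} \<times> {u})) ` sph k)"
      by (auto simp: image_iff) (metis atLeastAtMost_iff order_refl zero_le_one)
    then show "\<Inter> ((\<lambda>u. meridian k ` ({0..1} \<times> {u})) ` sph k) \<noteq> {}" by blast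
  qed
  ultimately show ?thesis by simp
qed

text \<open>This sphere is the suspension of \<open>?K\<close>. Continuing the argument along all
  meridians from the north pole gives a function on the cylinder, which descends to the sphere once
  it is constant at the other pole.\<close>

lemma circle_lifting_sph:
  "circle_lifting (sph (Suc (Suc k)))"
  unfolding circle_lifting_def
proof (intro allI impI)
  let ?K = "sph (Suc k)" and ?m = "meridian (Suc k)"
  fix g :: "(nat \<Rightarrow> real) \<Rightarrow> complex"
  assume g: "continuous_on (sph (Suc (Suc k))) g \<and> (\<forall>x\<in>sph (Suc (Suc k)). norm (g x) = 1)"
  define H where "H z = g (?m z)" for z
  have H: "continuous_on ({0..1} \<times> ?K) H"
    unfolding H_def[abs_def] using g
    by (intro continuous_on_compose2[OF _ continuous_meridian, of "sph (Suc (Suc k))" g])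
      (auto simp: meridian_surj)
  have unit: "norm (H z) = 1" if "z \<in> {0..1} \<times> ?K" for z
    using g that by (auto simp: H_def meridian_in_sph)
  obtain L where L: "continuous_on ({0..1} \<times> ?K) L" "\<And>u. u \<in> ?K \<Longrightarrow> L (0, u) = 0"
    "\<And>t u. t \<in> {0..1} \<Longrightarrow> u \<in> ?K \<Longrightarrow> H (t, u) = H (0, u) * cis (L (t, u))"
    using lift_homotopy_circle[OF compact_sph H unit] by blast
  have poles: "?m (0, u) = ?m (0, u')" "?m (1, u) = ?m (1, u')" for u u'
    by (auto simp: meridian_def fun_eq_iff)
  define b where "b = g (?m (0, sphere_basepoint))"
  have "norm b = 1" using g meridian_surj[of "Suc k"] by (auto simp: b_def intro!: meridian_in_sph)
  then have b: "b \<noteq> 0" "cis (Arg b) = b" using rcis_cmod_Arg[of b] by (auto simp: rcis_def)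
  have gL: "g (?m (t, u)) = b * cis (L (t, u))" if "t \<in> {0..1}" "u \<in> ?K" for t u
    using L(3)[OF that] poles(1)[of u sphere_basepoint] by (simp add: b_def H_def)
  \<comment> \<open>The values at the south pole agree modulo \<open>2 * pi\<close>, so
    connectedness of \<open>?K\<close> makes them equal. This is where dimension at least 2
    enters.\<close>
  have south: "L (1, u) = L (1, u')" if u: "u \<in> ?K" "u' \<in> ?K" for u u'
  proof (rule continuous_countable_constant[OF connected_sph _ _ u])
    show "continuous_on ?K (\<lambda>u. L (1, u))"
      by (intro continuous_on_compose2[OF L(1)] continuous_intros) auto
    have "(L (1, v) - L (1, u)) / (2 * pi) \<in> \<int>" if "v \<in> ?K" for v
    proof -
      have "cis (L (1, v)) = cis (L (1, u))"
        using gL[of 1 v] gL[of 1 u] that u poles(2)[of v u] b by simp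
      then show ?thesis by (simp add: cis_eq_1_iff'[symmetric] flip: cis_divide)
    qed
    then have "(\<lambda>u. L (1, u)) ` ?K \<subseteq> (\<lambda>n. L (1, u) + 2 * pi * n) ` \<int>"
      by (force simp: image_iff intro!: bexI[of _ "(L (1, _) - L (1, u)) / (2 * pi)"])
    then show "countable ((\<lambda>u. L (1, u)) ` ?K)"
      by (rule countable_subset) (simp add: countable_int Ints_def)
  qed
  have fibres: "L z = L w" if z: "z \<in> {0..1} \<times> ?K" and w: "w \<in> {0..1} \<times> ?K" and eq: "?m z = ?m w" for z w
  proof -
    obtain t u t' u' where zw: "z = (t, u)" "w = (t', u')" by (cases z; cases w)
    then have "t = t'" and "t = 0 \<or> t = 1 \<or> u = u'"
      using meridian_inj[of t t' u "Suc k" u'] z w eq by auto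
    then show ?thesis using L(2)[of u] L(2)[of u'] south[of u u'] z w zw by auto
  qed
  have comp: "compact ({0..1::real} \<times> ?K)" by (intro compact_Times compact_sph) simp
  obtain \<phi> where \<phi>: "continuous_on (?m ` ({0..1} \<times> ?K)) \<phi>" "\<And>z. z \<in> {0..1} \<times> ?K \<Longrightarrow> \<phi> (?m z) = L z"
    using continuous_factor[OF comp continuous_meridian L(1) fibres] by blast
  show "\<exists>\<phi>. continuous_on (sph (Suc (Suc k))) \<phi> \<and> (\<forall>x\<in>sph (Suc (Suc k)). g x = cis (\<phi> x))"
  proof (intro exI conjI ballI)
    show "continuous_on (sph (Suc (Suc k))) (\<lambda>x. Arg b + \<phi> x)"
      using \<phi>(1) unfolding meridian_surj by (intro continuous_intros)
    fix x assume "x \<in> sph (Suc (Suc k))"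
    then obtain t u where "x = ?m (t, u)" "t \<in> {0..1}" "u \<in> ?K" using meridian_surj[of "Suc k"] by blast
    then show "g x = cis (Arg b + \<phi> x)" using gL[of t u] \<phi>(2)[of "(t, u)"] b by (simp flip: cis_mult)
  qed
qed

section \<open>The mapping torus\<close>

text \<open>Packs four complex numbers into the first eight coordinates, since the classifying space
  is to consist of points of type \<open>nat \<Rightarrow> real\<close>.\<close>

definition emb :: "complex \<Rightarrow> complex \<Rightarrow> complex \<Rightarrow> complex \<Rightarrow> nat \<Rightarrow> real" where
  "emb z1 z2 z3 z4 i =
     (if i = 0 then Re z1 else if i = 1 then Im z1 else if i = 2 then Re z2 else if i = 3 then Im z2
      else if i = 4 then Re z3 else if i = 5 then Im z3 else if i = 6 then Re z4
      else if i = 7 then Im z4 else 0)"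

lemma emb_eq_iff: "emb z1 z2 z3 z4 = emb w1 w2 w3 w4 \<longleftrightarrow> z1 = w1 \<and> z2 = w2 \<and> z3 = w3 \<and> z4 = w4"
proof
  assume "emb z1 z2 z3 z4 = emb w1 w2 w3 w4"
  then have "emb z1 z2 z3 z4 i = emb w1 w2 w3 w4 i" for i by simp
  from this[of 0] this[of 1] this[of 2] this[of 3] this[of 4] this[of 5] this[of 6] this[of 7]
  show "z1 = w1 \<and> z2 = w2 \<and> z3 = w3 \<and> z4 = w4" by (simp add: emb_def complex_eq_iff)
qed simp

lemma continuous_emb:
  fixes f1 f2 f3 f4 :: "'a::topological_space \<Rightarrow> complex"
  assumes "continuous_on S f1" "continuous_on S f2" "continuous_on S f3" "continuous_on S f4"
  shows "continuous_on S (\<lambda>x. emb (f1 x) (f2 x) (f3 x) (f4 x))"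
proof (rule continuous_on_coordinatewise_then_product)
  have const_if: "continuous_on S (\<lambda>x. if c then f x else g x)"
    if "continuous_on S f" "continuous_on S g" for c and f g :: "'a \<Rightarrow> real"
    using that by (cases c) auto
  show "continuous_on S (\<lambda>x. emb (f1 x) (f2 x) (f3 x) (f4 x) i)" for i
    unfolding emb_def by (intro const_if continuous_intros assms)
qed

lemma floor_eq_of_diff_Ints:
  fixes s s' :: real
  assumes "0 \<le> s" "s < 1" "0 \<le> s'" "s' < 1" "s - s' \<in> \<int>"
  shows "s = s'"
proof -
  obtain z :: int where z: "s - s' = of_int z" using assms(5) by (auto simp: Ints_def)
  then have "-1 < real_of_int z" "real_of_int z < 1" using assms by auto
  then have "z = 0" by simp
  then show ?thesis using z by simp
qed

locale mapping_torus =
  fixes m :: nat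
  assumes m: "m > 0"
begin

abbreviation M :: real where "M \<equiv> real m"

text \<open>
  For \<open>s \<in> [0, 1]\<close> the second coordinate interpolates between the two ends of the cylinder, so that
  the end \<open>s = 1\<close> is glued to the end \<open>s = 0\<close> by \<open>x \<mapsto> m x\<close>; the third one separates the points with
  \<open>0 < s < 1\<close>.
\<close>

definition E :: "real \<Rightarrow> real \<Rightarrow> real \<Rightarrow> nat \<Rightarrow> real" where
  "E s x y = emb (cis (2 * pi * s)) ((1 - s) * cis (2 * pi * x) + s * cis (2 * pi * (M * x)))
     (s * (1 - s) * cis (2 * pi * x)) (cis (2 * pi * y))"

text \<open>Unrolls the mapping torus: between the levels j and j + 1 the circle coordinate is
  \<open>M powi j * x\<close>. Crossing an integer level upwards multiplies it by \<open>m\<close>,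
  as the gluing demands, while \<open>x\<close> stays constant along flow lines.\<close>

definition P :: "real \<times> real \<times> real \<Rightarrow> nat \<Rightarrow> real" where
  "P = (\<lambda>(s, x, y). E (frac s) (M powi \<lfloor>s\<rfloor> * x) y)"

lemma E_one: "E 1 x y = E 0 (M * x) y"
  by (simp add: E_def)

lemma E_eq_iff:
  assumes "0 \<le> s" "s < 1" "0 \<le> s'" "s' < 1"
  shows "E s x y = E s' x' y' \<longleftrightarrow> s = s' \<and> x - x' \<in> \<int> \<and> y - y' \<in> \<int>"
proof
  assume eq: "E s x y = E s' x' y'"
  then have "s - s' \<in> \<int>" and y: "y - y' \<in> \<int>" by (auto simp: E_def emb_eq_iff cis_eq_cis_iff)
  then have s: "s = s'" using floor_eq_of_diff_Ints assms by blast
  have "cis (2 * pi * x) = cis (2 * pi * x')"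
  proof (cases "s = 0")
    case True
    then show ?thesis using eq s by (simp add: E_def emb_eq_iff)
  next
    case False
    then have "complex_of_real s * (1 - complex_of_real s) \<noteq> 0" using assms by (auto simp flip: of_real_diff)
    then show ?thesis using eq s by (simp add: E_def emb_eq_iff)
  qed
  then show "s = s' \<and> x - x' \<in> \<int> \<and> y - y' \<in> \<int>" using s y by (simp add: cis_eq_cis_iff)
next
  assume "s = s' \<and> x - x' \<in> \<int> \<and> y - y' \<in> \<int>"
  moreover from this have "M * x - M * x' \<in> \<int>"
    by (metis Ints_mult Ints_of_nat right_diff_distrib)
  ultimately show "E s x y = E s' x' y'"
    by (simp add: E_def emb_eq_iff flip: cis_eq_cis_iff)
qed

text \<open>At fixed \<open>s\<close> and \<open>y\<close> the coordinate \<open>x\<close> is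
  determined modulo \<open>M powi (- \<lfloor>s\<rfloor>)\<close>. This ambiguity increases with the
  level, hence the preference for upward motion in the arguments below.\<close>

lemma P_eq_iff:
  "P (s, x, y) = P (s', x', y') \<longleftrightarrow>
     s - s' \<in> \<int> \<and> M powi \<lfloor>s\<rfloor> * x - M powi \<lfloor>s'\<rfloor> * x' \<in> \<int> \<and> y - y' \<in> \<int>"
proof -
  have "frac s = frac s' \<longleftrightarrow> s - s' \<in> \<int>"
  proof
    assume "frac s = frac s'"
    then have "s - s' = of_int (\<lfloor>s\<rfloor> - \<lfloor>s'\<rfloor>)" by (simp add: frac_def)
    then show "s - s' \<in> \<int>" by (metis Ints_of_int)
  next
    assume "s - s' \<in> \<int>"
    then obtain z :: int where "s = s' + of_int z" by (auto simp: Ints_def algebra_simps)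
    then show "frac s = frac s'" by (simp add: frac_def)
  qed
  then show ?thesis by (simp add: P_def E_eq_iff frac_lt_1)
qed

lemma continuous_E: "continuous_on S (\<lambda>u. E (fst u) (fst (snd u)) (snd (snd u)))"
  unfolding E_def by (intro continuous_emb continuous_intros)

lemma P_strip:
  assumes "of_int j \<le> s" "s \<le> of_int j + 1"
  shows "P (s, x, y) = E (s - of_int j) (M powi j * x) y"
proof (cases "s = of_int j + 1")
  case True
  then have "\<lfloor>s\<rfloor> = j + 1" "frac s = 0" by (auto simp: frac_def)
  moreover have "M powi (j + 1) = M * M powi j" using m by (simp add: power_int_add)
  ultimately show ?thesis using True by (simp add: P_def E_one mult.assoc)
next
  case False
  then have "\<lfloor>s\<rfloor> = j" using assms by (simp add: floor_eq_iff)
  then show ?thesis by (simp add: P_def frac_def)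
qed

text \<open>On each closed strip \<open>V j\<close> the formula \<open>P_strip\<close> is
  continuous. Two adjacent strips contain the open slab \<open>U j\<close>, and these slabs cover
  the space.\<close>

lemma continuous_P: "continuous_on S P"
proof -
  define U where "U j = {of_int j - 1<..<of_int j + 1 :: real} \<times> (UNIV :: (real \<times> real) set)" for j :: int
  define V where "V j = {of_int j..of_int j + 1 :: real} \<times> (UNIV :: (real \<times> real) set)" for j :: int
  have strip: "continuous_on (V j) P" for j
  proof -
    have "continuous_on (V j) (\<lambda>u. E (fst u - of_int j) (M powi j * fst (snd u)) (snd (snd u)))"
      by (rule continuous_on_compose2[OF continuous_E[of UNIV],
            of _ "\<lambda>u. (fst u - of_int j, M powi j * fst (snd u), snd (snd u))", simplified])
        (intro continuous_intros)
    then show ?thesis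
      by (rule continuous_on_eq) (auto simp: V_def P_strip)
  qed
  have "continuous_on (U j) P" for j
  proof -
    have "continuous_on (V (j - 1) \<union> V j) P"
      by (intro continuous_on_closed_Un strip) (auto simp: V_def intro!: closed_Times)
    then show ?thesis by (rule continuous_on_subset) (auto simp: U_def V_def)
  qed
  then have "continuous_on (\<Union>j. U j) P"
    by (intro continuous_on_open_UN) (auto simp: U_def intro!: open_Times)
  moreover have "(\<Union>j. U j) = UNIV"
  proof (intro equalityI subset_UNIV subsetI)
    fix u :: "real \<times> real \<times> real"
    have "u \<in> U \<lfloor>fst u\<rfloor>" by (cases u) (simp add: U_def, linarith)
    then show "u \<in> (\<Union>j. U j)" by blast
  qed
  ultimately show ?thesis using continuous_on_subset[of UNIV P S] by simp
qed

lemma P_frac: "P (s, x, y) = P (frac s, frac (M powi \<lfloor>s\<rfloor> * x), frac y)"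
  unfolding P_eq_iff by (simp add: frac_def)

definition X :: "(nat \<Rightarrow> real) set" where "X = range P"

abbreviation "cube \<equiv> {0..1::real} \<times> {0..1::real} \<times> {0..1::real}"

lemma compact_cube: "compact cube" by (intro compact_Times) auto

lemma P_cube: "P ` cube = X"
proof -
  have "P (s, x, y) \<in> P ` cube" for s x y
    using P_frac[of s x y] by (auto simp: frac_lt_1 less_imp_le)
  then show ?thesis by (auto simp: X_def)
qed

lemma P_in_X [simp]: "P u \<in> X" by (simp add: X_def)

lemma P_factor:
  fixes f :: "real \<times> real \<times> real \<Rightarrow> 'c::topological_space"
  assumes "continuous_on UNIV f" "\<And>u u'. P u = P u' \<Longrightarrow> f u = f u'"
  shows "\<exists>h. continuous_on X h \<and> (\<forall>u. h (P u) = f u)"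
proof -
  have "continuous_on cube f" using assms(1) by (rule continuous_on_subset) simp
  from continuous_factor[OF compact_cube continuous_P this assms(2)]
  obtain h where h: "continuous_on (P ` cube) h" "\<And>u. u \<in> cube \<Longrightarrow> h (P u) = f u" by blast
  have "h (P u) = f u" for u
  proof -
    have "P u \<in> P ` cube" by (simp add: P_cube)
    then obtain u' where "u' \<in> cube" "P u = P u'" by blast
    then show ?thesis using h(2)[of u'] assms(2)[of u u'] by simp
  qed
  then show ?thesis using h(1) P_cube by auto
qed

text \<open>A piece of the infinite cyclic cover of \<open>X\<close>, over a bounded range of
  levels: the circle-valued level of a point is refined to a real number.\<close>

definition strip :: "nat \<Rightarrow> nat \<Rightarrow> ((nat \<Rightarrow> real) \<times> real) set" where
  "strip a N = {(P (s, x, y), s) | s x y. - real a \<le> s \<and> s \<le> real N}"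

lemma strip_memI: "- real a \<le> s \<Longrightarrow> s \<le> real N \<Longrightarrow> (P (s, x, y), s) \<in> strip a N"
  unfolding strip_def by blast

lemma strip_factor:
  fixes f :: "(real \<times> real \<times> real) \<times> real \<Rightarrow> 'c::topological_space"
  assumes f: "continuous_on UNIV f"
    and wd: "\<And>s x y x' y' r. s \<le> real N \<Longrightarrow> 0 \<le> r \<Longrightarrow> r \<le> 1 \<Longrightarrow> P (s, x, y) = P (s, x', y') \<Longrightarrow>
      f ((s, x, y), r) = f ((s, x', y'), r)"
  shows "\<exists>h. continuous_on (strip a N \<times> {0..1}) h \<and>
    (\<forall>s x y r. - real a \<le> s \<longrightarrow> s \<le> real N \<longrightarrow> 0 \<le> r \<longrightarrow> r \<le> 1 \<longrightarrow> h ((P (s, x, y), s), r) = f ((s, x, y), r))"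
proof -
  \<comment> \<open>A compact box that maps onto the whole strip: at levels
    \<open>s \<ge> - a\<close> the ambiguity of \<open>x\<close> is at most \<open>M ^ a\<close>, so
    \<open>x\<close> can be reduced to \<open>{0..M ^ a}\<close>.\<close>
  define Q where "Q = ({- real a..real N} \<times> {0..M ^ a} \<times> {0..1::real}) \<times> {0..1::real}"
  define p where "p = (\<lambda>(u, r::real). ((P u, fst u), r))"
  have Q: "compact Q" unfolding Q_def by (intro compact_Times) auto
  have p: "continuous_on Q p"
    unfolding p_def case_prod_beta
    by (intro continuous_intros continuous_on_compose2[OF continuous_P[of UNIV]]) auto
  have fQ: "continuous_on Q f" using f by (rule continuous_on_subset) simp
  have fib: "f z = f w" if "z \<in> Q" "w \<in> Q" "p z = p w" for z w
  proof -
    obtain s x y r s' x' y' r' where zw: "z = ((s, x, y), r)" "w = ((s', x', y'), r')"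
      by (cases z; cases w) (auto elim: prod_cases3)
    then show ?thesis using wd[of s r x y x' y'] that by (auto simp: p_def Q_def)
  qed
  obtain h where h: "continuous_on (p ` Q) h" "\<And>z. z \<in> Q \<Longrightarrow> h (p z) = f z"
    using continuous_factor[OF Q p fQ fib] by blast
  have rep: "\<exists>x' y'. P (s, x, y) = P (s, x', y') \<and> ((s, x', y'), r) \<in> Q"
    if s: "- real a \<le> s" "s \<le> real N" "0 \<le> r" "r \<le> 1" for s x y r :: real
  proof -
    define q where "q = M powi \<lfloor>s\<rfloor>"
    have q: "q > 0" using m by (simp add: q_def zero_less_power_int)
    have "1 / q \<le> M ^ a"
    proof -
      have "1 / q = M powi (- \<lfloor>s\<rfloor>)" by (simp add: q_def power_int_minus divide_inverse)
      also have "\<dots> \<le> M powi int a" using s m by (intro power_int_increasing) linarith+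
      finally show ?thesis by simp
    qed
    moreover have "frac (q * x) / q \<le> 1 / q" using q by (intro divide_right_mono) (auto simp: frac_lt_1 less_imp_le)
    ultimately have "frac (q * x) / q \<in> {0..M ^ a}" using q by auto
    moreover have "P (s, x, y) = P (s, frac (q * x) / q, frac y)"
      using q unfolding P_eq_iff q_def[symmetric] by (simp add: frac_def)
    ultimately show ?thesis using s
      by (intro exI[of _ "frac (q * x) / q"] exI[of _ "frac y"]) (auto simp: Q_def frac_lt_1 less_imp_le)
  qed
  have val: "h ((P (s, x, y), s), r) = f ((s, x, y), r)"
    if s: "- real a \<le> s" "s \<le> real N" "0 \<le> r" "r \<le> 1" for s x y r :: real
  proof -
    obtain x' y' where xy: "P (s, x, y) = P (s, x', y')" "((s, x', y'), r) \<in> Q" using rep[OF s] by blast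
    then have "h ((P (s, x, y), s), r) = f ((s, x', y'), r)" using h(2)[OF xy(2)] by (simp add: p_def)
    then show ?thesis using wd[OF s(2-4) xy(1)] by simp
  qed
  have "strip a N \<times> {0..1} \<subseteq> p ` Q"
  proof
    fix z assume "z \<in> strip a N \<times> {0..1::real}"
    then obtain s x y r where z: "z = ((P (s, x, y), s), r)" "- real a \<le> s" "s \<le> real N" "0 \<le> r" "r \<le> 1"
      by (auto simp: strip_def)
    obtain x' y' where xy: "P (s, x, y) = P (s, x', y')" "((s, x', y'), r) \<in> Q" using rep[OF z(2-5)] by blast
    then have "z = p ((s, x', y'), r)" using z by (simp add: p_def)
    then show "z \<in> p ` Q" using xy(2) by blast
  qed
  then have "continuous_on (strip a N \<times> {0..1}) h" by (rule continuous_on_subset[OF h(1)])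
  then show ?thesis using val by (intro exI[of _ h]) simp
qed

text \<open>
  \<open>dev N z (s, x, y)\<close> says that \<open>(s, x, y)\<close> is one of the values at \<open>z\<close> of the developing map, up to
  translation of \<open>x\<close> by \<open>m\<^sup>-\<^sup>N \<int>\<close>.
\<close>

definition dev :: "nat \<Rightarrow> (nat \<Rightarrow> real) \<Rightarrow> real \<times> real \<times> real \<Rightarrow> bool" where
  "dev N z = (\<lambda>(s, x, y). \<exists>x0. z = P (s, x0, y) \<and> M ^ N * (x - x0) \<in> \<int>)"

lemma dev_mono:
  assumes "dev N z u" "N \<le> N'"
  shows "dev N' z u"
proof -
  obtain s x y where u: "u = (s, x, y)" by (cases u)
  then obtain x0 where x0: "z = P (s, x0, y)" "M ^ N * (x - x0) \<in> \<int>" using assms by (auto simp: dev_def)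
  have "M ^ N' * (x - x0) = M ^ (N' - N) * (M ^ N * (x - x0))"
    using assms(2) by (simp flip: power_add mult.assoc)
  also have "M ^ (N' - N) * (M ^ N * (x - x0)) \<in> \<int>" by (rule Ints_mult[OF Ints_power x0(2)]) simp
  finally show ?thesis using x0(1) u by (auto simp: dev_def)
qed

lemma circle_lifting_pointed:
  assumes "circle_lifting K" "continuous_on K g" "\<And>k. k \<in> K \<Longrightarrow> norm (g k) = 1" "k0 \<in> K" "g k0 = 1"
  shows "\<exists>\<phi>. continuous_on K \<phi> \<and> \<phi> k0 = 0 \<and> (\<forall>k\<in>K. g k = cis (2 * pi * \<phi> k))"
proof -
  obtain \<phi> where \<phi>: "continuous_on K \<phi>" "\<And>k. k \<in> K \<Longrightarrow> g k = cis (\<phi> k)"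
    using assms(1)[unfolded circle_lifting_def, rule_format, of g] assms(2,3) by blast
  have "g k = cis (2 * pi * ((\<phi> k - \<phi> k0) / (2 * pi)))" if "k \<in> K" for k
    using \<phi>(2)[OF that] \<phi>(2)[OF assms(4)] assms(5) by (simp flip: cis_divide)
  moreover have "continuous_on K (\<lambda>k. (\<phi> k - \<phi> k0) / (2 * pi))" by (intro continuous_intros \<phi>) auto
  ultimately show ?thesis by (intro exI[of _ "\<lambda>k. (\<phi> k - \<phi> k0) / (2 * pi)"]) auto
qed

text \<open>The coordinates \<open>s\<close> and \<open>y\<close> come from circle-valued functions
  on \<open>X\<close>. For \<open>x\<close> only \<open>M ^ N * x\<close> is well-defined modulo 1,
  on a strip below level \<open>N\<close>, so this is lifted and divided by \<open>M ^ N\<close>.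
  This is why \<open>dev N\<close> appears in place of equality.\<close>

lemma lift_exists:
  fixes f :: "'k::metric_space \<Rightarrow> nat \<Rightarrow> real"
  assumes K: "compact K" "circle_lifting K" "k0 \<in> K"
    and f: "continuous_on K f" "\<And>k. k \<in> K \<Longrightarrow> f k \<in> X" "f k0 = P (0, 0, 0)"
  shows "\<exists>(\<sigma>::'k \<Rightarrow> real) \<omega> \<eta> N. continuous_on K \<sigma> \<and> continuous_on K \<omega> \<and> continuous_on K \<eta> \<and>
    \<sigma> k0 = 0 \<and> \<omega> k0 = 0 \<and> \<eta> k0 = 0 \<and>
    (\<forall>k\<in>K. \<sigma> k \<le> real N \<and> dev N (f k) (\<sigma> k, \<omega> k, \<eta> k))"
proof -
  have c1: "continuous_on UNIV (\<lambda>u :: real \<times> real \<times> real. cis (2 * pi * fst u))"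
    by (intro continuous_intros)
  have "cis (2 * pi * fst u) = cis (2 * pi * fst u')" if "P u = P u'" for u u'
    using that by (cases u; cases u') (simp add: P_eq_iff cis_eq_cis_iff)
  from P_factor[OF c1 this]
  obtain h1 where h1: "continuous_on X h1" "\<And>u. h1 (P u) = cis (2 * pi * fst u)" by blast
  have c4: "continuous_on UNIV (\<lambda>u :: real \<times> real \<times> real. cis (2 * pi * snd (snd u)))"
    by (intro continuous_intros)
  have "cis (2 * pi * snd (snd u)) = cis (2 * pi * snd (snd u'))" if "P u = P u'" for u u'
    using that by (cases u; cases u') (simp add: P_eq_iff cis_eq_cis_iff)
  from P_factor[OF c4 this]
  obtain h4 where h4: "continuous_on X h4" "\<And>u. h4 (P u) = cis (2 * pi * snd (snd u))" by blast
  have lift: "\<exists>\<phi>. continuous_on K \<phi> \<and> \<phi> k0 = 0 \<and> (\<forall>k\<in>K. h (f k) = cis (2 * pi * \<phi> k))"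
    if "continuous_on X h" "\<And>z. z \<in> X \<Longrightarrow> norm (h z) = 1" "h (P (0, 0, 0)) = 1" for h
  proof (rule circle_lifting_pointed[OF K(2) _ _ K(3)])
    show "continuous_on K (\<lambda>k. h (f k))"
      by (rule continuous_on_compose2[OF that(1) f(1)]) (use f(2) in blast)
    show "norm (h (f k)) = 1" if "k \<in> K" for k
      using that f(2) \<open>\<And>z. z \<in> X \<Longrightarrow> norm (h z) = 1\<close> by blast
    show "h (f k0) = 1" using f(3) that(3) by simp
  qed
  have n1: "norm (h1 z) = 1" and n4: "norm (h4 z) = 1" if "z \<in> X" for z
    using that h1(2) h4(2) by (auto simp: X_def)
  obtain \<sigma> where \<sigma>: "continuous_on K \<sigma>" "\<sigma> k0 = 0" "\<And>k. k \<in> K \<Longrightarrow> h1 (f k) = cis (2 * pi * \<sigma> k)"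
    using lift[OF h1(1) n1] h1(2)[of "(0, 0, 0)"] by auto
  obtain \<eta> where \<eta>: "continuous_on K \<eta>" "\<eta> k0 = 0" "\<And>k. k \<in> K \<Longrightarrow> h4 (f k) = cis (2 * pi * \<eta> k)"
    using lift[OF h4(1) n4] h4(2)[of "(0, 0, 0)"] by auto
  have "bounded (\<sigma> ` K)" using K(1) \<sigma>(1) by (intro compact_imp_bounded compact_continuous_image)
  then obtain B where B: "\<And>k. k \<in> K \<Longrightarrow> \<bar>\<sigma> k\<bar> \<le> B" by (auto simp: bounded_iff)
  define N where "N = nat \<lceil>B\<rceil>"
  have N: "- real N \<le> \<sigma> k" "\<sigma> k \<le> real N" if "k \<in> K" for k
    using B[OF that] by (auto simp: N_def abs_le_iff) linarith+
  have rep: "\<exists>x. f k = P (\<sigma> k, x, \<eta> k)" if k: "k \<in> K" for k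
  proof -
    obtain s x y where u: "f k = P (s, x, y)" using f(2)[OF k] by (auto simp: X_def)
    then have "s - \<sigma> k \<in> \<int>" "y - \<eta> k \<in> \<int>"
      using \<sigma>(3)[OF k] \<eta>(3)[OF k] h1(2)[of "(s, x, y)"] h4(2)[of "(s, x, y)"] u by (auto simp: cis_eq_cis_iff)
    then have "P (s, x, y) = P (\<sigma> k, M powi (- \<lfloor>\<sigma> k\<rfloor>) * (M powi \<lfloor>s\<rfloor> * x), \<eta> k)"
      using m by (simp add: P_eq_iff power_int_minus flip: mult.assoc)
    then show ?thesis using u by auto
  qed
  \<comment> \<open>The dummy argument \<open>r\<close> fits the time parameter of
    \<open>strip_factor\<close>, which the flow needs; here it is set to 0.\<close>
  define c where "c = (\<lambda>(u :: real \<times> real \<times> real, r :: real). cis (2 * pi * (M ^ N * fst (snd u))))"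
  have c: "continuous_on UNIV c"
    unfolding c_def case_prod_beta by (intro continuous_intros)
  have "c ((s, x, y), r) = c ((s, x', y'), r)"
    if s: "s \<le> real N" and "0 \<le> r" "r \<le> 1" and eq: "P (s, x, y) = P (s, x', y')" for s x y x' y' r
  proof -
    \<comment> \<open>Below level \<open>N\<close>, the power \<open>M ^ N\<close> is an integer
      multiple of \<open>M powi \<lfloor>s\<rfloor>\<close>, which makes the ambiguity of
      \<open>x\<close> integral.\<close>
    have "int N - \<lfloor>s\<rfloor> \<ge> 0" using s by linarith
    then have "M ^ N = M ^ nat (int N - \<lfloor>s\<rfloor>) * M powi \<lfloor>s\<rfloor>"
      using m by (simp add: power_int_diff flip: power_int_of_nat)
    then have "M ^ N * x - M ^ N * x' = M ^ nat (int N - \<lfloor>s\<rfloor>) * (M powi \<lfloor>s\<rfloor> * x - M powi \<lfloor>s\<rfloor> * x')"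
      by (simp add: algebra_simps)
    also have "\<dots> \<in> \<int>"
      using eq by (intro Ints_mult Ints_power) (auto simp: P_eq_iff)
    finally show ?thesis by (simp add: c_def cis_eq_cis_iff)
  qed
  from strip_factor[where f = c and N = N and a = N, OF c this]
  obtain h where h1: "continuous_on (strip N N \<times> {0..1}) h"
    and h2: "\<forall>s x y r. - real N \<le> s \<longrightarrow> s \<le> real N \<longrightarrow> 0 \<le> r \<longrightarrow> r \<le> 1 \<longrightarrow>
      h ((P (s, x, y), s), r) = c ((s, x, y), r)" by blast
  have h: "continuous_on (strip N N \<times> {0..1}) h"
    "\<And>s x y. - real N \<le> s \<Longrightarrow> s \<le> real N \<Longrightarrow> h ((P (s, x, y), s), 0::real) = cis (2 * pi * (M ^ N * x))"
    using h1 h2[rule_format, of _ 0] by (simp_all add: c_def)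
  have hf: "continuous_on K (\<lambda>k. h ((f k, \<sigma> k), 0))"
  proof (rule continuous_on_compose2[OF h(1)])
    show "(\<lambda>k. ((f k, \<sigma> k), 0)) ` K \<subseteq> strip N N \<times> {0..1::real}"
    proof (rule image_subsetI)
      fix k assume k: "k \<in> K"
      obtain x where "f k = P (\<sigma> k, x, \<eta> k)" using rep[OF k] by blast
      then show "((f k, \<sigma> k), 0) \<in> strip N N \<times> {0..1::real}" using strip_memI[OF N[OF k]] by simp
    qed
  qed (intro continuous_intros f \<sigma>)
  have norm: "norm (h ((f k, \<sigma> k), 0)) = 1" if k: "k \<in> K" for k
    using rep[OF k] h(2)[OF N[OF k]] by auto
  have base: "h ((f k0, \<sigma> k0), 0) = 1"
    using h(2)[of 0 0 0] by (simp add: f \<sigma>)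
  obtain \<psi> where \<psi>: "continuous_on K \<psi>" "\<psi> k0 = 0" "\<And>k. k \<in> K \<Longrightarrow> h ((f k, \<sigma> k), 0) = cis (2 * pi * \<psi> k)"
    using circle_lifting_pointed[OF K(2) hf norm K(3) base] by auto
  have "dev N (f k) (\<sigma> k, \<psi> k / M ^ N, \<eta> k)" if k: "k \<in> K" for k
  proof -
    obtain x where x: "f k = P (\<sigma> k, x, \<eta> k)" using rep[OF k] by blast
    have "cis (2 * pi * \<psi> k) = cis (2 * pi * (M ^ N * x))"
      using \<psi>(3)[OF k] h(2)[OF N[OF k], of x "\<eta> k"] x by simp
    then have "\<psi> k - M ^ N * x \<in> \<int>" by (simp only: cis_eq_cis_iff)
    then have "M ^ N * (\<psi> k / M ^ N - x) \<in> \<int>" using m by (simp add: right_diff_distrib)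
    then show ?thesis using x by (auto simp: dev_def)
  qed
  moreover have "continuous_on K (\<lambda>k. \<psi> k / M ^ N)" using m by (intro continuous_intros \<psi>) auto
  ultimately show ?thesis
    using \<sigma> \<eta> \<psi> N by (intro exI[of _ \<sigma>] exI[of _ "\<lambda>k. \<psi> k / M ^ N"] exI[of _ \<eta>] exI[of _ N]) auto
qed

text \<open>The flow in the direction of \<open>s\<close> is only defined forwards, since \<open>x \<mapsto> m x\<close> is not invertible on the circle.\<close>

lemma flow_exists:
  fixes f :: "'k::metric_space \<Rightarrow> nat \<Rightarrow> real"
  assumes K: "compact K" and f: "continuous_on K f"
    and lifts: "continuous_on K \<sigma>" "continuous_on K \<omega>" "continuous_on K \<eta>"
    and dev: "\<And>k. k \<in> K \<Longrightarrow> \<sigma> k \<le> real N \<and> dev N (f k) (\<sigma> k, \<omega> k, \<eta> k)"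
  shows "\<exists>F. continuous_on ({0..1} \<times> K) F \<and> F ` ({0..1} \<times> K) \<subseteq> X \<and>
    (\<forall>k\<in>K. F (0, k) = f k \<and> F (1, k) = P (real N, \<omega> k, \<eta> k)) \<and>
    (\<forall>r\<in>{0..1}. \<forall>k\<in>K. \<forall>x y. f k = P (\<sigma> k, x, y) \<longrightarrow> F (r, k) = P ((1 - r) * \<sigma> k + r * real N, x, y))"
proof -
  have "bounded (\<sigma> ` K)" using K lifts(1) by (intro compact_imp_bounded compact_continuous_image)
  then obtain B where B: "\<And>k. k \<in> K \<Longrightarrow> \<bar>\<sigma> k\<bar> \<le> B" by (auto simp: bounded_iff)
  define a where "a = nat \<lceil>B\<rceil>"
  have a: "- real a \<le> \<sigma> k" if "k \<in> K" for k
    using B[OF that] by (auto simp: a_def abs_le_iff) linarith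
  define g where "g = (\<lambda>(u :: real \<times> real \<times> real, r). P ((1 - r) * fst u + r * real N, snd u))"
  have g: "continuous_on UNIV g"
    unfolding g_def case_prod_beta
    by (intro continuous_on_compose2[OF continuous_P[of UNIV]] continuous_intros) auto
  have "g ((s, x, y), r) = g ((s, x', y'), r)"
    if s: "s \<le> real N" and r: "0 \<le> r" "r \<le> 1" and eq: "P (s, x, y) = P (s, x', y')" for s x y x' y' r
  proof -
    define s' where "s' = (1 - r) * s + r * real N"
    have "s' - s = r * (real N - s)" by (simp add: s'_def algebra_simps)
    then have "s \<le> s'" using r s by (metis diff_ge_0_iff_ge mult_nonneg_nonneg)
    then have "\<lfloor>s'\<rfloor> - \<lfloor>s\<rfloor> \<ge> 0" by (simp add: floor_mono)
    then have "M powi \<lfloor>s'\<rfloor> = M ^ nat (\<lfloor>s'\<rfloor> - \<lfloor>s\<rfloor>) * M powi \<lfloor>s\<rfloor>"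
      using m by (simp add: power_int_diff flip: power_int_of_nat)
    then have "M powi \<lfloor>s'\<rfloor> * x - M powi \<lfloor>s'\<rfloor> * x' =
        M ^ nat (\<lfloor>s'\<rfloor> - \<lfloor>s\<rfloor>) * (M powi \<lfloor>s\<rfloor> * x - M powi \<lfloor>s\<rfloor> * x')"
      by (simp add: algebra_simps)
    moreover have "M ^ nat (\<lfloor>s'\<rfloor> - \<lfloor>s\<rfloor>) * (M powi \<lfloor>s\<rfloor> * x - M powi \<lfloor>s\<rfloor> * x') \<in> \<int>"
      using eq by (intro Ints_mult Ints_power) (auto simp: P_eq_iff)
    ultimately show ?thesis
      using eq by (simp add: g_def P_eq_iff flip: s'_def)
  qed
  from strip_factor[where f = g and N = N and a = a, OF g this]
  obtain h where h1: "continuous_on (strip a N \<times> {0..1}) h"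
    and h2: "\<forall>s x y r. - real a \<le> s \<longrightarrow> s \<le> real N \<longrightarrow> 0 \<le> r \<longrightarrow> r \<le> 1 \<longrightarrow>
      h ((P (s, x, y), s), r) = g ((s, x, y), r)" by blast
  have rep: "\<exists>x. f k = P (\<sigma> k, x, \<eta> k) \<and> M ^ N * (\<omega> k - x) \<in> \<int>" if "k \<in> K" for k
    using dev[OF that] by (auto simp: dev_def)
  define F where "F = (\<lambda>(r, k). h ((f k, \<sigma> k), r))"
  have Fval: "F (r, k) = P ((1 - r) * \<sigma> k + r * real N, x, y)"
    if "r \<in> {0..1}" "k \<in> K" "f k = P (\<sigma> k, x, y)" for r k x y
    using that h2[rule_format, of "\<sigma> k" r x y] a[of k] dev[of k] by (auto simp: F_def g_def)
  have "continuous_on ({0..1} \<times> K) F"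
    unfolding F_def case_prod_beta
  proof (rule continuous_on_compose2[OF h1])
    show "(\<lambda>z. ((f (snd z), \<sigma> (snd z)), fst z)) ` ({0..1} \<times> K) \<subseteq> strip a N \<times> {0..1}"
    proof (rule image_subsetI)
      fix z assume z: "z \<in> {0..1} \<times> K"
      then have k: "snd z \<in> K" by auto
      obtain x where "f (snd z) = P (\<sigma> (snd z), x, \<eta> (snd z))" using rep[OF k] by blast
      then show "((f (snd z), \<sigma> (snd z)), fst z) \<in> strip a N \<times> {0..1}"
        using strip_memI[OF a[OF k], of N] dev[OF k] z by auto
    qed
    show "continuous_on ({0..1} \<times> K) (\<lambda>z. ((f (snd z), \<sigma> (snd z)), fst z))"
      by (intro continuous_intros continuous_on_compose2[OF f] continuous_on_compose2[OF lifts(1)]) auto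
  qed
  moreover have "F ` ({0..1} \<times> K) \<subseteq> X"
  proof clarify
    fix r :: real and k assume rk: "r \<in> {0..1}" "k \<in> K"
    obtain x where "f k = P (\<sigma> k, x, \<eta> k)" using rep[OF rk(2)] by blast
    then show "F (r, k) \<in> X" using Fval[OF rk] by simp
  qed
  moreover have "F (0, k) = f k \<and> F (1, k) = P (real N, \<omega> k, \<eta> k)" if k: "k \<in> K" for k
  proof -
    obtain x where x: "f k = P (\<sigma> k, x, \<eta> k)" "M ^ N * (\<omega> k - x) \<in> \<int>" using rep[OF k] by blast
    \<comment> \<open>At level \<open>N\<close> the ambiguity of \<open>x\<close> is exactly the one
      that \<open>dev N\<close> permits, so the approximate coordinate \<open>\<omega> k\<close>
      yields the right point.\<close>
    then have "P (real N, x, \<eta> k) = P (real N, \<omega> k, \<eta> k)"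
      using Ints_minus[OF x(2)] by (simp add: P_eq_iff right_diff_distrib)
    then show ?thesis using Fval[OF _ k x(1), of 0] Fval[OF _ k x(1), of 1] x(1) by simp
  qed
  ultimately show ?thesis using Fval by (intro exI[of _ F]) auto
qed

end

section \<open>The fundamental group\<close>

lemma loop_at_iff:
  "loop_at (top_of_set S) x p \<longleftrightarrow> path p \<and> path_image p \<subseteq> S \<and> p 0 = x \<and> p 1 = x"
  by (auto simp: loop_at_def pathin_def path_def path_image_def)

lemma loop_homotopic_iff:
  assumes "p 0 = x" "p 1 = x"
  shows "loop_homotopic (top_of_set S) x p q \<longleftrightarrow> homotopic_paths S p q"
  using assms by (simp add: loop_homotopic_def homotopic_paths_def pathstart_def pathfinish_def)

lemma loop_concat_eq: "loop_concat p q = p +++ q"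
  by (simp add: loop_concat_def joinpaths_def)

text \<open>The two routes between opposite corners are linearly homotopic in the convex square;
  \<open>h\<close> carries this homotopy to \<open>S\<close>.\<close>

lemma homotopic_paths_square:
  fixes h :: "real \<times> real \<Rightarrow> 'a::topological_space"
  assumes h: "continuous_on ({0..1} \<times> {0..1}) h" "h ` ({0..1} \<times> {0..1}) \<subseteq> S"
  shows "homotopic_paths S ((\<lambda>t. h (0, t)) +++ (\<lambda>r. h (r, 1))) ((\<lambda>r. h (r, 0)) +++ (\<lambda>t. h (1, t)))"
proof -
  define l where "l = linepath (0::real, 0::real) (0, 1) +++ linepath (0, 1) (1, 1)"
  define l' where "l' = linepath (0::real, 0::real) (1, 0) +++ linepath (1, 0) (1, 1)"
  have convex: "convex ({0..1} \<times> {0..1} :: (real \<times> real) set)" by (intro convex_Times) auto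
  have in_square: "l t \<in> {0..1} \<times> {0..1}" "l' t \<in> {0..1} \<times> {0..1}" if "t \<in> {0..1}" for t
    using that by (auto simp: l_def l'_def joinpaths_def linepath_def)
  have "homotopic_paths ({0..1} \<times> {0..1}) l l'"
  proof (rule homotopic_paths_linear)
    show "closed_segment (l t) (l' t) \<subseteq> {0..1} \<times> {0..1}" if "t \<in> {0..1}" for t
      using in_square[OF that] convex by (rule closed_segment_subset)
  qed (auto simp: l_def l'_def)
  then have "homotopic_paths S (h \<circ> l) (h \<circ> l')"
    using h by (intro homotopic_paths_continuous_image) auto
  moreover have "h \<circ> l = (\<lambda>t. h (0, t)) +++ (\<lambda>r. h (r, 1))" "h \<circ> l' = (\<lambda>r. h (r, 0)) +++ (\<lambda>t. h (1, t))"
    by (auto simp: l_def l'_def joinpaths_def linepath_def fun_eq_iff)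
  ultimately show ?thesis by simp
qed

lemma homotopic_paths_cancel_right:
  assumes "homotopic_paths S (p +++ g) (q +++ g)"
    and "path p" "path_image p \<subseteq> S" "path q" "path_image q \<subseteq> S" "path g" "path_image g \<subseteq> S"
    and ends: "pathfinish p = pathstart g" "pathfinish q = pathstart g"
  shows "homotopic_paths S p q"
proof -
  have *: "homotopic_paths S ((f +++ g) +++ reversepath g) f"
    if f: "path f" "path_image f \<subseteq> S" "pathfinish f = pathstart g" for f
  proof -
    \<comment> \<open>Both sides are \<open>f +++ g\<close> reparametrized: \<open>a\<close> runs
      through all of it and back to the midpoint, \<open>b\<close> stops at the midpoint. The two
      are homotopic in the interval.\<close>
    define a where "a = linepath 0 1 +++ linepath 1 (1 / 2 :: real)"
    define b where "b = linepath 0 (1 / 2 :: real)"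
    have ab: "a t \<in> {0..1}" "b t \<in> {0..1}" if "t \<in> {0..1}" for t
      using that by (auto simp: a_def b_def joinpaths_def linepath_def)
    have "homotopic_paths {0..1} a b"
    proof (rule homotopic_paths_linear)
      show "closed_segment (a t) (b t) \<subseteq> {0..1}" if "t \<in> {0..1}" for t
        using ab[OF that] convex_real_interval(5) by (rule closed_segment_subset)
    qed (auto simp: a_def b_def)
    moreover have fg: "path (f +++ g)" using f assms(6) by (intro path_join_imp)
    moreover have "path_image (f +++ g) \<subseteq> S"
      using path_image_join_subset[of f g] f assms(7) by blast
    ultimately have h: "homotopic_paths S ((f +++ g) \<circ> a) ((f +++ g) \<circ> b)"
      by (intro homotopic_paths_continuous_image) (auto simp: path_def path_image_def)
    have fg1: "f 1 = g 0" using f(3) by (simp add: pathfinish_def pathstart_def)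
    have "homotopic_paths S ((f +++ g) \<circ> a) ((f +++ g) +++ reversepath g)"
    proof (rule homotopic_paths_eq)
      fix t :: real assume t: "t \<in> {0..1}"
      have "g (2 - 2 * t) = f (3 - 2 * t)" if "3 - 2 * t \<le> 1"
      proof -
        have "t = 1" using that t by auto
        then show ?thesis using fg1 by simp
      qed
      then show "((f +++ g) \<circ> a) t = ((f +++ g) +++ reversepath g) t"
        by (auto simp: a_def joinpaths_def linepath_def reversepath_def algebra_simps diff_divide_distrib)
    qed (use homotopic_paths_imp_path[OF h] homotopic_paths_imp_subset[OF h] in auto)
    moreover have "homotopic_paths S ((f +++ g) \<circ> b) f"
      using homotopic_paths_imp_path[OF h] homotopic_paths_imp_subset[OF h]
      by (intro homotopic_paths_eq) (auto simp: b_def joinpaths_def linepath_def)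
    ultimately show ?thesis using h by (meson homotopic_paths_sym homotopic_paths_trans)
  qed
  have "homotopic_paths S ((p +++ g) +++ reversepath g) ((q +++ g) +++ reversepath g)"
    using assms(6,7) by (intro homotopic_paths_join[OF assms(1)]) auto
  then show ?thesis
    using *[OF assms(2,3) ends(1)] *[OF assms(4,5) ends(2)]
    by (meson homotopic_paths_sym homotopic_paths_trans)
qed

context mapping_torus
begin

text \<open>The union of \<open>dev N\<close> over all \<open>N\<close>. Allowing all translations
  by \<open>localized_ints m\<close> makes the relation independent of the level, while its fibres
  stay countable.\<close>

definition Dev :: "(nat \<Rightarrow> real) \<Rightarrow> real \<times> real \<times> real \<Rightarrow> bool" where
  "Dev z = (\<lambda>(s, x, y). \<exists>x0. z = P (s, x0, y) \<and> x - x0 \<in> localized_ints m)"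

lemma DevE: "Dev z (s, x, y) \<Longrightarrow> \<exists>a. z = P (s, a, y) \<and> x - a \<in> localized_ints m"
  by (simp add: Dev_def)

lemma DevI: "z = P (s, a, y) \<Longrightarrow> x - a \<in> localized_ints m \<Longrightarrow> Dev z (s, x, y)"
  by (auto simp: Dev_def)

abbreviation "base \<equiv> P (0, 0, 0)"

lemma dev_imp_Dev: "dev N z u \<Longrightarrow> Dev z u"
  by (cases u) (auto simp: dev_def Dev_def localized_ints_def mult.commute)

lemma Dev_diff:
  assumes "Dev z (s, x, y)" "Dev z (s', x', y')"
  shows "s - s' \<in> \<int>" "y - y' \<in> \<int>" "s = s' \<Longrightarrow> x - x' \<in> localized_ints m"
proof -
  obtain a b where ab: "z = P (s, a, y)" "x - a \<in> localized_ints m" "z = P (s', b, y')" "x' - b \<in> localized_ints m"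
    using DevE[OF assms(1)] DevE[OF assms(2)] by blast
  then have eq: "P (s, a, y) = P (s', b, y')" by simp
  then show "s - s' \<in> \<int>" "y - y' \<in> \<int>" by (simp_all add: P_eq_iff)
  show "x - x' \<in> localized_ints m" if "s = s'"
  proof -
    have "M powi \<lfloor>s\<rfloor> * a - M powi \<lfloor>s\<rfloor> * b \<in> \<int>" using eq that by (simp add: P_eq_iff)
    then have "(M powi \<lfloor>s\<rfloor> * a - M powi \<lfloor>s\<rfloor> * b) * M powi (- \<lfloor>s\<rfloor>) \<in> localized_ints m"
      by (intro localized_ints_powi m Ints_localized_ints)
    moreover have "(M powi \<lfloor>s\<rfloor> * a - M powi \<lfloor>s\<rfloor> * b) * M powi (- \<lfloor>s\<rfloor>) = a - b"
      using m by (simp add: power_int_minus field_simps)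
    ultimately have "a - b \<in> localized_ints m" by simp
    then have "(x - a) + (a - b) - (x' - b) \<in> localized_ints m"
      by (rule localized_ints_diff[OF localized_ints_add[OF ab(2)] ab(4)])
    then show ?thesis by simp
  qed
qed

lemma Dev_base:
  assumes "Dev base (s, x, y)"
  shows "s \<in> \<int>" "x \<in> localized_ints m" "y \<in> \<int>"
proof -
  have 0: "Dev base (0, 0, 0)" by (auto simp: Dev_def Ints_localized_ints intro!: exI[of _ 0])
  show "s \<in> \<int>" "y \<in> \<int>" using Dev_diff(1,2)[OF assms 0] by simp_all
  obtain a where a: "base = P (s, a, y)" "x - a \<in> localized_ints m" using DevE[OF assms] by blast
  then have "M powi \<lfloor>s\<rfloor> * a \<in> \<int>" by (simp add: P_eq_iff)
  then have "(M powi \<lfloor>s\<rfloor> * a) * M powi (- \<lfloor>s\<rfloor>) \<in> localized_ints m"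
    by (intro localized_ints_powi m Ints_localized_ints)
  moreover have "(M powi \<lfloor>s\<rfloor> * a) * M powi (- \<lfloor>s\<rfloor>) = a"
    using m by (simp add: power_int_minus field_simps)
  ultimately have "a \<in> localized_ints m" by simp
  then show "x \<in> localized_ints m" using localized_ints_add[OF a(2), of a] by simp
qed

text \<open>The difference of two lifts is continuous with values in a countable set, hence
  constant. The levels are compared first, because the \<open>x\<close> coordinates over one point
  are comparable only at equal levels.\<close>

lemma Dev_unique:
  fixes \<sigma> :: "'k::topological_space \<Rightarrow> real"
  assumes K: "connected K" "k0 \<in> K"
    and cont: "continuous_on K \<sigma>" "continuous_on K \<omega>" "continuous_on K \<eta>"
      "continuous_on K \<sigma>'" "continuous_on K \<omega>'" "continuous_on K \<eta>'"
    and eq0: "\<sigma> k0 = \<sigma>' k0" "\<omega> k0 = \<omega>' k0" "\<eta> k0 = \<eta>' k0"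
    and Dev: "\<And>k. k \<in> K \<Longrightarrow> Dev (p k) (\<sigma> k, \<omega> k, \<eta> k)" "\<And>k. k \<in> K \<Longrightarrow> Dev (p k) (\<sigma>' k, \<omega>' k, \<eta>' k)"
    and k: "k \<in> K"
  shows "\<sigma> k = \<sigma>' k" "\<omega> k = \<omega>' k" "\<eta> k = \<eta>' k"
proof -
  have const: "f k = g k" if k: "k \<in> K" and cont: "continuous_on K f" "continuous_on K g"
    and eq: "f k0 = g k0" and C: "countable C" "\<And>k. k \<in> K \<Longrightarrow> f k - g k \<in> C"
    for f g :: "'k \<Rightarrow> real" and C k
  proof -
    have "f k - g k = f k0 - g k0"
    proof (rule continuous_countable_constant[OF K(1) _ _ k K(2)])
      show "continuous_on K (\<lambda>k. f k - g k)" by (intro continuous_intros cont)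
      show "countable ((\<lambda>k. f k - g k) ` K)"
        by (rule countable_subset[OF _ C(1)]) (use C(2) in blast)
    qed
    then show ?thesis using eq by simp
  qed
  have \<sigma>: "\<sigma> k = \<sigma>' k" if "k \<in> K" for k
    by (rule const[OF that cont(1,4) eq0(1), of \<int>]) (use Dev_diff(1)[OF Dev] in \<open>auto simp: countable_int\<close>)
  then show "\<sigma> k = \<sigma>' k" using k .
  show "\<eta> k = \<eta>' k"
    by (rule const[OF k cont(3,6) eq0(3), of \<int>]) (use Dev_diff(2)[OF Dev] in \<open>auto simp: countable_int\<close>)
  show "\<omega> k = \<omega>' k"
    by (rule const[OF k cont(2,5) eq0(2), of "localized_ints m"])
      (use Dev_diff(3)[OF Dev] \<sigma> countable_localized_ints[OF m] in auto)
qed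

text \<open>Comparison with a constant lift.\<close>

lemma Dev_base_constant:
  fixes \<sigma> :: "'k::topological_space \<Rightarrow> real"
  assumes K: "connected K" "k0 \<in> K"
    and cont: "continuous_on K \<sigma>" "continuous_on K \<omega>" "continuous_on K \<eta>"
    and Dev: "\<And>k. k \<in> K \<Longrightarrow> Dev base (\<sigma> k, \<omega> k, \<eta> k)"
    and k: "k \<in> K"
  shows "\<sigma> k = \<sigma> k0" "\<omega> k = \<omega> k0" "\<eta> k = \<eta> k0"
  using Dev_unique[where p = "\<lambda>_. base", OF K cont continuous_on_const continuous_on_const continuous_on_const
      refl refl refl Dev Dev[OF K(2)] k] by auto

section \<open>Holonomy of loops\<close>

definition lifts_to :: "(real \<Rightarrow> nat \<Rightarrow> real) \<Rightarrow> (real \<Rightarrow> real \<times> real \<times> real) \<Rightarrow> bool" where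
  "lifts_to p c \<longleftrightarrow> path c \<and> c 0 = (0, 0, 0) \<and> (\<forall>t\<in>{0..1}. Dev (p t) (c t))"

text \<open>Reorders \<open>(s, x, y)\<close> into the triple \<open>(q, e, l)\<close> of
  \<open>bsz\<close>. For lifts of loops the floors only turn integral reals into integers.\<close>

definition endpoint :: "(real \<Rightarrow> real \<times> real \<times> real) \<Rightarrow> real \<times> int \<times> int" where
  "endpoint c = (fst (snd (c 1)), \<lfloor>fst (c 1)\<rfloor>, \<lfloor>snd (snd (c 1))\<rfloor>)"

definition hol :: "(real \<Rightarrow> nat \<Rightarrow> real) \<Rightarrow> real \<times> int \<times> int" where
  "hol p = endpoint (SOME c. lifts_to p c)"

abbreviation "loop p \<equiv> path p \<and> path_image p \<subseteq> X \<and> p 0 = base \<and> p 1 = base"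

lemma lifts_to_unique:
  assumes "lifts_to p c" "lifts_to p d" "t \<in> {0..1}"
  shows "c t = d t"
proof -
  have c: "continuous_on {0..1} c" and d: "continuous_on {0..1} d" using assms by (auto simp: lifts_to_def path_def)
  have D: "Dev (p t) (fst (c t), fst (snd (c t)), snd (snd (c t)))"
    "Dev (p t) (fst (d t), fst (snd (d t)), snd (snd (d t)))" if "t \<in> {0..1}" for t
    using assms that by (auto simp: lifts_to_def)
  have c0: "c 0 = (0, 0, 0)" "d 0 = (0, 0, 0)" using assms by (auto simp: lifts_to_def)
  have "fst (c t) = fst (d t)" "fst (snd (c t)) = fst (snd (d t))" "snd (snd (c t)) = snd (snd (d t))"
    by (rule Dev_unique[where K = "{0..1}" and ?k0.0 = 0 and p = p and
          \<sigma> = "\<lambda>t. fst (c t)" and \<omega> = "\<lambda>t. fst (snd (c t))" and \<eta> = "\<lambda>t. snd (snd (c t))" and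
          \<sigma>' = "\<lambda>t. fst (d t)" and \<omega>' = "\<lambda>t. fst (snd (d t))" and \<eta>' = "\<lambda>t. snd (snd (d t))"];
        (intro continuous_intros c d D assms(3))?; simp add: c0)+
  then show ?thesis by (simp add: prod_eq_iff)
qed

lemma hol_eq: "lifts_to p c \<Longrightarrow> hol p = endpoint c"
proof -
  assume c: "lifts_to p c"
  then have "lifts_to p (SOME c. lifts_to p c)" by (rule someI[of "lifts_to p"])
  then have "(SOME c. lifts_to p c) 1 = c 1" using c by (rule lifts_to_unique) simp
  then show ?thesis by (simp add: hol_def endpoint_def)
qed

lemma circle_lifting_01: "circle_lifting {0..1::real}"
  by (rule circle_lifting_starlike) (auto simp: mult_le_one)

lemma circle_lifting_square: "circle_lifting ({0..1::real} \<times> {0..1::real})"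
  by (rule circle_lifting_starlike) (auto simp: mult_le_one intro!: compact_Times)

lemma loop_lift:
  assumes p: "loop p"
  shows "\<exists>\<sigma> \<omega> \<eta> N. continuous_on {0..1} \<sigma> \<and> continuous_on {0..1} \<omega> \<and> continuous_on {0..1} \<eta> \<and>
    (\<forall>t\<in>{0..1}. \<sigma> t \<le> real N \<and> dev N (p t) (\<sigma> t, \<omega> t, \<eta> t)) \<and> \<sigma> 0 = 0 \<and> \<omega> 0 = 0 \<and> \<eta> 0 = 0 \<and>
    lifts_to p (\<lambda>t. (\<sigma> t, \<omega> t, \<eta> t))"
proof -
  have "\<exists>(\<sigma>::real \<Rightarrow> real) \<omega> \<eta> N. continuous_on {0..1} \<sigma> \<and> continuous_on {0..1} \<omega> \<and> continuous_on {0..1} \<eta> \<and>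
    \<sigma> 0 = 0 \<and> \<omega> 0 = 0 \<and> \<eta> 0 = 0 \<and>
    (\<forall>k\<in>{0..1}. \<sigma> k \<le> real N \<and> dev N (p k) (\<sigma> k, \<omega> k, \<eta> k))"
    using p by (intro lift_exists circle_lifting_01) (auto simp: path_def path_image_def)
  then obtain \<sigma> \<omega> \<eta> N where *: "continuous_on {0..1} \<sigma>" "continuous_on {0..1} \<omega>" "continuous_on {0..1} \<eta>"
    "\<sigma> 0 = 0" "\<omega> 0 = 0" "\<eta> 0 = (0::real)" "\<forall>k\<in>{0..1}. \<sigma> k \<le> real N \<and> dev N (p k) (\<sigma> k, \<omega> k, \<eta> k)"
    by (elim exE conjE)
  then have "lifts_to p (\<lambda>t. (\<sigma> t, \<omega> t, \<eta> t))"
    by (auto simp: lifts_to_def path_def intro!: continuous_intros dest: dev_imp_Dev)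
  then show ?thesis using * by (intro exI[of _ \<sigma>] exI[of _ \<omega>] exI[of _ \<eta>] exI[of _ N]) simp
qed

lemma endpoint_lift:
  assumes "loop p" "lifts_to p c"
  shows "c 1 = (of_int (fst (snd (endpoint c))), fst (endpoint c), of_int (snd (snd (endpoint c))))"
    and "endpoint c \<in> carrier (bsz m)"
proof -
  obtain s x y where c1: "c 1 = (s, x, y)" by (cases "c 1")
  have "Dev base (s, x, y)" using assms c1 by (auto simp: lifts_to_def dest: bspec[of _ _ 1])
  from Dev_base[OF this]
  show "c 1 = (of_int (fst (snd (endpoint c))), fst (endpoint c), of_int (snd (snd (endpoint c))))"
    "endpoint c \<in> carrier (bsz m)"
    by (auto simp: endpoint_def c1 elim!: Ints_cases)
qed

lemma hol_closed: "loop p \<Longrightarrow> hol p \<in> carrier (bsz m)"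
proof -
  assume p: "loop p"
  obtain c where c: "lifts_to p c" using loop_lift[OF p] by blast
  show ?thesis using endpoint_lift(2)[OF p c] hol_eq[OF c] by simp
qed

text \<open>Lift the whole homotopy over the square. On the two sides where it rests at
  \<open>base\<close> the lift is constant by countability, so the lifts of \<open>p\<close> and
  \<open>q\<close> start at the same point and end at the same point.\<close>

lemma hol_homotopic:
  assumes p: "loop p" and hom: "homotopic_paths X p q"
  shows "hol p = hol q"
proof -
  obtain h where h: "continuous_on ({0..1} \<times> {0..1}) h" "h \<in> ({0..1} \<times> {0..1}) \<rightarrow> X"
    "\<forall>x\<in>{0..1}. h (0, x) = p x" "\<forall>x\<in>{0..1}. h (1, x) = q x"
    "\<forall>t\<in>{0..1::real}. pathstart (h \<circ> Pair t) = pathstart p \<and> pathfinish (h \<circ> Pair t) = pathfinish p"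
    using hom unfolding homotopic_paths by blast
  have sides: "h (r, 0) = base" "h (r, 1) = base" if "r \<in> {0..1}" for r
    using h(5)[rule_format, OF that] p by (auto simp: pathstart_def pathfinish_def)
  let ?K = "{0..1::real} \<times> {0..1::real}"
  have "\<exists>(\<sigma>::real \<times> real \<Rightarrow> real) \<omega> \<eta> N. continuous_on ?K \<sigma> \<and> continuous_on ?K \<omega> \<and> continuous_on ?K \<eta> \<and>
    \<sigma> (0, 0) = 0 \<and> \<omega> (0, 0) = 0 \<and> \<eta> (0, 0) = 0 \<and>
    (\<forall>k\<in>?K. \<sigma> k \<le> real N \<and> dev N (h k) (\<sigma> k, \<omega> k, \<eta> k))"
  proof (rule lift_exists[OF _ circle_lifting_square _ h(1)])
    show "compact ?K" by (intro compact_Times) auto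
    show "h k \<in> X" if "k \<in> ?K" for k using h(2) that by blast
    show "h (0, 0) = base" using sides[of 0] by simp
  qed simp
  then obtain \<sigma> \<omega> \<eta> :: "real \<times> real \<Rightarrow> real" and N where
    cont: "continuous_on ?K \<sigma>" "continuous_on ?K \<omega>" "continuous_on ?K \<eta>"
    and zero: "\<sigma> (0, 0) = 0" "\<omega> (0, 0) = 0" "\<eta> (0, 0) = 0"
    and dev: "\<forall>k\<in>?K. \<sigma> k \<le> real N \<and> dev N (h k) (\<sigma> k, \<omega> k, \<eta> k)"
    by (elim exE conjE)
  have D: "Dev (h k) (\<sigma> k, \<omega> k, \<eta> k)" if "k \<in> ?K" for k
    using dev that by (auto intro: dev_imp_Dev)
  have edge: "continuous_on {0..1} (\<lambda>r. f (r, a))" if "continuous_on ?K f" "a \<in> {0..1}"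
    for a and f :: "real \<times> real \<Rightarrow> real"
    by (rule continuous_on_compose2[OF that(1)]) (use that(2) in \<open>auto intro!: continuous_intros\<close>)
  have edge': "continuous_on {0..1} (\<lambda>t. f (a, t))" if "continuous_on ?K f" "a \<in> {0..1}"
    for a and f :: "real \<times> real \<Rightarrow> real"
    by (rule continuous_on_compose2[OF that(1)]) (use that(2) in \<open>auto intro!: continuous_intros\<close>)
  have const: "\<sigma> (r, a) = \<sigma> (0, a)" "\<omega> (r, a) = \<omega> (0, a)" "\<eta> (r, a) = \<eta> (0, a)"
    if r: "r \<in> {0..1}" and a: "a \<in> {0, 1}" for r a
  proof -
    have "Dev base (\<sigma> (r, a), \<omega> (r, a), \<eta> (r, a))" if "r \<in> {0..1}" for r
      using D[of "(r, a)"] sides[OF that] that a by auto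
    then show "\<sigma> (r, a) = \<sigma> (0, a)" "\<omega> (r, a) = \<omega> (0, a)" "\<eta> (r, a) = \<eta> (0, a)"
      using Dev_base_constant[of "{0..1}" 0 "\<lambda>r. \<sigma> (r, a)" "\<lambda>r. \<omega> (r, a)" "\<lambda>r. \<eta> (r, a)" r]
        edge[OF cont(1), of a] edge[OF cont(2), of a] edge[OF cont(3), of a] a r by auto
  qed
  have lift: "lifts_to g (\<lambda>t. (\<sigma> (r, t), \<omega> (r, t), \<eta> (r, t)))"
    if r: "r \<in> {0, 1}" and g: "\<And>t. t \<in> {0..1} \<Longrightarrow> h (r, t) = g t" for r g
    unfolding lifts_to_def
  proof (intro conjI ballI)
    show "path (\<lambda>t. (\<sigma> (r, t), \<omega> (r, t), \<eta> (r, t)))"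
      unfolding path_def using r by (intro continuous_on_Pair edge' cont) auto
    show "(\<sigma> (r, 0), \<omega> (r, 0), \<eta> (r, 0)) = (0, 0, 0)"
      using const[of r 0] zero r by auto
    show "Dev (g t) (\<sigma> (r, t), \<omega> (r, t), \<eta> (r, t))" if "t \<in> {0..1}" for t
      using D[of "(r, t)"] g[OF that] r that by auto
  qed
  have "hol p = endpoint (\<lambda>t. (\<sigma> (0, t), \<omega> (0, t), \<eta> (0, t)))"
    by (rule hol_eq, rule lift) (use h(3) in auto)
  moreover have "hol q = endpoint (\<lambda>t. (\<sigma> (1, t), \<omega> (1, t), \<eta> (1, t)))"
    by (rule hol_eq, rule lift) (use h(4) in auto)
  ultimately show ?thesis using const[of 1 1] by (simp add: endpoint_def)
qed

lemma hol_join: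
  assumes p: "loop p" and q: "loop q"
  shows "hol (p +++ q) = hol p \<otimes>\<^bsub>bsz m\<^esub> hol q"
proof -
  obtain c where c: "lifts_to p c" using loop_lift[OF p] by blast
  obtain d where d: "lifts_to q d" using loop_lift[OF q] by blast
  obtain x0 e l where ep: "endpoint c = (x0, e, l)" by (cases "endpoint c")
  have c1: "c 1 = (of_int e, x0, of_int l)" and x0: "x0 \<in> localized_ints m"
    using endpoint_lift[OF p c] by (auto simp: ep)
  \<comment> \<open>Left multiplication by \<open>endpoint c\<close>, acting on R^3. It combines a
    symmetry of \<open>P\<close> with a translation by \<open>x0\<close>, which \<open>Dev\<close>
    does not see; so \<open>c\<close> followed by the transformed \<open>d\<close> lifts the
    concatenation.\<close>
  define act where "act u = (of_int e + fst u, x0 + M powi (- e) * fst (snd u), of_int l + snd (snd u))"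
    for u :: "real \<times> real \<times> real"
  have act: "Dev z (act u)" if zu: "Dev z u" for z u
  proof -
    obtain s x y where u: "u = (s, x, y)" by (cases u)
    then obtain a where a: "z = P (s, a, y)" "x - a \<in> localized_ints m" using DevE[of z s x y] zu by blast
    have "P (of_int e + s, M powi (- e) * a, of_int l + y) = P (s, a, y)"
      using m by (simp add: P_eq_iff power_int_add power_int_minus field_simps)
    moreover have "x0 + M powi (- e) * x - M powi (- e) * a = x0 + (x - a) * M powi (- e)"
      by (simp add: algebra_simps)
    moreover have "x0 + (x - a) * M powi (- e) \<in> localized_ints m"
      by (intro localized_ints_add x0 localized_ints_powi m a(2))
    ultimately have "z = P (of_int e + s, M powi (- e) * a, of_int l + y)"
      "x0 + M powi (- e) * x - M powi (- e) * a \<in> localized_ints m"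
      using a(1) by (simp_all only:)
    from DevI[OF this] show ?thesis by (simp add: act_def u)
  qed
  have d0: "act (d 0) = c 1" using d by (simp add: lifts_to_def act_def c1)
  have "lifts_to (p +++ q) (c +++ (\<lambda>t. act (d t)))"
    unfolding lifts_to_def
  proof (intro conjI ballI)
    have "path (\<lambda>t. act (d t))"
      using d by (auto simp: act_def lifts_to_def path_def intro!: continuous_intros)
    then show "path (c +++ (\<lambda>t. act (d t)))"
      using c d0 by (intro path_join_imp) (auto simp: lifts_to_def pathstart_def pathfinish_def)
    show "(c +++ (\<lambda>t. act (d t))) 0 = (0, 0, 0)" using c by (simp add: lifts_to_def joinpaths_def)
    show "Dev ((p +++ q) t) ((c +++ (\<lambda>t. act (d t))) t)" if "t \<in> {0..1}" for t
      using that c d act by (auto simp: lifts_to_def joinpaths_def)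
  qed
  then have "hol (p +++ q) = endpoint (c +++ (\<lambda>t. act (d t)))" by (rule hol_eq)
  also have "\<dots> = endpoint c \<otimes>\<^bsub>bsz m\<^esub> endpoint d"
    by (simp add: ep) (simp add: endpoint_def joinpaths_def act_def mult.commute)
  also have "\<dots> = hol p \<otimes>\<^bsub>bsz m\<^esub> hol q" using hol_eq[OF c] hol_eq[OF d] by simp
  finally show ?thesis .
qed

text \<open>Climb to a level \<open>i\<close> at which \<open>q\<close> is a multiple of
  \<open>M powi (- i)\<close>, so that moving \<open>x\<close> from 0 to \<open>q\<close> is a
  closed loop there. Then go straight to level \<open>e\<close> while \<open>y\<close> turns
  \<open>l\<close> times.\<close>

lemma hol_surj:
  assumes "g \<in> carrier (bsz m)"
  shows "\<exists>p. loop p \<and> hol p = g"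
proof -
  obtain q e l where g: "g = (q, e, l)" by (cases g)
  then obtain i where i: "q * M ^ i \<in> \<int>" using assms by (auto simp: localized_ints_def)
  define c1 where "c1 = linepath (0, 0, 0) (real i, 0, 0) +++ linepath (real i, 0, 0) (real i, q, 0 :: real)"
  define c2 where "c2 = linepath (real i, q, 0) (of_int e, q, of_int l :: real)"
  \<comment> \<open>The path in \<open>X\<close> follows \<open>d2\<close>, with
    \<open>x = 0\<close>, because \<open>P (e, q, l)\<close> need not be \<open>base\<close>. The
    lift follows \<open>c2\<close>, which differs from \<open>d2\<close> by \<open>q\<close> and is
    thus equally admissible for \<open>Dev\<close>.\<close>
  define d2 where "d2 = linepath (real i, 0 :: real, 0) (of_int e, 0, of_int l :: real)"
  define p where "p = (P \<circ> c1) +++ (P \<circ> d2)"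
  have path_P: "path (P \<circ> c)" if "path c" for c
    using that by (intro path_continuous_image continuous_P)
  have ends: "P (real i, q, 0) = P (real i, 0, 0)" "P (of_int e, 0, of_int l) = base"
    using i by (simp_all add: P_eq_iff mult.commute)
  have p: "path p"
    unfolding p_def using ends
    by (intro path_join_imp path_P) (auto simp: c1_def d2_def pathfinish_compose pathstart_compose)
  have loop: "loop p"
  proof (intro conjI p)
    show "path_image p \<subseteq> X" by (auto simp: p_def path_image_def joinpaths_def)
    show "p 0 = base" by (simp add: p_def c1_def joinpaths_def linepath_def)
    show "p 1 = base" using ends(2) by (simp add: p_def d2_def joinpaths_def linepath_def)
  qed
  have q: "q \<in> localized_ints m" using assms g by simp
  have "lifts_to p (c1 +++ c2)"
    unfolding lifts_to_def
  proof (intro conjI ballI)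
    show "path (c1 +++ c2)" by (intro path_join_imp) (auto simp: c1_def c2_def)
    show "(c1 +++ c2) 0 = (0, 0, 0)" by (simp add: c1_def joinpaths_def linepath_def)
    have D: "Dev (P u) u" for u
      by (cases u) (auto intro!: DevI[OF refl] simp: Ints_localized_ints)
    have D2: "Dev (P (d2 t)) (c2 t)" for t
    proof -
      have "c2 t = (fst (d2 t), q, snd (snd (d2 t)))" "fst (snd (d2 t)) = 0"
        by (simp_all add: c2_def d2_def linepath_def algebra_simps)
      then have "c2 t = (fst (d2 t), q, snd (snd (d2 t)))" "d2 t = (fst (d2 t), 0, snd (snd (d2 t)))"
        by (simp_all add: prod_eq_iff)
      then show ?thesis using q by (metis DevI diff_zero)
    qed
    show "Dev (p t) ((c1 +++ c2) t)" for t
      using D D2 by (simp add: p_def joinpaths_def)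
  qed
  then have "hol p = endpoint (c1 +++ c2)" by (rule hol_eq)
  also have "\<dots> = g" by (simp add: endpoint_def c2_def joinpaths_def linepath_def g)
  finally show ?thesis using loop by blast
qed

text \<open>Flowing up to level \<open>N\<close> turns the loops into paths \<open>T\<close> and
  \<open>T'\<close> in one torus fibre, whose lifts to the plane have the same ends and are linearly
  homotopic. Meanwhile the ends of the loops move along \<open>\<delta>\<close> and
  \<open>\<gamma>\<close>; the square lemma accounts for this, and \<open>\<gamma>\<close> is
  cancelled at the end.\<close>

lemma hol_inj:
  assumes p: "loop p" and q: "loop q" and eq: "hol p = hol q"
  shows "homotopic_paths X p q"
proof -
  obtain \<sigma> \<omega> \<eta> N1 where c: "continuous_on {0..1} \<sigma>" "continuous_on {0..1} \<omega>" "continuous_on {0..1} \<eta>"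
    and dev1: "\<forall>t\<in>{0..1}. \<sigma> t \<le> real N1 \<and> dev N1 (p t) (\<sigma> t, \<omega> t, \<eta> t)"
    and c0: "\<sigma> 0 = 0" "\<omega> 0 = 0" "\<eta> 0 = 0" and lc: "lifts_to p (\<lambda>t. (\<sigma> t, \<omega> t, \<eta> t))"
    using loop_lift[OF p] by (elim exE conjE)
  obtain \<sigma>' \<omega>' \<eta>' N2 where d: "continuous_on {0..1} \<sigma>'" "continuous_on {0..1} \<omega>'" "continuous_on {0..1} \<eta>'"
    and dev2: "\<forall>t\<in>{0..1}. \<sigma>' t \<le> real N2 \<and> dev N2 (q t) (\<sigma>' t, \<omega>' t, \<eta>' t)"
    and d0: "\<sigma>' 0 = 0" "\<omega>' 0 = 0" "\<eta>' 0 = 0" and ld: "lifts_to q (\<lambda>t. (\<sigma>' t, \<omega>' t, \<eta>' t))"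
    using loop_lift[OF q] by (elim exE conjE)
  define N where "N = max N1 N2"
  have dv1: "\<sigma> t \<le> real N \<and> dev N (p t) (\<sigma> t, \<omega> t, \<eta> t)" if "t \<in> {0..1}" for t
    using dev1[rule_format, OF that] dev_mono[of N1 _ _ N] by (auto simp: N_def)
  have dv2: "\<sigma>' t \<le> real N \<and> dev N (q t) (\<sigma>' t, \<omega>' t, \<eta>' t)" if "t \<in> {0..1}" for t
    using dev2[rule_format, OF that] dev_mono[of N2 _ _ N] by (auto simp: N_def)
  have "endpoint (\<lambda>t. (\<sigma> t, \<omega> t, \<eta> t)) = endpoint (\<lambda>t. (\<sigma>' t, \<omega>' t, \<eta>' t))"
    using eq hol_eq[OF lc] hol_eq[OF ld] by simp
  then have "(\<sigma> 1, \<omega> 1, \<eta> 1) = (\<sigma>' 1, \<omega>' 1, \<eta>' 1)"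
    using endpoint_lift(1)[OF p lc] endpoint_lift(1)[OF q ld] by simp
  then have e1: "\<sigma> 1 = \<sigma>' 1" "\<omega> 1 = \<omega>' 1" "\<eta> 1 = \<eta>' 1" by auto
  obtain F where F: "continuous_on ({0..1} \<times> {0..1}) F" "F ` ({0..1} \<times> {0..1}) \<subseteq> X"
    "\<forall>t\<in>{0..1}. F (0, t) = p t \<and> F (1, t) = P (real N, \<omega> t, \<eta> t)"
    "\<forall>r\<in>{0..1}. \<forall>t\<in>{0..1}. \<forall>x y. p t = P (\<sigma> t, x, y) \<longrightarrow> F (r, t) = P ((1 - r) * \<sigma> t + r * real N, x, y)"
    using flow_exists[of "{0..1}" p \<sigma> \<omega> \<eta> N] p c dv1 by (auto simp: path_def)
  obtain F' where F': "continuous_on ({0..1} \<times> {0..1}) F'" "F' ` ({0..1} \<times> {0..1}) \<subseteq> X"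
    "\<forall>t\<in>{0..1}. F' (0, t) = q t \<and> F' (1, t) = P (real N, \<omega>' t, \<eta>' t)"
    "\<forall>r\<in>{0..1}. \<forall>t\<in>{0..1}. \<forall>x y. q t = P (\<sigma>' t, x, y) \<longrightarrow> F' (r, t) = P ((1 - r) * \<sigma>' t + r * real N, x, y)"
    using flow_exists[of "{0..1}" q \<sigma>' \<omega>' \<eta>' N] q d dv2 by (auto simp: path_def)
  \<comment> \<open>An exact \<open>x\<close> coordinate of the base point at level
    \<open>\<sigma> 1\<close>, since \<open>\<omega> 1\<close> is one only up to an error. It
    selects the flow line \<open>\<gamma>\<close>.\<close>
  obtain x1 where x1: "base = P (\<sigma> 1, x1, \<eta> 1)" using dv1[of 1] p by (auto simp: dev_def)
  define \<delta> where "\<delta> r = P (r * real N, 0, 0)" for r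
  define \<gamma> where "\<gamma> r = P ((1 - r) * \<sigma> 1 + r * real N, x1, \<eta> 1)" for r
  define T where "T t = P (real N, \<omega> t, \<eta> t)" for t
  define T' where "T' t = P (real N, \<omega>' t, \<eta>' t)" for t
  have sides: "F (r, 0) = \<delta> r" "F (r, 1) = \<gamma> r" "F' (r, 0) = \<delta> r" "F' (r, 1) = \<gamma> r" if r: "r \<in> {0..1}" for r
    using F(4)[rule_format, OF r, of 0 0 0] F(4)[rule_format, OF r, of 1 x1 "\<eta> 1"]
      F'(4)[rule_format, OF r, of 0 0 0] F'(4)[rule_format, OF r, of 1 x1 "\<eta>' 1"] p q c0 d0 x1 e1
    by (auto simp: \<delta>_def \<gamma>_def)
  have paths: "path \<delta>" "path \<gamma>" "path T" "path T'"
    unfolding path_def \<delta>_def[abs_def] \<gamma>_def[abs_def] T_def[abs_def] T'_def[abs_def]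
    by (intro continuous_on_compose2[OF continuous_P[of UNIV]] continuous_intros c d; simp)+
  have in_X: "path_image \<delta> \<subseteq> X" "path_image \<gamma> \<subseteq> X" "path_image T \<subseteq> X" "path_image T' \<subseteq> X"
    by (auto simp: path_image_def \<delta>_def \<gamma>_def T_def T'_def)
  have sq: "homotopic_paths X (f +++ \<gamma>) (\<delta> +++ U)"
    if G: "continuous_on ({0..1} \<times> {0..1}) G" "G ` ({0..1} \<times> {0..1}) \<subseteq> X"
      "\<And>t. t \<in> {0..1} \<Longrightarrow> G (0, t) = f t" "\<And>t. t \<in> {0..1} \<Longrightarrow> G (1, t) = U t"
      "\<And>r. r \<in> {0..1} \<Longrightarrow> G (r, 0) = \<delta> r" "\<And>r. r \<in> {0..1} \<Longrightarrow> G (r, 1) = \<gamma> r"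
    for G :: "real \<times> real \<Rightarrow> nat \<Rightarrow> real" and f U
  proof -
    have h: "homotopic_paths X ((\<lambda>t. G (0, t)) +++ (\<lambda>r. G (r, 1))) ((\<lambda>r. G (r, 0)) +++ (\<lambda>t. G (1, t)))"
      by (rule homotopic_paths_square[OF G(1,2)])
    have "homotopic_paths X ((\<lambda>t. G (0, t)) +++ (\<lambda>r. G (r, 1))) (f +++ \<gamma>)"
      using homotopic_paths_imp_path[OF h] homotopic_paths_imp_subset[OF h]
      by (intro homotopic_paths_eq) (auto simp: joinpaths_def G)
    moreover have "homotopic_paths X ((\<lambda>r. G (r, 0)) +++ (\<lambda>t. G (1, t))) (\<delta> +++ U)"
      using homotopic_paths_imp_path[OF h] homotopic_paths_imp_subset[OF h]
      by (intro homotopic_paths_eq) (auto simp: joinpaths_def G)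
    ultimately show ?thesis using h by (meson homotopic_paths_sym homotopic_paths_trans)
  qed
  have 1: "homotopic_paths X (p +++ \<gamma>) (\<delta> +++ T)"
    using F by (intro sq[of F]) (auto simp: sides T_def)
  have 2: "homotopic_paths X (q +++ \<gamma>) (\<delta> +++ T')"
    using F' by (intro sq[of F']) (auto simp: sides T'_def)
  have "homotopic_paths UNIV (\<lambda>t. (real N, \<omega> t, \<eta> t)) (\<lambda>t. (real N, \<omega>' t, \<eta>' t))"
    by (rule homotopic_paths_linear)
      (auto simp: path_def pathstart_def pathfinish_def c0 d0 e1 intro!: continuous_intros c d)
  then have "homotopic_paths X (P \<circ> (\<lambda>t. (real N, \<omega> t, \<eta> t))) (P \<circ> (\<lambda>t. (real N, \<omega>' t, \<eta>' t)))"
    by (rule homotopic_paths_continuous_image) (auto intro: continuous_P)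
  then have "homotopic_paths X T T'" by (simp add: o_def T_def[abs_def] T'_def[abs_def])
  moreover have "homotopic_paths X \<delta> \<delta>" using paths in_X by simp
  moreover have "pathfinish \<delta> = pathstart T" by (simp add: pathfinish_def pathstart_def \<delta>_def T_def c0)
  ultimately have "homotopic_paths X (\<delta> +++ T) (\<delta> +++ T')" by (intro homotopic_paths_join)
  then have 3: "homotopic_paths X (p +++ \<gamma>) (q +++ \<gamma>)"
    using 1 2 by (meson homotopic_paths_sym homotopic_paths_trans)
  have "\<gamma> 0 = base" using x1 by (simp add: \<gamma>_def)
  then have "pathfinish p = pathstart \<gamma>" "pathfinish q = pathstart \<gamma>"
    using p q by (simp_all add: pathfinish_def pathstart_def)
  then show ?thesis
    using p q paths(2) in_X(2) by (intro homotopic_paths_cancel_right[OF 3]) blast+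
qed

section \<open>Identification of the fundamental group\<close>

abbreviation "Xt \<equiv> top_of_set X"

lemma loop_class_eq_iff:
  assumes "loop p" "loop q"
  shows "loop_class Xt base p = loop_class Xt base q \<longleftrightarrow> hol p = hol q"
proof -
  have cls: "loop_class Xt base f = {g. homotopic_paths X f g}" if "loop f" for f
    using that by (simp add: loop_class_def loop_homotopic_iff)
  show ?thesis
  proof
    assume eq: "loop_class Xt base p = loop_class Xt base q"
    have "q \<in> loop_class Xt base q" using assms by (simp add: cls)
    then have "q \<in> loop_class Xt base p" by (simp only: eq)
    then have "homotopic_paths X p q" unfolding cls[OF assms(1)] by simp
    then show "hol p = hol q" using assms hol_homotopic by blast
  next
    assume "hol p = hol q"
    then have "homotopic_paths X p q" using assms hol_inj by blast
    then have "homotopic_paths X p g \<longleftrightarrow> homotopic_paths X q g" for g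
      by (meson homotopic_paths_sym homotopic_paths_trans)
    then show "loop_class Xt base p = loop_class Xt base q" using assms by (simp add: cls)
  qed
qed

lemma mem_loop_class:
  assumes "loop p" "q \<in> loop_class Xt base p"
  shows "loop q" "hol q = hol p"
proof -
  have h: "homotopic_paths X p q" using assms by (simp add: loop_class_def loop_homotopic_iff)
  show "loop q"
    using homotopic_paths_imp_path[OF h] homotopic_paths_imp_subset[OF h]
      homotopic_paths_imp_pathstart[OF h] homotopic_paths_imp_pathfinish[OF h] assms(1)
    by (auto simp: pathstart_def pathfinish_def)
  show "hol q = hol p" using hol_homotopic[OF assms(1) h] by simp
qed

lemma loop_join:
  assumes "loop p" "loop q"
  shows "loop (p +++ q)"
proof (intro conjI)
  show "path (p +++ q)" using assms by (intro path_join_imp) (auto simp: pathfinish_def pathstart_def)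
  show "path_image (p +++ q) \<subseteq> X" using assms path_image_join_subset[of p q] by blast
qed (use assms in \<open>auto simp: joinpaths_def\<close>)

lemma fundamental_group_iso: "fundamental_group Xt base \<cong> bsz m"
proof -
  let ?\<pi> = "fundamental_group Xt base"
  define \<Psi> where "\<Psi> A = hol (SOME p. p \<in> A)" for A
  have carrier: "A \<in> carrier ?\<pi> \<longleftrightarrow> (\<exists>p. loop p \<and> A = loop_class Xt base p)" for A
    by (auto simp: fundamental_group_def loop_at_iff)
  have self: "p \<in> loop_class Xt base p" if "loop p" for p
    using that by (simp add: loop_class_def loop_homotopic_iff)
  have \<Psi>: "\<Psi> (loop_class Xt base p) = hol p" if "loop p" for p
    unfolding \<Psi>_def by (rule mem_loop_class(2)[OF that someI[of "\<lambda>q. q \<in> loop_class Xt base p", OF self[OF that]]])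
  have mult: "loop_class Xt base p \<otimes>\<^bsub>?\<pi>\<^esub> loop_class Xt base q = loop_class Xt base (p +++ q)"
    if p: "loop p" and q: "loop q" for p q
  proof -
    have "loop_class Xt base (loop_concat p' q') = loop_class Xt base (p +++ q)"
      if "p' \<in> loop_class Xt base p" "q' \<in> loop_class Xt base q" for p' q'
      using mem_loop_class[OF p that(1)] mem_loop_class[OF q that(2)] p q
      by (simp only: loop_concat_eq loop_class_eq_iff[OF loop_join loop_join] hol_join)
    then have "(\<Union>p'\<in>loop_class Xt base p. \<Union>q'\<in>loop_class Xt base q. loop_class Xt base (loop_concat p' q'))
        = loop_class Xt base (p +++ q)"
      using self[OF p] self[OF q] by blast
    then show ?thesis by (simp add: fundamental_group_def)
  qed
  have "\<Psi> \<in> hom ?\<pi> (bsz m)"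
  proof (rule homI)
    fix A assume "A \<in> carrier ?\<pi>"
    then obtain p where p: "loop p" "A = loop_class Xt base p" using carrier by blast
    then show "\<Psi> A \<in> carrier (bsz m)" using hol_closed[OF p(1)] \<Psi>[OF p(1)] by simp
    fix B assume "B \<in> carrier ?\<pi>"
    then obtain q where q: "loop q" "B = loop_class Xt base q" using carrier by blast
    show "\<Psi> (A \<otimes>\<^bsub>?\<pi>\<^esub> B) = \<Psi> A \<otimes>\<^bsub>bsz m\<^esub> \<Psi> B"
      unfolding p(2) q(2) mult[OF p(1) q(1)] \<Psi>[OF p(1)] \<Psi>[OF q(1)] \<Psi>[OF loop_join[OF p(1) q(1)]]
      by (rule hol_join[OF p(1) q(1)])
  qed
  moreover have "inj_on \<Psi> (carrier ?\<pi>)"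
  proof (rule inj_onI)
    fix A B assume "A \<in> carrier ?\<pi>" "B \<in> carrier ?\<pi>" and eq: "\<Psi> A = \<Psi> B"
    then obtain p q where pq: "loop p" "A = loop_class Xt base p" "loop q" "B = loop_class Xt base q"
      using carrier by metis
    then show "A = B" using eq \<Psi>[OF pq(1)] \<Psi>[OF pq(3)] loop_class_eq_iff[OF pq(1,3)] by simp
  qed
  moreover have "\<Psi> ` carrier ?\<pi> = carrier (bsz m)"
  proof
    show "\<Psi> ` carrier ?\<pi> \<subseteq> carrier (bsz m)" using \<open>\<Psi> \<in> hom ?\<pi> (bsz m)\<close> by (auto simp: hom_def)
    show "carrier (bsz m) \<subseteq> \<Psi> ` carrier ?\<pi>"
    proof
      fix g assume "g \<in> carrier (bsz m)"
      then obtain p where p: "loop p" "hol p = g" using hol_surj by blast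
      then have "g = \<Psi> (loop_class Xt base p)" "loop_class Xt base p \<in> carrier ?\<pi>"
        using \<Psi>[OF p(1)] carrier by auto
      then show "g \<in> \<Psi> ` carrier ?\<pi>" by blast
    qed
  qed
  ultimately have "\<Psi> \<in> iso ?\<pi> (bsz m)" by (simp add: iso_iff)
  then show ?thesis by (rule is_isoI)
qed

lemma path_connected_X: "path_connected_space Xt"
proof -
  have "path_connected X"
    unfolding X_def by (intro path_connected_continuous_image continuous_P path_connected_UNIV)
  then show ?thesis by simp
qed

end

section \<open>Higher homotopy groups\<close>

definition disc :: "nat \<Rightarrow> (nat \<Rightarrow> real) set" where
  "disc d = {z. (\<forall>i\<ge>d. z i = 0) \<and> (\<Sum>i<d. (z i)\<^sup>2) \<le> 1}"

definition cone :: "real \<times> (nat \<Rightarrow> real) \<Rightarrow> nat \<Rightarrow> real" where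
  "cone z i = fst z * snd z i"

lemma continuous_cone: "continuous_on S cone"
proof (rule continuous_on_coordinatewise_then_product)
  fix i
  have "continuous_on S (\<lambda>z::real \<times> (nat \<Rightarrow> real). snd z i)"
    by (rule continuous_on_compose2[OF continuous_on_coordinate[of UNIV i], of S snd])
      (auto intro!: continuous_on_snd continuous_on_id)
  then show "continuous_on S (\<lambda>z. cone z i)"
    unfolding cone_def by (intro continuous_intros)
qed

lemma cone_image: "cone ` ({0..1} \<times> sph k) = disc (Suc k)"
proof
  show "cone ` ({0..1} \<times> sph k) \<subseteq> disc (Suc k)"
  proof (rule image_subsetI)
    fix z assume "z \<in> {0..1::real} \<times> sph k"
    then obtain \<rho> u where z: "z = (\<rho>, u)" "0 \<le> \<rho>" "\<rho> \<le> 1" "u \<in> sph k" by auto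
    have "(\<Sum>i\<le>k. (\<rho> * u i)\<^sup>2) = \<rho>\<^sup>2"
      using z(4) by (simp add: power_mult_distrib sph_def flip: sum_distrib_left)
    moreover have "\<rho>\<^sup>2 \<le> 1" using z by (simp add: abs_square_le_1)
    ultimately show "cone z \<in> disc (Suc k)"
      using z by (auto simp: disc_def cone_def sph_def lessThan_Suc_atMost)
  qed
  show "disc (Suc k) \<subseteq> cone ` ({0..1} \<times> sph k)"
  proof
    fix z assume z: "z \<in> disc (Suc k)"
    define q where "q = (\<Sum>i\<le>k. (z i)\<^sup>2)"
    have q: "0 \<le> q" "q \<le> 1" using z by (auto simp: q_def disc_def lessThan_Suc_atMost sum_nonneg)
    show "z \<in> cone ` ({0..1} \<times> sph k)"
    proof (cases "q = 0")
      case True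
      then have "z i = 0" if "i \<le> k" for i
        using that sum_nonneg_eq_0_iff[of "{..k}" "\<lambda>i. (z i)\<^sup>2"] by (simp add: q_def)
      then have "z i = 0" for i using z by (cases "i \<le> k") (auto simp: disc_def)
      then have "z = cone (0, sphere_basepoint)" by (auto simp: cone_def)
      then show ?thesis using basepoint_in_sph by force
    next
      case False
      define u where "u i = z i / sqrt q" for i
      have "(\<Sum>i\<le>k. (u i)\<^sup>2) = q / q"
        using q by (simp add: u_def power_divide q_def flip: sum_divide_distrib)
      then have "u \<in> sph k" using False z by (simp add: sph_def u_def disc_def)
      moreover have "z = cone (sqrt q, u)" using False q by (auto simp: cone_def u_def)
      moreover have "sqrt q \<in> {0..1}" using q by simp
      ultimately show ?thesis by blast
    qed
  qed
qed

lemma compact_disc: "compact (disc d)"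
proof (cases d)
  case 0
  have "disc 0 = {\<lambda>_. 0}" by (auto simp: disc_def)
  then show ?thesis using 0 by simp
next
  case (Suc k)
  have "compact (cone ` ({0..1} \<times> sph k))"
    by (intro compact_continuous_image continuous_cone compact_Times compact_sph) auto
  then show ?thesis unfolding cone_image Suc .
qed

lemma cone_inj:
  assumes "0 \<le> \<rho>" "0 \<le> \<rho>'" "u \<in> sph k" "u' \<in> sph k" "cone (\<rho>, u) = cone (\<rho>', u')"
  shows "\<rho> = \<rho>' \<and> (\<rho> = 0 \<or> u = u')"
proof -
  have sq: "(\<Sum>i\<le>k. (cone (r, v) i)\<^sup>2) = r\<^sup>2" if "v \<in> sph k" for r v
    using that by (simp add: cone_def power_mult_distrib sph_def flip: sum_distrib_left)
  have "\<rho>\<^sup>2 = \<rho>'\<^sup>2" using sq[OF assms(3), of \<rho>] sq[OF assms(4), of \<rho>'] assms(5) by simp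
  then have \<rho>: "\<rho> = \<rho>'" using assms by (simp add: power2_eq_iff_nonneg)
  moreover have "u = u'" if "\<rho> \<noteq> 0"
  proof
    show "u i = u' i" for i using fun_cong[OF assms(5), of i] \<rho> that by (simp add: cone_def)
  qed
  ultimately show ?thesis by blast
qed

text \<open>A free null-homotopy extends the map to the disc, which can be contracted to the base point.\<close>

lemma free_null_homotopy_imp_based:
  fixes G :: "real \<times> (nat \<Rightarrow> real) \<Rightarrow> 'a::topological_space"
  assumes G: "continuous_on ({0..1} \<times> sph k) G" "G ` ({0..1} \<times> sph k) \<subseteq> S"
    and G0: "\<And>u. u \<in> sph k \<Longrightarrow> G (0, u) = f u" and G1: "\<And>u. u \<in> sph k \<Longrightarrow> G (1, u) = q"
  shows "homotopic_with (\<lambda>h. h sphere_basepoint = f sphere_basepoint) (nsphere k) (top_of_set S) f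
    (\<lambda>_. f sphere_basepoint)"
proof -
  let ?b = sphere_basepoint
  \<comment> \<open>Time is reversed so that the constant end of the homotopy lies at the centre of
    the cone.\<close>
  have "continuous_on ({0..1} \<times> sph k) (\<lambda>z. G (1 - fst z, snd z))"
  proof (rule continuous_on_compose2[OF G(1)])
    show "continuous_on ({0..1} \<times> sph k) (\<lambda>z::real \<times> (nat \<Rightarrow> real). (1 - fst z, snd z))"
      by (intro continuous_on_Pair continuous_on_diff continuous_on_mult continuous_on_const continuous_on_fst continuous_on_snd continuous_on_id)
  qed auto
  moreover have "G (1 - fst z, snd z) = G (1 - fst w, snd w)"
    if "z \<in> {0..1} \<times> sph k" "w \<in> {0..1} \<times> sph k" "cone z = cone w" for z w
  proof -
    have "fst z = fst w \<and> (fst z = 0 \<or> snd z = snd w)"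
      using that by (intro cone_inj[of _ _ _ k]) auto
    moreover have "snd z \<in> sph k" "snd w \<in> sph k" using that by auto
    ultimately show ?thesis using G1[of "snd z"] G1[of "snd w"] by auto
  qed
  moreover have "compact ({0..1::real} \<times> sph k)" by (intro compact_Times compact_sph) auto
  ultimately have "\<exists>g. continuous_on (cone ` ({0..1} \<times> sph k)) g \<and>
      (\<forall>z\<in>{0..1} \<times> sph k. g (cone z) = G (1 - fst z, snd z))"
    by (intro continuous_factor continuous_cone)
  then obtain g where g: "continuous_on (disc (Suc k)) g"
    "\<And>\<rho> u. \<rho> \<in> {0..1} \<Longrightarrow> u \<in> sph k \<Longrightarrow> g (cone (\<rho>, u)) = G (1 - \<rho>, u)"
    unfolding cone_image by auto
  have gS: "g ` disc (Suc k) \<subseteq> S"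
    unfolding cone_image[symmetric] using g(2) G(2) by auto
  have g_sph: "g u = f u" if "u \<in> sph k" for u
  proof -
    have "cone (1, u) = u" by (simp add: cone_def fun_eq_iff)
    then show ?thesis using g(2)[of 1 u] G0[OF that] that by simp
  qed
  \<comment> \<open>Straight-line contraction of the sphere inside the disc towards the base point;
    it leaves the base point fixed, which makes the resulting homotopy based.\<close>
  define c where "c z i = (1 - fst z) * snd z i + fst z * ?b i" for z :: "real \<times> (nat \<Rightarrow> real)" and i
  have c_cont: "continuous_on T c" for T
  proof (rule continuous_on_coordinatewise_then_product)
    fix i
    have "continuous_on T (\<lambda>z::real \<times> (nat \<Rightarrow> real). snd z i)"
      by (rule continuous_on_compose2[OF continuous_on_coordinate[of UNIV i], of T snd])
        (auto intro!: continuous_on_snd continuous_on_id)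
    then show "continuous_on T (\<lambda>z. c z i)" unfolding c_def by (intro continuous_intros)
  qed
  have c_disc: "c z \<in> disc (Suc k)" if zz: "z \<in> {0..1} \<times> sph k" for z
  proof -
    obtain r x where z: "z = (r, x)" "0 \<le> r" "r \<le> 1" "x \<in> sph k" using zz by auto
    have "(c z i)\<^sup>2 \<le> (1 - r) * (x i)\<^sup>2 + r * (?b i)\<^sup>2" for i
    proof -
      have "(1 - r) * (x i)\<^sup>2 + r * (?b i)\<^sup>2 - (c z i)\<^sup>2 = r * (1 - r) * (x i - ?b i)\<^sup>2"
        by (simp add: c_def z power2_eq_square algebra_simps)
      moreover have "r * (1 - r) * (x i - ?b i)\<^sup>2 \<ge> 0" using z by simp
      ultimately show ?thesis by linarith
    qed
    then have "(\<Sum>i\<le>k. (c z i)\<^sup>2) \<le> (\<Sum>i\<le>k. (1 - r) * (x i)\<^sup>2 + r * (?b i)\<^sup>2)" by (intro sum_mono)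
    also have "\<dots> = (1 - r) * (\<Sum>i\<le>k. (x i)\<^sup>2) + r * (\<Sum>i\<le>k. (?b i)\<^sup>2)"
      by (simp add: sum.distrib sum_distrib_left)
    also have "\<dots> = 1" using z basepoint_in_sph[of k] by (simp add: sph_def)
    finally have "(\<Sum>i\<le>k. (c z i)\<^sup>2) \<le> 1" .
    moreover have "c z i = 0" if "i \<ge> Suc k" for i
      using z that basepoint_in_sph[of k] by (simp add: c_def sph_def)
    ultimately show ?thesis by (simp add: disc_def lessThan_Suc_atMost)
  qed
  have prod: "prod_topology (top_of_set {0..1}) (nsphere k) = top_of_set ({0..1::real} \<times> sph k)"
    by (simp add: nsphere_eq prod_topology_subtopology_eu)
  show ?thesis
  proof (subst homotopic_with)
    show "(h ?b = f ?b) = (h' ?b = f ?b)" if "\<And>x. x \<in> topspace (nsphere k) \<Longrightarrow> h x = h' x" for h h'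
      using that[of ?b] by (simp add: nsphere_eq)
    show "\<exists>h. continuous_map (prod_topology (top_of_set {0..1::real}) (nsphere k)) (top_of_set S) h \<and>
        (\<forall>x\<in>topspace (nsphere k). h (0, x) = f x) \<and> (\<forall>x\<in>topspace (nsphere k). h (1, x) = f ?b) \<and>
        (\<forall>t\<in>{0..1}. h (t, ?b) = f ?b)"
    proof (intro exI conjI ballI)
      show "continuous_map (prod_topology (top_of_set {0..1::real}) (nsphere k)) (top_of_set S) (\<lambda>z. g (c z))"
        unfolding prod continuous_map_subtopology_eu
      proof
        show "continuous_on ({0..1} \<times> sph k) (\<lambda>z. g (c z))"
          by (rule continuous_on_compose2[OF g(1) c_cont]) (use c_disc in blast)
        show "(\<lambda>z. g (c z)) \<in> {0..1} \<times> sph k \<rightarrow> S" using gS c_disc by blast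
      qed
      fix x assume "x \<in> topspace (nsphere k)"
      then have x: "x \<in> sph k" by (simp add: nsphere_eq)
      have "c (0, x) = x" "c (1, x) = ?b" by (simp_all add: c_def fun_eq_iff)
      then show "g (c (0, x)) = f x" "g (c (1, x)) = f ?b" using g_sph x by simp_all
    next
      fix t :: real
      have "c (t, ?b) = ?b" by (simp add: c_def fun_eq_iff algebra_simps)
      then show "g (c (t, ?b)) = f ?b" using g_sph by simp
    qed
  qed
qed

context mapping_torus
begin

text \<open>The first half of the homotopy is the flow to level \<open>N\<close>, the second a
  linear contraction in the plane over that fibre. The base point moves and the limit is
  \<open>P (N, 0, 0)\<close>, so only a free null-homotopy arises directly.\<close>

lemma trivial_higher_homotopy:
  assumes "k \<ge> 2"
  shows "trivial_homotopy_group k (top_of_set X) (P (0, 0, 0))"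
  unfolding trivial_homotopy_group_def
proof (intro allI impI)
  fix f assume f: "continuous_map (nsphere k) (top_of_set X) f \<and> f sphere_basepoint = P (0, 0, 0)"
  then have fc: "continuous_on (sph k) f" and fX: "\<And>u. u \<in> sph k \<Longrightarrow> f u \<in> X"
    by (auto simp: nsphere_eq)
  have lift: "circle_lifting (sph k)"
  proof -
    have "Suc (Suc (k - 2)) = k" using assms by simp
    then show ?thesis using circle_lifting_sph[of "k - 2"] by metis
  qed
  obtain \<sigma> \<omega> \<eta> N where c: "continuous_on (sph k) \<sigma>" "continuous_on (sph k) \<omega>" "continuous_on (sph k) \<eta>"
    and dev: "\<forall>u\<in>sph k. \<sigma> u \<le> real N \<and> dev N (f u) (\<sigma> u, \<omega> u, \<eta> u)"
    using lift_exists[OF compact_sph lift basepoint_in_sph fc fX] f by blast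
  have dev': "\<sigma> u \<le> real N \<and> dev N (f u) (\<sigma> u, \<omega> u, \<eta> u)" if "u \<in> sph k" for u
    using dev that by blast
  obtain F where F: "continuous_on ({0..1} \<times> sph k) F" "F ` ({0..1} \<times> sph k) \<subseteq> X"
    "\<forall>u\<in>sph k. F (0, u) = f u \<and> F (1, u) = P (real N, \<omega> u, \<eta> u)"
    and "\<forall>r\<in>{0..1}. \<forall>u\<in>sph k. \<forall>x y. f u = P (\<sigma> u, x, y) \<longrightarrow> F (r, u) = P ((1 - r) * \<sigma> u + r * real N, x, y)"
    using flow_exists[of "sph k" f \<sigma> \<omega> \<eta> N] compact_sph fc c dev' by auto
  define G1 where "G1 z = F (2 * fst z, snd z)" for z
  define G2 where "G2 z = P (real N, (2 - 2 * fst z) * \<omega> (snd z), (2 - 2 * fst z) * \<eta> (snd z))" for z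
  define G where "G = (\<lambda>z. if fst z \<le> 1 / 2 then G1 z else G2 z)"
  have closed: "closed ({a..b::real} \<times> sph k)" for a b
    by (rule closed_Times[OF closed_atLeastAtMost compact_imp_closed[OF compact_sph]])
  have G1: "continuous_on ({0..1 / 2} \<times> sph k) G1"
    unfolding G1_def[abs_def]
  proof (rule continuous_on_compose2[OF F(1)])
    show "continuous_on ({0..1 / 2} \<times> sph k) (\<lambda>z::real \<times> (nat \<Rightarrow> real). (2 * fst z, snd z))"
      by (intro continuous_on_Pair continuous_on_mult continuous_on_const continuous_on_fst
          continuous_on_snd continuous_on_id)
  qed auto
  have snd_image: "snd ` ({1 / 2..1::real} \<times> sph k) \<subseteq> sph k" by auto
  have \<omega>\<eta>: "continuous_on ({1 / 2..1::real} \<times> sph k) (\<lambda>z. \<omega> (snd z))"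
    "continuous_on ({1 / 2..1::real} \<times> sph k) (\<lambda>z. \<eta> (snd z))"
    by (rule continuous_on_compose2[OF c(2) continuous_on_snd[OF continuous_on_id] snd_image],
        rule continuous_on_compose2[OF c(3) continuous_on_snd[OF continuous_on_id] snd_image])
  have G2: "continuous_on ({1 / 2..1} \<times> sph k) G2"
    unfolding G2_def[abs_def]
  proof (rule continuous_on_compose2[OF continuous_P[of UNIV]])
    show "continuous_on ({1 / 2..1} \<times> sph k)
        (\<lambda>z. (real N, (2 - 2 * fst z) * \<omega> (snd z), (2 - 2 * fst z) * \<eta> (snd z)))"
      by (intro continuous_on_Pair continuous_on_const continuous_on_mult continuous_on_diff
          continuous_on_fst continuous_on_id \<omega>\<eta>)
  qed simp
  have agree: "\<forall>z. z \<in> {0..1 / 2} \<times> sph k \<and> \<not> fst z \<le> 1 / 2 \<or> z \<in> {1 / 2..1} \<times> sph k \<and> fst z \<le> 1 / 2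
      \<longrightarrow> G1 z = G2 z"
  proof (intro allI impI)
    fix z :: "real \<times> (nat \<Rightarrow> real)"
    assume "z \<in> {0..1 / 2} \<times> sph k \<and> \<not> fst z \<le> 1 / 2 \<or> z \<in> {1 / 2..1} \<times> sph k \<and> fst z \<le> 1 / 2"
    then have z: "2 * fst z = 1" "snd z \<in> sph k" by auto
    then have "2 - 2 * fst z = 1" by simp
    then show "G1 z = G2 z" using F(3) z by (simp only: G1_def G2_def z(1)) simp
  qed
  have "continuous_on ({0..1/2} \<times> sph k \<union> {1/2..1} \<times> sph k) G"
    unfolding G_def by (rule continuous_on_cases[OF closed closed G1 G2 agree])
  moreover have "{0..1/2} \<times> sph k \<union> {1/2..1} \<times> sph k = {0..1::real} \<times> sph k" by auto
  ultimately have Gc: "continuous_on ({0..1} \<times> sph k) G" by simp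
  have "homotopic_with (\<lambda>h. h sphere_basepoint = f sphere_basepoint) (nsphere k) (top_of_set X) f
    (\<lambda>_. f sphere_basepoint)"
  proof (rule free_null_homotopy_imp_based[OF Gc])
    show "G ` ({0..1} \<times> sph k) \<subseteq> X"
    proof (rule image_subsetI)
      fix z assume "z \<in> {0..1::real} \<times> sph k"
      then have "fst z \<le> 1 / 2 \<Longrightarrow> (2 * fst z, snd z) \<in> {0..1} \<times> sph k" by auto
      then show "G z \<in> X" using F(2) unfolding G_def G1_def G2_def by (cases "fst z \<le> 1 / 2") auto
    qed
    show "G (0, u) = f u" if "u \<in> sph k" for u using F(3) that by (simp add: G_def G1_def)
    show "G (1, u) = P (real N, 0, 0)" for u by (simp add: G_def G2_def)
  qed
  then show "homotopic_with (\<lambda>h. h sphere_basepoint = P (0, 0, 0)) (nsphere k) (top_of_set X) f (\<lambda>x. P (0, 0, 0))"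
    using f by simp
qed

end

section \<open>The cell structure\<close>

text \<open>The sup norm on the first \<open>d\<close> coordinates; its unit ball is the cube, as
  that of \<open>nrm\<close> is the disc.\<close>

fun mx :: "nat \<Rightarrow> (nat \<Rightarrow> real) \<Rightarrow> real" where
  "mx 0 z = 0"
| "mx (Suc d) z = max (mx d z) \<bar>z d\<bar>"

definition nrm :: "nat \<Rightarrow> (nat \<Rightarrow> real) \<Rightarrow> real" where
  "nrm d z = sqrt (\<Sum>i<d. (z i)\<^sup>2)"

lemma mx_nonneg [simp]: "mx d z \<ge> 0"
  by (induction d) (auto simp: max_def)

lemma mx_ge: "i < d \<Longrightarrow> \<bar>z i\<bar> \<le> mx d z"
  by (induction d) (auto simp: less_Suc_eq max_def)

lemma mx_attained: "d > 0 \<Longrightarrow> \<exists>i<d. \<bar>z i\<bar> = mx d z"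
proof (induction d)
  case (Suc d)
  show ?case
  proof (cases "d = 0 \<or> \<bar>z d\<bar> \<ge> mx d z")
    case True
    then show ?thesis by (intro exI[of _ d]) auto
  next
    case False
    then obtain i where "i < d" "\<bar>z i\<bar> = mx d z" using Suc.IH by auto
    then show ?thesis using False by (intro exI[of _ i]) auto
  qed
qed simp

lemma mx_scale: "c \<ge> 0 \<Longrightarrow> mx d (\<lambda>i. c * z i) = c * mx d z"
  by (induction d) (auto simp: abs_mult max_mult_distrib_left)

lemma nrm_scale: "c \<ge> 0 \<Longrightarrow> nrm d (\<lambda>i. c * z i) = c * nrm d z"
  by (simp add: nrm_def power_mult_distrib real_sqrt_mult flip: sum_distrib_left)

lemma nrm_eq_0: "nrm d z = 0 \<Longrightarrow> i < d \<Longrightarrow> z i = 0"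
  using sum_nonneg_eq_0_iff[of "{..<d}" "\<lambda>i. (z i)\<^sup>2"] by (simp add: nrm_def)

lemma mx_eq_0: "mx d z = 0 \<Longrightarrow> i < d \<Longrightarrow> z i = 0"
  using mx_ge[of i d z] by simp

lemma nrm_nonneg [simp]: "nrm d z \<ge> 0"
  by (simp add: nrm_def sum_nonneg)

lemma nrm_eq_0_iff_mx: "nrm d z = 0 \<longleftrightarrow> mx d z = 0"
proof
  assume "nrm d z = 0"
  then show "mx d z = 0"
    using nrm_eq_0[of d z] mx_attained[of d z] by (cases "d = 0") auto
next
  assume "mx d z = 0"
  then have "(\<Sum>i<d. (z i)\<^sup>2) = 0" using mx_eq_0[of d z] by (intro sum.neutral) auto
  then show "nrm d z = 0" by (simp add: nrm_def)
qed

lemma continuous_mx: "continuous_on S (mx d)"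
proof (induction d)
  case (Suc d)
  then show ?case
    by (auto intro!: continuous_on_max continuous_on_rabs continuous_on_coordinate)
qed simp

lemma continuous_nrm: "continuous_on S (nrm d)"
  unfolding nrm_def[abs_def]
  by (intro continuous_on_real_sqrt continuous_on_sum continuous_on_power continuous_on_coordinate)

text \<open>Radial homeomorphism from the ball to the cube; at \<open>0\<close> the division by \<open>mx d 0 = 0\<close> gives \<open>0\<close>.\<close>

definition ball_cube :: "nat \<Rightarrow> (nat \<Rightarrow> real) \<Rightarrow> nat \<Rightarrow> real" where
  "ball_cube d z i = nrm d z / mx d z * z i"

lemma mx_ball_cube: "mx d (ball_cube d z) = nrm d z"
proof -
  have "mx d (ball_cube d z) = nrm d z / mx d z * mx d z"
    unfolding ball_cube_def[abs_def] by (rule mx_scale) simp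
  then show ?thesis using nrm_eq_0_iff_mx[of d z] by auto
qed

lemma abs_ball_cube_le: "i < d \<Longrightarrow> \<bar>ball_cube d z i\<bar> \<le> nrm d z"
  using mx_ge[of i d "ball_cube d z"] by (simp add: mx_ball_cube)

lemma continuous_ball_cube:
  assumes i: "i < d"
  shows "continuous_on S (\<lambda>z. ball_cube d z i)"
proof -
  have "isCont (\<lambda>z. ball_cube d z i) z" for z
  proof (cases "mx d z = 0")
    \<comment> \<open>Here \<open>z\<close> vanishes on the first \<open>d\<close> coordinates and
      the quotient formula breaks down; continuity follows by squeezing with
      \<open>nrm d\<close>.\<close>
    case True
    then have 0: "nrm d z = 0" using nrm_eq_0_iff_mx by blast
    have "isCont (nrm d) z" using continuous_nrm[of UNIV d] by (simp add: continuous_on_eq_continuous_at)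
    then have "(nrm d \<longlongrightarrow> 0) (at z)" using 0 by (simp add: isCont_def)
    then have "((\<lambda>z. ball_cube d z i) \<longlongrightarrow> 0) (at z)"
      by (rule Lim_null_comparison[rotated]) (simp add: abs_ball_cube_le[OF i])
    moreover have "ball_cube d z i = 0" using 0 by (simp add: ball_cube_def)
    ultimately show ?thesis by (simp add: isCont_def)
  next
    case False
    have "continuous_on UNIV (\<lambda>z::nat \<Rightarrow> real. z i)" by (rule continuous_on_coordinate)
    then have "isCont (nrm d) z" "isCont (mx d) z" "isCont (\<lambda>z::nat \<Rightarrow> real. z i) z"
      using continuous_nrm[of UNIV d] continuous_mx[of UNIV d]
      unfolding continuous_on_eq_continuous_at[OF open_UNIV] by blast+
    then show ?thesis unfolding ball_cube_def using False by (intro isCont_mult isCont_divide)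
  qed
  then show ?thesis by (simp add: continuous_at_imp_continuous_on)
qed

lemma ball_cube_inj:
  assumes eq: "\<And>i. i < d \<Longrightarrow> ball_cube d z i = ball_cube d z' i"
    and 0: "\<And>i. i \<ge> d \<Longrightarrow> z i = 0" "\<And>i. i \<ge> d \<Longrightarrow> z' i = 0"
  shows "z = z'"
proof -
  have eq': "ball_cube d z = ball_cube d z'"
  proof
    show "ball_cube d z i = ball_cube d z' i" for i
      using eq[of i] 0[of i] by (cases "i < d") (auto simp: ball_cube_def)
  qed
  have n: "nrm d z = nrm d z'" using mx_ball_cube[of d z] mx_ball_cube[of d z'] eq' by simp
  show ?thesis
  proof (cases "nrm d z = 0")
    case True
    then have "z i = z' i" for i
      using nrm_eq_0[of d z i] nrm_eq_0[of d z' i] n 0[of i] by (cases "i < d") auto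
    then show ?thesis by blast
  next
    case False
    then have pos: "mx d z \<noteq> 0" "mx d z' \<noteq> 0" using False n nrm_eq_0_iff_mx[of d z] nrm_eq_0_iff_mx[of d z'] by auto
    define t where "t = mx d z' / mx d z"
    have t: "t \<ge> 0" by (simp add: t_def)
    have z': "z' i = t * z i" for i
      using fun_cong[OF eq', of i] n False pos by (simp add: ball_cube_def t_def field_simps)
    have "z' = (\<lambda>i. t * z i)" using z' by (simp add: fun_eq_iff)
    then have "nrm d z' = t * nrm d z" using nrm_scale[OF t, of d z] by simp
    then have "t = 1" using n False by simp
    then show ?thesis using z' by (simp add: fun_eq_iff)
  qed
qed

lemma ball_cube_surj:
  assumes "\<And>i. i \<ge> d \<Longrightarrow> w i = 0"
  shows "\<exists>z. (\<forall>i\<ge>d. z i = 0) \<and> nrm d z = mx d w \<and> ball_cube d z = w"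
proof (cases "mx d w = 0")
  case True
  then have "w i = 0" for i using assms mx_eq_0[of d w i] by (cases "i < d") auto
  then have "w = (\<lambda>_. 0)" by auto
  then show ?thesis using True by (intro exI[of _ w]) (auto simp: ball_cube_def nrm_eq_0_iff_mx)
next
  case False
  then have n: "nrm d w \<noteq> 0" using nrm_eq_0_iff_mx by blast
  define c where "c = mx d w / nrm d w"
  have c: "c \<ge> 0" "c \<noteq> 0" using False n by (auto simp: c_def)
  have "nrm d (\<lambda>i. c * w i) = mx d w" using nrm_scale[OF c(1), of d w] n by (simp add: c_def)
  moreover have "ball_cube d (\<lambda>i. c * w i) = w"
    using c n False by (simp add: ball_cube_def[abs_def] nrm_scale mx_scale, simp add: c_def fun_eq_iff)
  ultimately show ?thesis using assms by (intro exI[of _ "\<lambda>i. c * w i"]) auto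
qed

text \<open>The map is closed on the compact set \<open>K\<close>, and restricting a closed map to a
  saturated subset keeps it closed; injectivity on \<open>U\<close> then gives an embedding.\<close>

lemma embedding_map_saturated:
  fixes f :: "'a::metric_space \<Rightarrow> 'b::metric_space"
  assumes K: "compact K" and f: "continuous_on K f" "f ` K \<subseteq> Y"
    and U: "U \<subseteq> K" "inj_on f U" "\<And>x. x \<in> K \<Longrightarrow> f x \<in> f ` U \<Longrightarrow> x \<in> U"
  shows "embedding_map (top_of_set U) (top_of_set Y) f"
proof -
  have cm: "continuous_map (top_of_set K) (top_of_set Y) f" using f by auto
  have "closed_map (top_of_set K) (top_of_set Y) f"
    using K cm by (intro continuous_imp_closed_map[OF cm])
      (auto simp: compact_space_subtopology Hausdorff_space_subtopology)
  moreover have "{x \<in> topspace (top_of_set K). f x \<in> f ` U} = U" using U by auto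
  ultimately have "closed_map (subtopology (top_of_set K) U) (subtopology (top_of_set Y) (f ` U)) f"
    by (rule closed_map_restriction)
  moreover have "subtopology (top_of_set K) U = top_of_set U"
    using U(1) by (simp add: subtopology_subtopology inf_absorb2)
  moreover have "f ` U \<subseteq> Y" using f U by blast
  then have "subtopology (top_of_set Y) (f ` U) = top_of_set (f ` U)"
    by (simp add: subtopology_subtopology inf_absorb2)
  ultimately have "closed_map (top_of_set U) (top_of_set (f ` U)) f" by simp
  moreover have "continuous_map (top_of_set U) (top_of_set (f ` U)) f"
    using continuous_on_subset[OF f(1) U(1)] by auto
  ultimately have "homeomorphic_map (top_of_set U) (top_of_set (f ` U)) f"
    using U(2) by (intro bijective_closed_imp_homeomorphic_map) auto
  then show ?thesis
    using \<open>subtopology (top_of_set Y) (f ` U) = top_of_set (f ` U)\<close>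
    by (simp add: embedding_map_def)
qed

text \<open>The rank of \<open>j\<close> in \<open>J\<close>; it assigns the coordinates of the disc
  of dimension \<open>card J\<close> to the members of \<open>J\<close>.\<close>

definition pos_in :: "nat set \<Rightarrow> nat \<Rightarrow> nat" where
  "pos_in J j = card {i \<in> J. i < j}"

lemma pos_in_bij:
  assumes "finite J"
  shows "bij_betw (pos_in J) J {..<card J}"
proof -
  have less: "pos_in J i < pos_in J j" if "i \<in> J" "i < j" for i j
    unfolding pos_in_def using that assms by (intro psubset_card_mono) auto
  have inj: "inj_on (pos_in J) J"
  proof (rule inj_onI)
    fix i j assume "i \<in> J" "j \<in> J" "pos_in J i = pos_in J j"
    then show "i = j" using less[of i j] less[of j i] by (cases i j rule: linorder_cases) auto
  qed
  moreover have "pos_in J ` J \<subseteq> {..<card J}"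
    unfolding pos_in_def using assms by (auto intro!: psubset_card_mono)
  ultimately have "pos_in J ` J = {..<card J}"
    by (intro card_subset_eq) (auto simp: card_image)
  then show ?thesis using inj by (simp add: bij_betw_def)
qed

lemma pos_in_surj: "finite J \<Longrightarrow> i < card J \<Longrightarrow> \<exists>j\<in>J. pos_in J j = i"
proof -
  assume "finite J" "i < card J"
  then have "i \<in> pos_in J ` J" using pos_in_bij[of J] by (simp add: bij_betw_def)
  then show ?thesis by blast
qed

section \<open>The cells of the mapping torus\<close>

context mapping_torus
begin

definition coord :: "nat set \<Rightarrow> (nat \<Rightarrow> real) \<Rightarrow> nat \<Rightarrow> real" where
  "coord J z j = (if j \<in> J then (ball_cube (card J) z (pos_in J j) + 1) / 2 else 0)"

definition cell_map :: "nat set \<Rightarrow> (nat \<Rightarrow> real) \<Rightarrow> nat \<Rightarrow> real" where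
  "cell_map J z = P (coord J z 0, coord J z 1, coord J z 2)"

text \<open>The image of an open face of the unit cube; \<open>J\<close> says which of the
  coordinates \<open>s\<close>, \<open>x\<close>, \<open>y\<close>, numbered 0, 1, 2, vary on
  it.\<close>

definition cell :: "nat set \<Rightarrow> (nat \<Rightarrow> real) set" where
  "cell J = {P (u 0, u 1, u 2) | u :: nat \<Rightarrow> real.
     \<forall>j\<in>{0, 1, 2}. if j \<in> J then 0 < u j \<and> u j < 1 else u j = 0}"

definition open_ball :: "nat \<Rightarrow> (nat \<Rightarrow> real) set" where
  "open_ball d = {z. (\<forall>i\<ge>d. z i = 0) \<and> nrm d z < 1}"

lemma disc_eq: "disc d = {z. (\<forall>i\<ge>d. z i = 0) \<and> nrm d z \<le> 1}"
  by (simp add: disc_def nrm_def)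

lemma closed_disc_eq: "closed_disc d = top_of_set (disc d)"
  by (simp add: closed_disc_def Euclidean_space_def subtopology_subtopology disc_def
      euclidean_product_topology Collect_conj_eq)

lemma open_disc_eq: "open_disc d = open_ball d"
  by (auto simp: open_disc_def open_ball_def topspace_Euclidean_space nrm_def)

lemma disc_boundary_eq: "disc_boundary d = {z. (\<forall>i\<ge>d. z i = 0) \<and> nrm d z = 1}"
  by (auto simp: disc_boundary_def topspace_Euclidean_space nrm_def)

lemma P_inj:
  assumes "0 \<le> s" "s < 1" "0 \<le> x" "x < 1" "0 \<le> y" "y < 1"
    "0 \<le> s'" "s' < 1" "0 \<le> x'" "x' < 1" "0 \<le> y'" "y' < 1" "P (s, x, y) = P (s', x', y')"
  shows "s = s' \<and> x = x' \<and> y = y'"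
proof -
  have "\<lfloor>s\<rfloor> = 0" "\<lfloor>s'\<rfloor> = 0" using assms by (simp_all add: floor_eq_iff)
  then have "s - s' \<in> \<int>" "x - x' \<in> \<int>" "y - y' \<in> \<int>" using assms(13) by (simp_all add: P_eq_iff)
  then show ?thesis using assms by (auto intro!: floor_eq_of_diff_Ints)
qed

lemma coord_bounds:
  assumes "finite J" "nrm (card J) z \<le> 1"
  shows "0 \<le> coord J z j" "coord J z j \<le> 1"
    "j \<in> J \<Longrightarrow> nrm (card J) z < 1 \<Longrightarrow> 0 < coord J z j"
    "j \<in> J \<Longrightarrow> nrm (card J) z < 1 \<Longrightarrow> coord J z j < 1"
proof -
  have "\<bar>ball_cube (card J) z (pos_in J j)\<bar> \<le> nrm (card J) z" if "j \<in> J"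
    using pos_in_bij[OF assms(1)] that by (intro abs_ball_cube_le) (auto simp: bij_betw_def)
  then show "0 \<le> coord J z j" "coord J z j \<le> 1"
    "j \<in> J \<Longrightarrow> nrm (card J) z < 1 \<Longrightarrow> 0 < coord J z j"
    "j \<in> J \<Longrightarrow> nrm (card J) z < 1 \<Longrightarrow> coord J z j < 1"
    using assms(2) by (auto simp: coord_def abs_le_iff)
qed

lemma coord_inj:
  assumes J: "J \<subseteq> {0, 1, 2}" and z: "z \<in> disc (card J)" "z' \<in> disc (card J)"
    and eq: "\<And>j. j \<in> {0, 1, 2} \<Longrightarrow> coord J z j = coord J z' j"
  shows "z = z'"
proof (rule ball_cube_inj[of "card J"])
  have fin: "finite J" using J finite_subset by blast
  fix i assume "i < card J"
  then obtain j where j: "j \<in> J" "pos_in J j = i" using pos_in_surj[OF fin] by blast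
  then show "ball_cube (card J) z i = ball_cube (card J) z' i"
    using eq[of j] J by (auto simp: coord_def)
qed (use z in \<open>auto simp: disc_def\<close>)

lemma cell_map_cell:
  assumes J: "J \<subseteq> {0, 1, 2}"
  shows "cell_map J ` open_ball (card J) = cell J"
proof
  have fin: "finite J" using J finite_subset by blast
  show "cell_map J ` open_ball (card J) \<subseteq> cell J"
  proof (rule image_subsetI)
    fix z assume "z \<in> open_ball (card J)"
    then have n: "nrm (card J) z \<le> 1" "nrm (card J) z < 1" by (auto simp: open_ball_def)
    show "cell_map J z \<in> cell J"
      unfolding cell_def cell_map_def
      using coord_bounds(3,4)[OF fin n(1) _ n(2)]
      by (intro CollectI exI[of _ "coord J z"] conjI refl ballI) (auto simp: coord_def)
  qed
  show "cell J \<subseteq> cell_map J ` open_ball (card J)"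
  proof
    fix p assume "p \<in> cell J"
    then obtain u :: "nat \<Rightarrow> real" where p: "p = P (u 0, u 1, u 2)"
      and u: "\<And>j. j \<in> {0, 1, 2} \<Longrightarrow> if j \<in> J then 0 < u j \<and> u j < 1 else u j = 0"
      unfolding cell_def by blast
    define w where "w i = (if i < card J then 2 * u (inv_into J (pos_in J) i) - 1 else 0)" for i
    have "pos_in J ` J = {..<card J}" using pos_in_bij[OF fin] by (simp add: bij_betw_def)
    then have inv: "inv_into J (pos_in J) i \<in> J" if "i < card J" for i
      using that by (intro inv_into_into) auto
    obtain z where z: "\<forall>i\<ge>card J. z i = 0" "nrm (card J) z = mx (card J) w" "ball_cube (card J) z = w"
      using ball_cube_surj[of "card J" w] by (auto simp: w_def)
    have "mx (card J) w < 1"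
    proof (cases "card J = 0")
      case False
      then obtain i where i: "i < card J" "\<bar>w i\<bar> = mx (card J) w" using mx_attained by blast
      have "0 < u (inv_into J (pos_in J) i)" "u (inv_into J (pos_in J) i) < 1"
        using u[of "inv_into J (pos_in J) i"] inv[OF i(1)] J by auto
      then show ?thesis using i by (simp add: w_def abs_less_iff flip: i(2))
    qed simp
    then have "z \<in> open_ball (card J)" using z by (simp add: open_ball_def)
    moreover have "coord J z j = u j" if "j \<in> {0, 1, 2}" for j
    proof (cases "j \<in> J")
      case True
      have "pos_in J j < card J" "inv_into J (pos_in J) (pos_in J j) = j"
        using True pos_in_bij[OF fin] by (auto simp: bij_betw_def)
      then show ?thesis using True by (simp add: coord_def z w_def)
    qed (use u[OF that] in \<open>simp add: coord_def\<close>)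
    then have "cell_map J z = p" by (simp add: cell_map_def p)
    ultimately show "p \<in> cell_map J ` open_ball (card J)" by blast
  qed
qed

lemma cell_disjoint:
  assumes "J \<subseteq> {0, 1, 2}" "J' \<subseteq> {0, 1, 2}" "p \<in> cell J" "p \<in> cell J'"
  shows "J = J'"
proof -
  obtain u u' :: "nat \<Rightarrow> real" where p: "p = P (u 0, u 1, u 2)" "p = P (u' 0, u' 1, u' 2)"
    and u: "\<And>j. j \<in> {0, 1, 2} \<Longrightarrow> if j \<in> J then 0 < u j \<and> u j < 1 else u j = 0"
    and u': "\<And>j. j \<in> {0, 1, 2} \<Longrightarrow> if j \<in> J' then 0 < u' j \<and> u' j < 1 else u' j = 0"
    using assms(3,4) unfolding cell_def by blast
  have b: "0 \<le> u j \<and> u j < 1" "0 \<le> u' j \<and> u' j < 1" if "j \<in> {0, 1, 2}" for j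
    using u[OF that] u'[OF that] by (auto split: if_splits)
  have "u 0 = u' 0 \<and> u 1 = u' 1 \<and> u 2 = u' 2"
    by (rule P_inj) (use b p in auto)
  then have "u j = u' j" if "j \<in> {0, 1, 2}" for j using that by auto
  then have "j \<in> J \<longleftrightarrow> j \<in> J'" if "j \<in> {0, 1, 2}" for j
    using u[OF that] u'[OF that] that by (auto split: if_splits)
  then show ?thesis using assms by blast
qed

lemma continuous_cell_map:
  assumes J: "J \<subseteq> {0, 1, 2}"
  shows "continuous_on S (cell_map J)"
proof -
  have fin: "finite J" using J finite_subset by blast
  have "continuous_on S (\<lambda>z. coord J z j)" for j
  proof (cases "j \<in> J")
    case True
    then have "pos_in J j < card J" using pos_in_bij[OF fin] by (auto simp: bij_betw_def)
    then show ?thesis using True by (auto simp: coord_def intro!: continuous_intros continuous_ball_cube)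
  qed (simp add: coord_def)
  then show ?thesis
    unfolding cell_map_def[abs_def]
    by (intro continuous_on_compose2[OF continuous_P[of UNIV]] continuous_on_Pair) auto
qed

lemma cell_of_cube:
  fixes u :: "nat \<Rightarrow> real"
  assumes "\<And>j. j \<in> {0, 1, 2} \<Longrightarrow> 0 \<le> u j \<and> u j < 1"
  shows "P (u 0, u 1, u 2) \<in> cell {j \<in> {0, 1, 2}. u j \<noteq> 0}"
  unfolding cell_def using assms by (intro CollectI exI[of _ u]) (auto simp: order_less_le)

lemma cell_cover: "(\<Union>J\<in>Pow {0, 1, 2}. cell J) = X"
proof
  show "(\<Union>J\<in>Pow {0, 1, 2}. cell J) \<subseteq> X" by (auto simp: cell_def)
  show "X \<subseteq> (\<Union>J\<in>Pow {0, 1, 2}. cell J)"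
  proof
    fix p assume "p \<in> X"
    then obtain s x y where p: "p = P (s, x, y)" by (auto simp: X_def)
    define u where "u j = (if j = 0 then frac s else if j = 1 then frac (M powi \<lfloor>s\<rfloor> * x) else frac y)" for j :: nat
    have "p = P (u 0, u 1, u 2)" unfolding p u_def using P_frac[of s x y] by simp
    moreover have "P (u 0, u 1, u 2) \<in> cell {j \<in> {0, 1, 2}. u j \<noteq> 0}"
      by (rule cell_of_cube) (simp add: u_def frac_lt_1)
    ultimately have "p \<in> cell {j \<in> {0, 1, 2}. u j \<noteq> 0}" by (simp only:)
    then show "p \<in> (\<Union>J\<in>Pow {0, 1, 2}. cell J)" by (rule UN_I[rotated]) blast
  qed
qed

text \<open>On the boundary some coordinate of \<open>J\<close> is 0 or 1. Reduction to the
  half-open cube by \<open>P_frac\<close> makes a coordinate vanish and makes none outside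
  \<open>J\<close> nonzero.\<close>

lemma cell_map_boundary:
  assumes J: "J \<subseteq> {0, 1, 2}" and z: "z \<in> disc_boundary (card J)"
  shows "\<exists>J'. J' \<subseteq> {0, 1, 2} \<and> card J' < card J \<and> cell_map J z \<in> cell J'"
proof -
  have fin: "finite J" using J finite_subset by blast
  have n: "nrm (card J) z = 1" using z by (simp add: disc_boundary_eq)
  then have "card J > 0" by (cases "card J") (auto simp: nrm_def)
  then obtain i where i: "i < card J" "\<bar>ball_cube (card J) z i\<bar> = 1"
    using mx_attained[of "card J" "ball_cube (card J) z"] mx_ball_cube[of "card J" z] n by auto
  then obtain j0 where j0: "j0 \<in> J" "pos_in J j0 = i" using pos_in_surj[OF fin] by blast
  define u where "u = coord J z"
  have u01: "0 \<le> u j" "u j \<le> 1" for j using coord_bounds(1,2)[OF fin, of z j] n by (auto simp: u_def)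
  have u_out: "u j = 0" if "j \<notin> J" for j using that by (simp add: u_def coord_def)
  have u_j0: "u j0 = 0 \<or> u j0 = 1" using i j0 by (auto simp: u_def coord_def abs_if split: if_splits)
  define v where "v j = (if j = 0 then frac (u 0) else if j = 1 then frac (M powi \<lfloor>u 0\<rfloor> * u 1) else frac (u 2))" for j :: nat
  have v_eq: "cell_map J z = P (v 0, v 1, v 2)"
    unfolding cell_map_def v_def u_def using P_frac[of "coord J z 0" "coord J z 1" "coord J z 2"] by simp
  let ?J' = "{j \<in> {0, 1, 2}. v j \<noteq> 0}"
  have "cell_map J z \<in> cell ?J'"
    unfolding v_eq by (rule cell_of_cube) (simp add: v_def frac_lt_1)
  moreover have "?J' \<subset> J"
  proof -
    have frac01: "frac r = 0" if "r = 0 \<or> r = 1" for r :: real using that by (auto simp: frac_def)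
    have sub: "v j = 0" if "j \<in> {0, 1, 2}" "j \<notin> J" for j
      using that u_out[of j] by (auto simp: v_def frac01)
    have "\<exists>j\<in>J. v j = 0"
    \<comment> \<open>At \<open>s = 1\<close> the gluing multiplies \<open>x\<close> by
      \<open>m\<close>, and a vanishing coordinate that is certain to result is \<open>s\<close>
      itself.\<close>
    proof (cases "u 0 = 1")
      case True
      then have "0 \<in> J" using u_out[of 0] by auto
      moreover have "v 0 = 0" using True by (simp add: v_def frac01)
      ultimately show ?thesis by blast
    next
      case False
      then have "\<lfloor>u 0\<rfloor> = 0" using u01[of 0] by (simp add: floor_eq_iff)
      then have "v j0 = 0" using u_j0 j0 J by (auto simp: v_def frac01)
      then show ?thesis using j0 by blast
    qed
    then show ?thesis using sub J by blast
  qed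
  then have "card ?J' < card J" using fin by (rule psubset_card_mono[rotated])
  ultimately show ?thesis by (intro exI[of _ ?J']) auto
qed

lemma CW: "finite_CW_complex (top_of_set X)"
proof -
  let ?S = "Pow {0, 1, 2 :: nat}"
  \<comment> \<open>The eight subsets are coded as natural numbers, the index type that
    \<open>finite_CW_complex\<close> asks for.\<close>
  define I where "I = set_encode ` ?S"
  define d where "d i = card (set_decode i)" for i
  define \<Phi> where "\<Phi> i = cell_map (set_decode i)" for i
  have dec: "set_decode i \<subseteq> {0, 1, 2}" if "i \<in> I" for i
    using that finite_subset[of _ "{0, 1, 2 :: nat}"] by (auto simp: I_def set_encode_inverse)
  have enc: "set_encode J \<in> I" "set_decode (set_encode J) = J" if "J \<subseteq> {0, 1, 2}" for J
    using that finite_subset[of J "{0, 1, 2}"] by (auto simp: I_def set_encode_inverse)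
  have fin: "finite I" by (simp add: I_def)
  have cells: "\<Phi> i ` open_disc (d i) = cell (set_decode i)" if "i \<in> I" for i
    using cell_map_cell[OF dec[OF that]] by (simp add: \<Phi>_def d_def open_disc_eq)
  have cont: "continuous_on (disc (d i)) (\<Phi> i)" if "i \<in> I" for i
    unfolding \<Phi>_def by (rule continuous_cell_map[OF dec[OF that]])
  have into: "\<Phi> i z \<in> X" for i z by (simp add: \<Phi>_def cell_map_def)
  have sub: "open_ball k \<subseteq> disc k" for k by (auto simp: open_ball_def disc_eq)
  have disc_cases: "z \<in> open_ball k \<or> z \<in> disc_boundary k" if "z \<in> disc k" for z k
    using that by (auto simp: open_ball_def disc_eq disc_boundary_eq)
  have boundary: "\<exists>j\<in>I. d j < d i \<and> \<Phi> i z \<in> \<Phi> j ` open_disc (d j)"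
    if i: "i \<in> I" and z: "z \<in> disc_boundary (d i)" for i z
  proof -
    obtain J' where J': "J' \<subseteq> {0, 1, 2}" "card J' < d i" "\<Phi> i z \<in> cell J'"
      using cell_map_boundary[OF dec[OF i] z[unfolded d_def]] unfolding d_def \<Phi>_def by blast
    then show ?thesis
      using enc[OF J'(1)] cells[OF enc(1)[OF J'(1)]]
      by (intro bexI[of _ "set_encode J'"]) (auto simp: d_def)
  qed
  have disj: "i = j" if ij: "i \<in> I" "j \<in> I" and p: "p \<in> \<Phi> i ` open_disc (d i)" "p \<in> \<Phi> j ` open_disc (d j)" for i j p
  proof -
    have "set_decode i = set_decode j"
      using p unfolding cells[OF ij(1)] cells[OF ij(2)] by (rule cell_disjoint[OF dec[OF ij(1)] dec[OF ij(2)]])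
    then show ?thesis by (metis set_decode_inverse)
  qed
  have emb: "embedding_map (subtopology (closed_disc (d i)) (open_disc (d i))) (top_of_set X) (\<Phi> i)" if i: "i \<in> I" for i
  proof -
    have "embedding_map (top_of_set (open_ball (d i))) (top_of_set X) (\<Phi> i)"
    proof (rule embedding_map_saturated[OF compact_disc cont[OF i] _ sub])
      show "\<Phi> i ` disc (d i) \<subseteq> X" using into by blast
      show "inj_on (\<Phi> i) (open_ball (d i))"
      proof (rule inj_onI)
        fix z z' assume z: "z \<in> open_ball (d i)" "z' \<in> open_ball (d i)" and eq: "\<Phi> i z = \<Phi> i z'"
        let ?J = "set_decode i"
        have n: "nrm (card ?J) z \<le> 1" "nrm (card ?J) z < 1" "nrm (card ?J) z' \<le> 1" "nrm (card ?J) z' < 1"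
          using z by (auto simp: open_ball_def d_def)
        have b: "0 \<le> coord ?J z j \<and> coord ?J z j < 1" "0 \<le> coord ?J z' j \<and> coord ?J z' j < 1" for j
          using coord_bounds(1,4)[OF finite_set_decode n(1), of j] coord_bounds(1,4)[OF finite_set_decode n(3), of j] n
          by (cases "j \<in> ?J"; simp add: coord_def)+
        have "coord ?J z 0 = coord ?J z' 0 \<and> coord ?J z 1 = coord ?J z' 1 \<and> coord ?J z 2 = coord ?J z' 2"
          by (rule P_inj) (use b eq in \<open>auto simp: \<Phi>_def cell_map_def\<close>)
        then have "coord ?J z j = coord ?J z' j" if "j \<in> {0, 1, 2}" for j using that by auto
        then show "z = z'"
          using z sub by (intro coord_inj[OF dec[OF i]]) (auto simp: d_def)
      qed
      \<comment> \<open>Boundary points land in cells of lower dimension, which are disjoint from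
        this open cell; so the open ball is saturated.\<close>
      show "z \<in> open_ball (d i)" if "z \<in> disc (d i)" "\<Phi> i z \<in> \<Phi> i ` open_ball (d i)" for z
      proof (rule ccontr)
        assume "z \<notin> open_ball (d i)"
        then have "z \<in> disc_boundary (d i)" using disc_cases[OF that(1)] by blast
        then obtain j where "j \<in> I" "d j < d i" "\<Phi> i z \<in> \<Phi> j ` open_disc (d j)" using boundary[OF i] by blast
        then show False using disj[OF i, of j "\<Phi> i z"] that(2) by (simp add: open_disc_eq)
      qed
    qed
    then show ?thesis
      using sub[of "d i"] by (simp add: closed_disc_eq open_disc_eq subtopology_subtopology inf_absorb2)
  qed
  have weak: "closedin (top_of_set X) A \<longleftrightarrow>
      (\<forall>i\<in>I. closedin (closed_disc (d i)) {z \<in> topspace (closed_disc (d i)). \<Phi> i z \<in> A})"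
    if A: "A \<subseteq> X" for A
  proof
    assume A: "closedin (top_of_set X) A"
    show "\<forall>i\<in>I. closedin (closed_disc (d i)) {z \<in> topspace (closed_disc (d i)). \<Phi> i z \<in> A}"
    proof
      fix i assume "i \<in> I"
      then have "continuous_map (closed_disc (d i)) (top_of_set X) (\<Phi> i)"
        using cont into by (auto simp: closed_disc_eq)
      then show "closedin (closed_disc (d i)) {z \<in> topspace (closed_disc (d i)). \<Phi> i z \<in> A}"
        by (rule closedin_continuous_map_preimage) (rule A)
    qed
  next
    assume *: "\<forall>i\<in>I. closedin (closed_disc (d i)) {z \<in> topspace (closed_disc (d i)). \<Phi> i z \<in> A}"
    define B where "B i = {z \<in> disc (d i). \<Phi> i z \<in> A}" for i
    \<comment> \<open>With finitely many cells the weak topology is automatic: \<open>A\<close> is a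
      finite union of compact sets.\<close>
    have "compact (\<Phi> i ` B i)" if i: "i \<in> I" for i
    proof -
      have "closedin (top_of_set (disc (d i))) (B i)" using * i by (simp add: closed_disc_eq B_def)
      then have "compact (B i)" by (rule closedin_compact[OF compact_disc])
      moreover have "continuous_on (B i) (\<Phi> i)"
        by (rule continuous_on_subset[OF cont[OF i]]) (auto simp: B_def)
      ultimately show ?thesis by (intro compact_continuous_image)
    qed
    then have "compact (\<Union>i\<in>I. \<Phi> i ` B i)" using fin by (intro compact_UN) auto
    moreover have "(\<Union>i\<in>I. \<Phi> i ` B i) = A"
    proof
      show "(\<Union>i\<in>I. \<Phi> i ` B i) \<subseteq> A" by (auto simp: B_def)
      show "A \<subseteq> (\<Union>i\<in>I. \<Phi> i ` B i)"
      proof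
        fix p assume p: "p \<in> A"
        then have "p \<in> X" using A by blast
        then have "p \<in> (\<Union>J\<in>?S. cell J)" by (simp only: cell_cover)
        then obtain J where J: "J \<subseteq> {0, 1, 2}" "p \<in> cell J" by blast
        then have "p \<in> cell_map J ` open_ball (card J)" by (simp only: cell_map_cell)
        then obtain z where z: "z \<in> open_ball (card J)" "p = cell_map J z" by blast
        then have "z \<in> B (set_encode J)" "p = \<Phi> (set_encode J) z"
          using p z subsetD[OF sub z(1)] by (simp_all add: B_def d_def \<Phi>_def enc(2)[OF J(1)])
        then show "p \<in> (\<Union>i\<in>I. \<Phi> i ` B i)" using enc(1)[OF J(1)] by blast
      qed
    qed
    ultimately have "closed A" by (simp add: compact_imp_closed)
    then show "closedin (top_of_set X) A" using A by (simp add: closed_subset)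
  qed
  have cover: "(\<Union>i\<in>I. \<Phi> i ` open_disc (d i)) = X"
  proof -
    have "(\<Union>i\<in>I. \<Phi> i ` open_disc (d i)) = (\<Union>i\<in>I. cell (set_decode i))" using cells by simp
    also have "\<dots> = (\<Union>J\<in>?S. cell J)" unfolding I_def using enc(2) by simp
    finally show ?thesis by (simp only: cell_cover)
  qed
  have "CW_structure (top_of_set X) I d \<Phi>"
    unfolding CW_structure_def
  proof (intro conjI ballI allI impI)
    show "Hausdorff_space (top_of_set X)" by (simp add: Hausdorff_space_subtopology)
    show "continuous_map (closed_disc (d i)) (top_of_set X) (\<Phi> i)" if "i \<in> I" for i
      using cont[OF that] into by (auto simp: closed_disc_eq)
    show "disjoint_family_on (\<lambda>i. \<Phi> i ` open_disc (d i)) I"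
      unfolding disjoint_family_on_def using disj by blast
    show "(\<Union>i\<in>I. \<Phi> i ` open_disc (d i)) = topspace (top_of_set X)" using cover by simp
    show "\<exists>J\<subseteq>I. finite J \<and> (\<forall>j\<in>J. d j < d i) \<and>
        \<Phi> i ` disc_boundary (d i) \<subseteq> (\<Union>j\<in>J. \<Phi> j ` open_disc (d j))" if "i \<in> I" for i
    proof (intro exI[of _ "{j \<in> I. d j < d i}"] conjI ballI image_subsetI)
      fix z assume "z \<in> disc_boundary (d i)"
      from boundary[OF that this] obtain j where "j \<in> I" "d j < d i" "\<Phi> i z \<in> \<Phi> j ` open_disc (d j)"
        by (elim bexE conjE)
      then show "\<Phi> i z \<in> (\<Union>j\<in>{j \<in> I. d j < d i}. \<Phi> j ` open_disc (d j))"
        by (intro UN_I[of j]) simp_all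
    qed (use fin in auto)
    show "closedin (top_of_set X) A \<longleftrightarrow>
        (\<forall>i\<in>I. closedin (closed_disc (d i)) {x \<in> topspace (closed_disc (d i)). \<Phi> i x \<in> A})"
      if "A \<subseteq> topspace (top_of_set X)" for A
      by (rule weak) (use that in simp)
  qed (rule emb)
  then show ?thesis using fin unfolding finite_CW_complex_def
    by (intro exI[of _ I] exI[of _ d] exI[of _ \<Phi>] conjI)
qed

end

section \<open>Isomorphic copies\<close>

text \<open>Transport of structure along an enumeration of the carrier, as the final group is to
  live on natural numbers.\<close>

lemma (in group) exists_nat_copy:
  assumes "countable (carrier G)"
  shows "\<exists>(H :: nat monoid) f. group H \<and> f \<in> iso G H"
proof -
  define f where "f = to_nat_on (carrier G)"
  have inj: "inj_on f (carrier G)" unfolding f_def by (rule inj_on_to_nat_on[OF assms])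
  define H where "H = \<lparr>carrier = f ` carrier G,
    monoid.mult = \<lambda>x y. f (inv_into (carrier G) f x \<otimes> inv_into (carrier G) f y), one = f \<one>\<rparr>"
  have mult: "f x \<otimes>\<^bsub>H\<^esub> f y = f (x \<otimes> y)" if "x \<in> carrier G" "y \<in> carrier G" for x y
    using that inj by (simp add: H_def)
  have carrier: "carrier H = f ` carrier G" and one: "\<one>\<^bsub>H\<^esub> = f \<one>" by (simp_all add: H_def)
  have "group H"
  proof (rule groupI)
    fix x assume "x \<in> carrier H"
    then obtain x' where x: "x' \<in> carrier G" "x = f x'" by (auto simp: carrier)
    show "\<one>\<^bsub>H\<^esub> \<otimes>\<^bsub>H\<^esub> x = x" using x by (simp add: one mult)
    show "\<exists>y\<in>carrier H. y \<otimes>\<^bsub>H\<^esub> x = \<one>\<^bsub>H\<^esub>"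
      using x by (intro bexI[of _ "f (inv x')"]) (simp_all add: one mult carrier)
    fix y assume "y \<in> carrier H"
    then obtain y' where y: "y' \<in> carrier G" "y = f y'" by (auto simp: carrier)
    show "x \<otimes>\<^bsub>H\<^esub> y \<in> carrier H" using x y by (simp add: mult carrier)
    fix z assume "z \<in> carrier H"
    then obtain z' where z: "z' \<in> carrier G" "z = f z'" by (auto simp: carrier)
    show "x \<otimes>\<^bsub>H\<^esub> y \<otimes>\<^bsub>H\<^esub> z = x \<otimes>\<^bsub>H\<^esub> (y \<otimes>\<^bsub>H\<^esub> z)" using x y z by (simp add: mult m_assoc)
  qed (simp add: one carrier)
  moreover have "f \<in> iso G H"
    using inj by (auto simp: iso_iff carrier mult intro!: homI)
  ultimately show ?thesis by blast
qed

lemma (in group_hom) ordered_group_vimage: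
  assumes "ordered_group H lt" "inj_on h (carrier G)"
  shows "ordered_group G (\<lambda>x y. lt (h x) (h y))"
proof -
  interpret O: ordered_group H lt by fact
  show ?thesis
  proof unfold_locales
    fix x y z assume c: "x \<in> carrier G" "y \<in> carrier G" "z \<in> carrier G"
    then have h: "h x \<in> carrier H" "h y \<in> carrier H" "h z \<in> carrier H" by simp_all
    show "lt (h x) (h z)" if "lt (h x) (h y)" "lt (h y) (h z)"
      using O.less_trans[OF h that] .
    show "lt (h (z \<otimes> x)) (h (z \<otimes> y))" if "lt (h x) (h y)"
      using O.left_mono[OF h that] c by simp
    show "lt (h (x \<otimes> z)) (h (y \<otimes> z))" if "lt (h x) (h y)"
      using O.right_mono[OF h that] c by simp
  next
    fix x y assume c: "x \<in> carrier G" "y \<in> carrier G" "x \<noteq> y"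
    then have "h x \<noteq> h y" using inj_onD[OF assms(2)] by blast
    then show "lt (h x) (h y) \<or> lt (h y) (h x)" using O.total[of "h x" "h y"] c by simp
  qed (simp add: O.irrefl)
qed

section \<open>Residues modulo \<open>m - 1\<close>\<close>

text \<open>The ring homomorphism from Z[1/(n+1)] to Z/n, well-defined since n + 1 is congruent to
  1. It reads off the exponent of \<open>a\<close> modulo \<open>n\<close>.\<close>

definition residue :: "nat \<Rightarrow> real \<Rightarrow> int" where
  "residue n q = (THE r. \<exists>i j. q * real (Suc n) ^ i = of_int j \<and> r = j mod int n)"

lemma mult_power_Suc_mod: "(j * int (Suc n) ^ k) mod int n = j mod int n"
proof -
  have "int (Suc n) mod int n = 1 mod int n" by simp
  then have "int (Suc n) ^ k mod int n = 1 ^ k mod int n" by (metis power_mod)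
  then have "(j * int (Suc n) ^ k) mod int n = (j * 1) mod int n" by (intro mod_mult_cong) simp_all
  then show ?thesis by simp
qed

lemma residue_eq:
  assumes "q * real (Suc n) ^ i = of_int j"
  shows "residue n q = j mod int n"
  unfolding residue_def
proof (rule the_equality)
  show "\<exists>i j'. q * real (Suc n) ^ i = of_int j' \<and> j mod int n = j' mod int n" using assms by blast
next
  fix r assume "\<exists>i j. q * real (Suc n) ^ i = of_int j \<and> r = j mod int n"
  then obtain i' j' where j': "q * real (Suc n) ^ i' = of_int j'" "r = j' mod int n" by blast
  have "of_int (j * int (Suc n) ^ i') = q * real (Suc n) ^ i * real (Suc n) ^ i'"
    using assms by simp
  also have "\<dots> = q * real (Suc n) ^ i' * real (Suc n) ^ i" by (simp only: mult_ac)
  also have "\<dots> = of_int (j' * int (Suc n) ^ i)" using j'(1) by simp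
  finally have "j * int (Suc n) ^ i' = j' * int (Suc n) ^ i" by (simp only: of_int_eq_iff)
  then show "r = j mod int n" using mult_power_Suc_mod[of j n i'] mult_power_Suc_mod[of j' n i] j'(2) by metis
qed

text \<open>The action of \<open>t\<close> becomes trivial modulo \<open>n\<close>, so
  \<open>residue\<close> of the first coordinate is a homomorphism on the whole semidirect
  product.\<close>

lemma residue_add:
  assumes "q \<in> localized_ints (Suc n)" "q' \<in> localized_ints (Suc n)"
  shows "residue n (q + q' * real (Suc n) powi (- e)) = (residue n q + residue n q') mod int n"
proof -
  define M where "M = real (Suc n)"
  obtain i i' j j' where ij: "q * M ^ i = of_int j" "q' * M ^ i' = of_int j'"
    using assms by (auto simp: localized_ints_def Ints_def M_def)
  have M: "M \<noteq> 0" and Mk: "of_int (int (Suc n) ^ k) = M ^ k" for k by (simp_all add: M_def)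
  \<comment> \<open>\<open>I\<close> clears the denominators of both summands: the surplus exponent
    is \<open>a\<close> for the first and, after the shift by \<open>- e\<close>, \<open>b\<close>
    for the second. Both are natural numbers thanks to the term
    \<open>\<bar>e\<bar>\<close>.\<close>
  define a where "a = i' + nat \<bar>e\<bar>"
  define b where "b = nat (int i + \<bar>e\<bar> - e)"
  define I where "I = i + a"
  have "q * M ^ I = (q * M ^ i) * M ^ a" by (simp add: I_def power_add)
  then have 1: "q * M ^ I = of_int (j * int (Suc n) ^ a)" by (simp only: ij(1) of_int_mult Mk)
  have "M powi (- e) * M ^ I = M powi (- e + int I)" using M power_int_add[of M "- e" "int I"] by (simp only: power_int_of_nat simp_thms)
  also have "- e + int I = int (i' + b)" by (simp add: I_def a_def b_def)
  also have "M powi int (i' + b) = M ^ i' * M ^ b" by (simp only: power_int_of_nat power_add)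
  finally have "q' * M powi (- e) * M ^ I = (q' * M ^ i') * M ^ b" by (simp only: mult.assoc)
  then have 2: "q' * M powi (- e) * M ^ I = of_int (j' * int (Suc n) ^ b)" by (simp only: ij(2) of_int_mult Mk)
  have "(q + q' * M powi (- e)) * M ^ I = of_int (j * int (Suc n) ^ a + j' * int (Suc n) ^ b)"
    by (simp only: distrib_right 1 2 of_int_add)
  then have "residue n (q + q' * M powi (- e)) = (j * int (Suc n) ^ a + j' * int (Suc n) ^ b) mod int n"
    unfolding M_def by (rule residue_eq)
  also have "\<dots> = (j mod int n + j' mod int n) mod int n"
    by (rule mod_add_cong) (simp_all only: mult_power_Suc_mod mod_mod_trivial)
  finally show ?thesis using residue_eq[OF ij(1)[unfolded M_def]] residue_eq[OF ij(2)[unfolded M_def]] by (simp only: M_def)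
qed

lemma residue_bounds:
  assumes "n > 0" "q \<in> localized_ints (Suc n)"
  shows "0 \<le> residue n q \<and> residue n q < int n"
proof -
  obtain i j where "q * real (Suc n) ^ i = of_int j" using assms(2) by (auto simp: localized_ints_def Ints_def)
  then show ?thesis using residue_eq[of q n i j] assms(1) by simp
qed

lemma (in mapping_torus) Eilenberg_MacLane:
  fixes H :: "('g, 'b) monoid_scheme"
  assumes "bsz m \<cong> H"
  shows "has_finite_classifying_space H"
  unfolding has_finite_classifying_space_def Eilenberg_MacLane_1_def
proof (intro exI conjI bexI allI impI)
  show "finite_CW_complex (top_of_set X)" by (rule CW)
  show "path_connected_space (top_of_set X)" by (rule path_connected_X)
  show "fundamental_group (top_of_set X) (P (0, 0, 0)) \<cong> H"
    using fundamental_group_iso assms by (rule iso_trans)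
  show "trivial_homotopy_group k (top_of_set X) (P (0, 0, 0))" if "2 \<le> k" for k
    using that by (rule trivial_higher_homotopy)
qed simp

theorem proposition5p5:
  fixes n :: nat
  assumes "n > 1"
  shows "\<exists>G :: nat monoid.
           group G \<and> finitely_presented G \<and> torsion_free G \<and> has_finite_classifying_space G \<and>
           (\<exists>x\<in>carrier (sidki_double G). group.ord (sidki_double G) x = n) \<and>
           only_trivial_idempotents (complex_group_ring G)"
proof -
  define B where "B = bsz (Suc n)"
  have bs: "baumslag_solitar (Suc n)" and mt: "mapping_torus (Suc n)" by unfold_locales simp_all
  interpret B: group B unfolding B_def by (rule group_bsz) simp
  obtain G :: "nat monoid" and f where G: "group G" and f: "f \<in> iso B G"
    using B.exists_nat_copy countable_carrier_bsz[of "Suc n"] unfolding B_def by auto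
  interpret G: group G by (rule G)
  interpret f: group_hom B G f
    using f by unfold_locales (simp add: iso_iff)
  define \<psi> where "\<psi> = inv_into (carrier B) f"
  have \<psi>: "\<psi> \<in> iso G B" unfolding \<psi>_def using f by (rule B.iso_set_sym)
  interpret \<psi>: group_hom G B \<psi>
    using \<psi> by unfold_locales (simp add: iso_iff)
  have \<psi>f: "\<psi> (f x) = x" if "x \<in> carrier B" for x
    using f that by (simp add: \<psi>_def iso_iff)
  have BG: "B \<cong> G" using f by (rule is_isoI)
  have fp: "finitely_presented G"
  proof -
    obtain S :: "nat set" and R where "finite S" "finite R" "R \<subseteq> carrier (free_group S)" "B \<cong> presented_group S R"
      using baumslag_solitar.finitely_presented_bsz[OF bs] unfolding finitely_presented_def B_def by blast
    moreover from this(4) have "G \<cong> presented_group S R" by (rule iso_trans[OF B.iso_sym[OF BG]])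
    ultimately show ?thesis unfolding finitely_presented_def by blast
  qed
  have space: "has_finite_classifying_space G"
    using BG unfolding B_def by (rule mapping_torus.Eilenberg_MacLane[OF mt])
  have inj: "inj_on \<psi> (carrier G)" using \<psi> by (simp add: iso_iff)
  \<comment> \<open>The lexicographic order of the triples, pulled back to the copy on natural
    numbers.\<close>
  interpret O: ordered_group G "\<lambda>x y. (\<lambda>(q, e, l) (q', e', l'). e < e' \<or> e = e' \<and> (q < q' \<or> q = q' \<and> l < l')) (\<psi> x) (\<psi> y)"
    by (rule \<psi>.ordered_group_vimage[OF _ inj]) (unfold B_def, rule ordered_group_bsz, simp)
  interpret S: sidki G by unfold_locales
  have dy: "fst (\<psi> x) \<in> localized_ints (Suc n)" if "x \<in> carrier G" for x
    using \<psi>.hom_closed[OF that] unfolding B_def by (cases "\<psi> x") auto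
  have mem: "(1, 0, 0) \<in> carrier B" "(0, 1, 0) \<in> carrier B" "(0, 0, 1) \<in> carrier B"
    by (simp_all add: B_def Ints_localized_ints)
  have "\<exists>x\<in>carrier (sidki_double G). group.ord (sidki_double G) x = n"
  \<comment> \<open>\<open>\<mu>\<close> and \<open>\<nu>\<close> are the exponents of
    \<open>a\<close> and \<open>c\<close> modulo \<open>n\<close>; the relation with exponent
    \<open>Suc n\<close> is the defining one of BS(1, n + 1).\<close>
  proof (rule S.exists_element_of_order[where \<mu> = "\<lambda>x. residue n (fst (\<psi> x))" and
        \<nu> = "\<lambda>x. snd (snd (\<psi> x)) mod int n" and a = "f (1, 0, 0)" and t = "f (0, 1, 0)" and c = "f (0, 0, 1)"])
    show "1 < n" by fact
  next
    fix g assume g: "g \<in> carrier G"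
    show "0 \<le> residue n (fst (\<psi> g)) \<and> residue n (fst (\<psi> g)) < int n"
      using residue_bounds[OF _ dy[OF g]] assms by simp
    show "0 \<le> snd (snd (\<psi> g)) mod int n \<and> snd (snd (\<psi> g)) mod int n < int n" using assms by simp
    have "\<psi> g \<otimes>\<^bsub>B\<^esub> (0, 0, 1) = (0, 0, 1) \<otimes>\<^bsub>B\<^esub> \<psi> g" by (cases "\<psi> g") (simp add: B_def)
    then have "\<psi> (g \<otimes>\<^bsub>G\<^esub> f (0, 0, 1)) = \<psi> (f (0, 0, 1) \<otimes>\<^bsub>G\<^esub> g)"
      using g mem by (simp add: \<psi>f)
    then show "g \<otimes>\<^bsub>G\<^esub> f (0, 0, 1) = f (0, 0, 1) \<otimes>\<^bsub>G\<^esub> g"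
      by (rule inj_onD[OF inj]) (use g mem in simp_all)
    fix h assume h: "h \<in> carrier G"
    obtain q e l q' e' l' where qe: "\<psi> g = (q, e, l)" "\<psi> h = (q', e', l')" by (cases "\<psi> g"; cases "\<psi> h")
    then have gh: "\<psi> (g \<otimes>\<^bsub>G\<^esub> h) = (q + q' * real (Suc n) powi (- e), e + e', l + l')"
      using g h by (simp add: B_def del: of_nat_Suc)
    show "residue n (fst (\<psi> (g \<otimes>\<^bsub>G\<^esub> h))) = (residue n (fst (\<psi> g)) + residue n (fst (\<psi> h))) mod int n"
      unfolding gh qe fst_conv using dy[OF g] dy[OF h] qe by (intro residue_add) simp_all
    show "snd (snd (\<psi> (g \<otimes>\<^bsub>G\<^esub> h))) mod int n =
        (snd (snd (\<psi> g)) mod int n + snd (snd (\<psi> h)) mod int n) mod int n"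
      unfolding gh qe by (simp add: mod_simps)
  next
    show "f (1, 0, 0) \<in> carrier G" "f (0, 0, 1) \<in> carrier G" "f (0, 1, 0) \<in> carrier G"
      using mem by simp_all
    show "residue n (fst (\<psi> (f (1, 0, 0)))) = 1"
      using residue_eq[of 1 n 0 1] assms by (simp add: \<psi>f mem)
    show "residue n (fst (\<psi> (f (0, 0, 1)))) = 0"
      using residue_eq[of 0 n 0 0] by (simp add: \<psi>f mem)
    show "snd (snd (\<psi> (f (1, 0, 0)))) mod int n = 0" "snd (snd (\<psi> (f (0, 0, 1)))) mod int n = 1"
      using assms by (simp_all add: \<psi>f mem)
    have "(1, 0, 0) \<otimes>\<^bsub>B\<^esub> (0, 1, 0) = (0, 1, 0) \<otimes>\<^bsub>B\<^esub> (1, 0, 0) [^]\<^bsub>B\<^esub> Suc n"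
      unfolding B_def by (rule baumslag_solitar.relation_bsz[OF bs])
    then have "f ((1, 0, 0) \<otimes>\<^bsub>B\<^esub> (0, 1, 0)) = f ((0, 1, 0) \<otimes>\<^bsub>B\<^esub> (1, 0, 0) [^]\<^bsub>B\<^esub> Suc n)" by (simp only:)
    then show "f (1, 0, 0) \<otimes>\<^bsub>G\<^esub> f (0, 1, 0) = f (0, 1, 0) \<otimes>\<^bsub>G\<^esub> f (1, 0, 0) [^]\<^bsub>G\<^esub> Suc n"
      by (simp only: f.hom_mult f.hom_nat_pow B.nat_pow_closed mem)
  qed
  then show ?thesis
    using G fp space O.torsion_free O.only_trivial_idempotents by blast
qed

end
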